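(* Let $\mathfrak g=\mathfrak{so}(2n,\mathbb C)$ and $G=\mathrm{SO}(2n)$ with $n\ge2$, and let $k\ge0$, $1\le p\le n$ be integers. Let $\mu\in P(G)$. If $r(\mu):=(k+p-\|\mu\|)/2$ is a non-negative integer, then $$m_{\pi_{k,p}}(\mu)=\sum_{j=1}^{p}(-1)^{j-1}\sum_{t=0}^{\lfloor\frac{p-j}{2}\rfloor}\binom{n-p+j+2t}{t}\sum_{\beta=0}^{p-j-2t}2^{p-j-2t-\beta}\binom{n-Z(\mu)}{\beta}\binom{Z(\mu)}{p-j-2t-\beta}\sum_{\alpha=0}^{\beta}\binom{\beta}{\alpha}\sum_{i=0}^{j-1}\binom{r(\mu)-i-p+\alpha+t+j+n-2}{n-2}.$$ Otherwise $m_{\pi_{k,p}}(\mu)=0$. Moreover, $m_{\pi_{k,p}}(\mu)=0$ for every $\mu\in P(\mathfrak g)\setminus P(G)$.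
   Context: $\mathfrak g=\mathfrak{so}(2n,\mathbb C)$ (type $D_n$) has standard basis $\varepsilon_1,\dots,\varepsilon_n$ of $\mathfrak h^*$ and positive roots $\varepsilon_i\pm\varepsilon_j$ ($i<j$). The weight lattice $P(\mathfrak g)$ consists of $\sum a_i\varepsilon_i$ with either all $a_i\in\mathbb Z$ or all $a_i\in\tfrac12+\mathbb Z$. The lattice $P(G)$ of $\mathrm{SO}(2n)$-integral weights is $\mathbb Z\varepsilon_1\oplus\dots\oplus\mathbb Z\varepsilon_n$. The fundamental weights are $\omega_p=\varepsilon_1+\dots+\varepsilon_p$ for $p\le n-2$, $\omega_{n-1}=\tfrac12(\varepsilon_1+\dots+\varepsilon_{n-1}-\varepsilon_n)$ and $\omega_n=\tfrac12(\varepsilon_1+\dots+\varepsilon_n)$. $\pi_\lambda$ is the irreducible representation with highest weight $\lambda$, and $m_\pi(\mu)$ is the weight multiplicity. Define $\pi_{k,p}=\pi_{k\omega_1+\omega_p}$ for $1\le p\le n-2$, $\pi_{k,n-1}=\pi_{k\omega_1+\omega_{n-1}+\omega_n}$, and $\pi_{k,n}=\pi_{k\omega_1+2\omega_{n-1}}\oplus\pi_{k\omega_1+2\omega_n}$. For $\mu=\sum a_j\varepsilon_j$, set $\|\mu\|=\sum|a_j|$ and $Z(\mu)=\#\{j:a_j=0\}$. Convention: $\binom{b}{a}=0$ if $a<0$ or $b<a$.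
   Formalization: In the definition of π_{k,p}, kω₁ is read as kε₁; this changes only n=2, where the listed ω₁=(ε₁−ε₂)/2 makes the claim false (k=p=1: highest weight (3/2,−1/2) lies outside P(G) but has multiplicity 1). *)

theory Defs
  imports Complex_Main
begin

text \<open>Complex square matrices are functions nat => nat => complex; the matrices
  of size 2n have their entries indexed by 1..2n (entries outside are zero).
  The symmetric bilinear form defining so(2n,C) is J = [[0,I_n],[I_n,0]], i.e.
  index i is paired with index i+n (1 <= i <= n).\<close>

type_synonym cmat = "nat \<Rightarrow> nat \<Rightarrow> complex"

definition mat_supp :: "nat \<Rightarrow> cmat \<Rightarrow> bool" where
  "mat_supp n X \<longleftrightarrow> (\<forall>i j. X i j \<noteq> 0 \<longrightarrow> i \<in> {1..2*n} \<and> j \<in> {1..2*n})"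

definition mmul :: "nat \<Rightarrow> cmat \<Rightarrow> cmat \<Rightarrow> cmat" where
  "mmul n X Y = (\<lambda>i j. \<Sum>l\<in>{1..2*n}. X i l * Y l j)"

definition mtrans :: "cmat \<Rightarrow> cmat" where
  "mtrans X = (\<lambda>i j. X j i)"

definition madd :: "cmat \<Rightarrow> cmat \<Rightarrow> cmat" where
  "madd X Y = (\<lambda>i j. X i j + Y i j)"

definition msmult :: "complex \<Rightarrow> cmat \<Rightarrow> cmat" where
  "msmult c X = (\<lambda>i j. c * X i j)"

definition bracket :: "nat \<Rightarrow> cmat \<Rightarrow> cmat \<Rightarrow> cmat" where
  "bracket n X Y = (\<lambda>i j. mmul n X Y i j - mmul n Y X i j)"

definition Jform :: "nat \<Rightarrow> cmat" where
  "Jform n = (\<lambda>i j. if (i \<in> {1..n} \<and> j = i + n) \<or> (j \<in> {1..n} \<and> i = j + n) then 1 else 0)"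

definition so :: "nat \<Rightarrow> cmat set" where
  "so n = {X. mat_supp n X \<and> (\<forall>i j. mmul n (mtrans X) (Jform n) i j + mmul n (Jform n) X i j = 0)}"

text \<open>Cartan subalgebra: the diagonal matrices in so(2n,C), i.e. diag(h_1..h_n,-h_1..-h_n).
  eps i H = h_i.\<close>
definition cartan :: "nat \<Rightarrow> cmat set" where
  "cartan n = {H \<in> so n. \<forall>i j. i \<noteq> j \<longrightarrow> H i j = 0}"

definition wt :: "nat \<Rightarrow> (nat \<Rightarrow> real) \<Rightarrow> cmat \<Rightarrow> complex" where
  "wt n a H = (\<Sum>i\<in>{1..n}. complex_of_real (a i) * H i i)"

definition pos_root_vecs :: "nat \<Rightarrow> cmat set" where
  "pos_root_vecs n = {X \<in> so n. \<exists>i j s. 1 \<le> i \<and> i < j \<and> j \<le> n \<and> (s = 1 \<or> s = -1) \<and>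
      (\<forall>H\<in>cartan n. bracket n H X = msmult (H i i + s * H j j) X)}"

definition lie_rep :: "nat \<Rightarrow> (complex \<Rightarrow> 'v::ab_group_add \<Rightarrow> 'v) \<Rightarrow> (cmat \<Rightarrow> 'v \<Rightarrow> 'v) \<Rightarrow> bool" where
  "lie_rep n sc \<rho> \<longleftrightarrow>
     vector_space sc \<and>
     (\<exists>B. finite B \<and> module.span sc B = UNIV) \<and>
     (\<forall>X\<in>so n. Vector_Spaces.linear sc sc (\<rho> X)) \<and>
     (\<forall>X\<in>so n. \<forall>Y\<in>so n. \<forall>v. \<rho> (madd X Y) v = \<rho> X v + \<rho> Y v) \<and>
     (\<forall>X\<in>so n. \<forall>c v. \<rho> (msmult c X) v = sc c (\<rho> X v)) \<and>
     (\<forall>X\<in>so n. \<forall>Y\<in>so n. \<forall>v. \<rho> (bracket n X Y) v = \<rho> X (\<rho> Y v) - \<rho> Y (\<rho> X v))"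

definition irreducible_rep :: "nat \<Rightarrow> (complex \<Rightarrow> 'v::ab_group_add \<Rightarrow> 'v) \<Rightarrow> (cmat \<Rightarrow> 'v \<Rightarrow> 'v) \<Rightarrow> bool" where
  "irreducible_rep n sc \<rho> \<longleftrightarrow> lie_rep n sc \<rho> \<and> (\<exists>v::'v. v \<noteq> 0) \<and>
     (\<forall>W. module.subspace sc W \<and> (\<forall>X\<in>so n. \<forall>w\<in>W. \<rho> X w \<in> W) \<longrightarrow> W = {0} \<or> W = UNIV)"

definition weight_space :: "nat \<Rightarrow> (complex \<Rightarrow> 'v \<Rightarrow> 'v) \<Rightarrow> (cmat \<Rightarrow> 'v \<Rightarrow> 'v) \<Rightarrow> (nat \<Rightarrow> real) \<Rightarrow> 'v set" where
  "weight_space n sc \<rho> mu = {v. \<forall>H\<in>cartan n. \<rho> H v = sc (wt n mu H) v}"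

definition wmult :: "nat \<Rightarrow> (complex \<Rightarrow> 'v::ab_group_add \<Rightarrow> 'v) \<Rightarrow> (cmat \<Rightarrow> 'v \<Rightarrow> 'v) \<Rightarrow> (nat \<Rightarrow> real) \<Rightarrow> nat" where
  "wmult n sc \<rho> mu = vector_space.dim sc (weight_space n sc \<rho> mu)"

definition irrep_hw :: "nat \<Rightarrow> (complex \<Rightarrow> 'v::ab_group_add \<Rightarrow> 'v) \<Rightarrow> (cmat \<Rightarrow> 'v \<Rightarrow> 'v) \<Rightarrow> (nat \<Rightarrow> real) \<Rightarrow> bool" where
  "irrep_hw n sc \<rho> lam \<longleftrightarrow> irreducible_rep n sc \<rho> \<and>
     (\<exists>v. v \<noteq> 0 \<and> v \<in> weight_space n sc \<rho> lam \<and> (\<forall>X\<in>pos_root_vecs n. \<rho> X v = 0))"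

definition eps :: "nat \<Rightarrow> nat \<Rightarrow> real" where
  "eps i = (\<lambda>j. if j = i then 1 else 0)"

definition omega :: "nat \<Rightarrow> nat \<Rightarrow> nat \<Rightarrow> real" where
  "omega n p = (\<lambda>j. if p \<le> n - 2 then (if 1 \<le> j \<and> j \<le> p then 1 else 0)
                   else if p = n - 1 then (if 1 \<le> j \<and> j \<le> n - 1 then 1/2 else if j = n then -1/2 else 0)
                   else (if 1 \<le> j \<and> j \<le> n then 1/2 else 0))"

definition wadd :: "(nat \<Rightarrow> real) \<Rightarrow> (nat \<Rightarrow> real) \<Rightarrow> nat \<Rightarrow> real" where
  "wadd a b = (\<lambda>j. a j + b j)"

definition wscale :: "real \<Rightarrow> (nat \<Rightarrow> real) \<Rightarrow> nat \<Rightarrow> real" where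
  "wscale c a = (\<lambda>j. c * a j)"

definition in_Pg :: "nat \<Rightarrow> (nat \<Rightarrow> real) \<Rightarrow> bool" where
  "in_Pg n mu \<longleftrightarrow> (\<forall>j\<in>{1..n}. mu j \<in> \<int>) \<or> (\<forall>j\<in>{1..n}. mu j - 1/2 \<in> \<int>)"

definition in_PG :: "nat \<Rightarrow> (nat \<Rightarrow> real) \<Rightarrow> bool" where
  "in_PG n mu \<longleftrightarrow> (\<forall>j\<in>{1..n}. mu j \<in> \<int>)"

definition wnorm :: "nat \<Rightarrow> (nat \<Rightarrow> real) \<Rightarrow> real" where
  "wnorm n mu = (\<Sum>j\<in>{1..n}. \<bar>mu j\<bar>)"

definition Zc :: "nat \<Rightarrow> (nat \<Rightarrow> real) \<Rightarrow> nat" where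
  "Zc n mu = card {j\<in>{1..n}. mu j = 0}"

definition binom :: "int \<Rightarrow> int \<Rightarrow> int" where
  "binom b a = (if a < 0 \<or> b < a then 0 else int (nat b choose nat a))"

text \<open>pi_{k,p}: for p < n it is the irreducible representation rho with highest weight
  k omega_1 + omega_p (p <= n-2) resp. k omega_1 + omega_{n-1} + omega_n (p = n-1);
  for p = n it is the direct sum of rho (highest weight k omega_1 + 2 omega_{n-1}) and
  sigma (highest weight k omega_1 + 2 omega_n).  Here k omega_1 is read as k eps_1.\<close>
definition is_pi_kp :: "nat \<Rightarrow> nat \<Rightarrow> nat \<Rightarrow> (complex \<Rightarrow> 'v::ab_group_add \<Rightarrow> 'v) \<Rightarrow> (cmat \<Rightarrow> 'v \<Rightarrow> 'v)
     \<Rightarrow> (complex \<Rightarrow> 'w::ab_group_add \<Rightarrow> 'w) \<Rightarrow> (cmat \<Rightarrow> 'w \<Rightarrow> 'w) \<Rightarrow> bool" where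
  "is_pi_kp n k p sc \<rho> sc' \<sigma> \<longleftrightarrow>
     (if p \<le> n - 2 then irrep_hw n sc \<rho> (wadd (wscale (real k) (eps 1)) (omega n p))
      else if p = n - 1 then irrep_hw n sc \<rho> (wadd (wscale (real k) (eps 1)) (wadd (omega n (n-1)) (omega n n)))
      else irrep_hw n sc \<rho> (wadd (wscale (real k) (eps 1)) (wscale 2 (omega n (n-1)))) \<and>
           irrep_hw n sc' \<sigma> (wadd (wscale (real k) (eps 1)) (wscale 2 (omega n n))))"

definition mult_pi_kp :: "nat \<Rightarrow> nat \<Rightarrow> (complex \<Rightarrow> 'v::ab_group_add \<Rightarrow> 'v) \<Rightarrow> (cmat \<Rightarrow> 'v \<Rightarrow> 'v)
     \<Rightarrow> (complex \<Rightarrow> 'w::ab_group_add \<Rightarrow> 'w) \<Rightarrow> (cmat \<Rightarrow> 'w \<Rightarrow> 'w) \<Rightarrow> (nat \<Rightarrow> real) \<Rightarrow> nat" where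
  "mult_pi_kp n p sc \<rho> sc' \<sigma> mu =
     (if p < n then wmult n sc \<rho> mu else wmult n sc \<rho> mu + wmult n sc' \<sigma> mu)"

definition mult_formula :: "nat \<Rightarrow> nat \<Rightarrow> int \<Rightarrow> nat \<Rightarrow> int" where
  "mult_formula n p r Z =
    (\<Sum>j=1..p. (-1)^(j-1) *
      (\<Sum>t=0..(p-j) div 2. binom (int (n-p+j+2*t)) (int t) *
        (\<Sum>\<beta>=0..p-j-2*t. 2^(p-j-2*t-\<beta>) * binom (int n - int Z) (int \<beta>) * binom (int Z) (int (p-j-2*t-\<beta>)) *
          (\<Sum>\<alpha>=0..\<beta>. binom (int \<beta>) (int \<alpha>) *
            (\<Sum>i=0..j-1. binom (r - int i - int p + int \<alpha> + int t + int j + int n - 2) (int n - 2))))))"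

end

(* The irreducible module pi_{k,p} is realised as the space M(k,p) of closed and coclosed polynomial
   differential p-forms on C^(2n) with coefficients homogeneous of degree k, on which the Casimir
   operator is a scalar.  If U is a submodule of M(k,p) and w is a weight vector outside U of maximal
   height, then w is a highest weight vector modulo U; the Casimir value then forces its weight to be
   the top one (for p = n also the top one with the last sign reversed), so that M(k,p) is irreducible
   for p < n and the sum of two irreducibles for p = n.  An abstract highest weight module V is
   embedded into M(k,p) by means of the submodule of V x M(k,p) generated by the pair of highest weight
   vectors.

   The character of M(k,p) comes from exactness: d is exact by the homotopy with contraction along the
   Euler field, the codifferential by the homotopy with its adjoint, and the codifferential maps closed
   forms onto coclosed forms because the Laplacian is surjective on polynomials.  Hence M(k,p) is the
   alternating sum over j of (Sym^(k+j) - Sym^(k-j)) tensor Lambda^(p-j), and counting the monomials of a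
   given weight gives the formula. *)

theory Submission
  imports Defs "HOL-Library.Function_Algebras" "HOL-Library.Product_Plus"
begin

section \<open>Linear operators on polynomial differential forms\<close>

text \<open>Working modulo an arbitrary submodule U takes the place of complete reducibility: with U
  = 0 it shows that a nonzero submodule of M(k,p) contains a top monomial, with a given U that
  containing the top monomials forces U to be everything. Equal Casimir values alone do not
  determine a dominant weight. The missing information is the bound |\<mu>_1| + ... + |\<mu>_j|
  \<le> k + min(j,p) for the weights of M(k,p); summation by parts then writes the difference of the
  two Casimir values as a sum of non-negative terms. The Casimir operator is a scalar on M(k,p)
  because it is a polynomial in the two degrees plus terms in which d, the codifferential or the
  Laplacian acts first. The condition p \<le> n keeps positive the number by which the homotopy for
  the codifferential divides. In the formula, the innermost sum is the telescoped difference of the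
  counts for Sym^(k+j) and Sym^(k-j), and the powers of 2 come from the positions where \<mu>
  vanishes: there both signs of a differential lengthen the remaining weight equally.\<close>

text \<open>A polynomial differential form is given by its coefficients: the index (e, S) stands for the
  monomial with exponents e times the exterior product of the differentials in S.\<close>

type_synonym idx = "(nat \<Rightarrow> nat) \<times> nat set"
type_synonym form = "idx \<Rightarrow> complex"

definition fscale :: "complex \<Rightarrow> form \<Rightarrow> form" where
  "fscale c f = (\<lambda>i. c * f i)"

lemma fscale_apply [simp]: "fscale c f i = c * f i"
  by (simp add: fscale_def)

text \<open>Linearity is bundled into the type so that composition becomes the product of a ring;
  the identities between operators are then ring calculations instead of statements about
  coefficients.\<close>

typedef lop = "{T :: form \<Rightarrow> form. (\<forall>f g. T (f + g) = T f + T g) \<and> (\<forall>c f. T (fscale c f) = fscale c (T f))}"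
  morphisms app Lop
  by (rule exI[of _ "\<lambda>f. 0"]) (auto simp: fun_eq_iff)

setup_lifting type_definition_lop

lemma app_add [simp]: "app T (f + g) = app T f + app T g"
  and app_scale [simp]: "app T (fscale c f) = fscale c (app T f)"
  using app[of T] by auto

lemma app_0 [simp]: "app T 0 = 0"
  using app_add[of T 0 0] by simp

lemma app_minus [simp]: "app T (- f) = - app T f"
  using app_add[of T f "- f"] by (simp add: eq_neg_iff_add_eq_0 add.commute)

lemma app_diff [simp]: "app T (f - g) = app T f - app T g"
  using app_add[of T f "- g"] by simp

lemma app_sum: "app T (sum f A) = (\<Sum>i\<in>A. app T (f i))"
  by (induction A rule: infinite_finite_induct)
    (simp_all only: sum.infinite sum.empty sum.insert app_0 app_add not_False_eq_True)

instantiation lop :: ring_1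
begin

lift_definition zero_lop :: lop is "\<lambda>f. 0" by (auto simp: fun_eq_iff)
lift_definition one_lop :: lop is "\<lambda>f. f" by auto
lift_definition plus_lop :: "lop \<Rightarrow> lop \<Rightarrow> lop" is "\<lambda>S T f. S f + T f"
  by (auto simp: fun_eq_iff algebra_simps)
lift_definition minus_lop :: "lop \<Rightarrow> lop \<Rightarrow> lop" is "\<lambda>S T f. S f - T f"
  by (auto simp: fun_eq_iff algebra_simps)
lift_definition uminus_lop :: "lop \<Rightarrow> lop" is "\<lambda>T f. - T f"
  by (auto simp: fun_eq_iff algebra_simps)
lift_definition times_lop :: "lop \<Rightarrow> lop \<Rightarrow> lop" is "\<lambda>S T f. S (T f)"
  by auto

instance
proof
  show "(0::lop) \<noteq> 1"
  proof
    assume "(0::lop) = 1"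
    then have "app 0 (\<lambda>_. 1) = app 1 (\<lambda>_. 1)" by simp
    then show False by (simp add: zero_lop.rep_eq one_lop.rep_eq fun_eq_iff)
  qed
qed (transfer; auto simp: fun_eq_iff algebra_simps)+

end

lemma app_simps [simp]:
  "app 0 f = 0" "app 1 f = f" "app (S + T) f = app S f + app T f"
  "app (S - T) f = app S f - app T f" "app (- T) f = - app T f" "app (S * T) f = app S (app T f)"
  by (simp_all add: zero_lop.rep_eq one_lop.rep_eq plus_lop.rep_eq minus_lop.rep_eq
      uminus_lop.rep_eq times_lop.rep_eq)

lemma app_sum_op: "app (sum T A) f = (\<Sum>i\<in>A. app (T i) f)"
  by (induction A rule: infinite_finite_induct)
    (simp_all only: sum.infinite sum.empty sum.insert app_simps not_False_eq_True)

lemma app_of_nat [simp]: "app (of_nat m) f = fscale (of_nat m) f"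
  by (induction m) (auto simp: fun_eq_iff algebra_simps)

lemma lop_eqI: "(\<And>f. app S f = app T f) \<Longrightarrow> S = T"
  by (metis app_inject ext)

text \<open>The coefficients are complex numbers, so there is no 2-torsion. This is what makes
  antisymmetric double sums vanish later on.\<close>

lemma lop_double_0: "T + T = 0 \<Longrightarrow> T = (0::lop)"
proof (rule lop_eqI)
  fix f assume "T + T = 0"
  then have "app T f + app T f = 0" by (metis app_simps(1,3))
  then show "app T f = app 0 f" by (simp add: fun_eq_iff)
qed

lift_definition cop :: "complex \<Rightarrow> lop" is fscale
  by (auto simp: fun_eq_iff algebra_simps)

lemma app_cop [simp]: "app (cop c) f = fscale c f"
  by (simp add: cop.rep_eq)

lemma cop_add: "cop (a + b) = cop a + cop b"
  and cop_mult: "cop (a * b) = cop a * cop b"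
  and cop_0 [simp]: "cop 0 = 0" and cop_1 [simp]: "cop 1 = 1"
  and cop_diff: "cop (a - b) = cop a - cop b"
  by (auto intro!: lop_eqI simp: fun_eq_iff algebra_simps)

lemma cop_sum: "cop (sum f A) = (\<Sum>i\<in>A. cop (f i))"
  by (induction A rule: infinite_finite_induct) (auto simp: cop_add)

text \<open>The sign for moving the differential with index a past those of smaller index, the
  factors of an exterior product being ordered by index.\<close>

definition sg :: "nat \<Rightarrow> nat set \<Rightarrow> complex" where
  "sg a S = (-1) ^ card {b \<in> S. b < a}"

text \<open>X and D are multiplication by and differentiation in a coordinate, Th and Dt exterior
  multiplication and contraction.\<close>

lift_definition X :: "nat \<Rightarrow> lop" is
  "\<lambda>a f (e, S). if e a > 0 then f (e(a := e a - 1), S) else 0"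
  by (auto simp: fun_eq_iff)
lift_definition D :: "nat \<Rightarrow> lop" is
  "\<lambda>a f (e, S). of_nat (e a + 1) * f (e(a := e a + 1), S)"
  by (auto simp: fun_eq_iff algebra_simps)
lift_definition Th :: "nat \<Rightarrow> lop" is
  "\<lambda>a f (e, S). if a \<in> S then sg a S * f (e, S - {a}) else 0"
  by (auto simp: fun_eq_iff algebra_simps)
lift_definition Dt :: "nat \<Rightarrow> lop" is
  "\<lambda>a f (e, S). if a \<in> S then 0 else sg a S * f (e, insert a S)"
  by (auto simp: fun_eq_iff algebra_simps)

lemmas basic_app = X.rep_eq D.rep_eq Th.rep_eq Dt.rep_eq

lemma lop_eqI2: "(\<And>f e S. app P f (e, S) = app Q f (e, S)) \<Longrightarrow> P = Q"
  by (rule lop_eqI) (auto simp: fun_eq_iff)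

lemma X_app: "app (X a) f (e, S) = (if e a > 0 then f (e(a := e a - 1), S) else 0)"
  and D_app: "app (D a) f (e, S) = of_nat (e a + 1) * f (e(a := e a + 1), S)"
  and Th_app: "app (Th a) f (e, S) = (if a \<in> S then sg a S * f (e, S - {a}) else 0)"
  and Dt_app: "app (Dt a) f (e, S) = (if a \<in> S then 0 else sg a S * f (e, insert a S))"
  by (simp_all add: basic_app)

lemmas basic_eval = X_app D_app Th_app Dt_app

lemma upd_back: "e a = m \<Longrightarrow> e(a := m) = e"
  by auto

section \<open>Commutation and anticommutation relations of the generators\<close>

lemma XX: "X a * X b = X b * X a"
  by (cases "a = b"; intro lop_eqI2) (auto simp: basic_eval fun_upd_twist)

lemma DD: "D a * D b = D b * D a"
  by (cases "a = b"; intro lop_eqI2) (auto simp: basic_eval fun_upd_twist)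

lemma DX: "D a * X b = X b * D a + (if a = b then 1 else 0)"
proof (cases "a = b")
  case True
  show ?thesis unfolding True
    by (intro lop_eqI2) (auto simp: basic_eval upd_back algebra_simps)
next
  case False
  then show ?thesis
    by (intro lop_eqI2) (auto simp: basic_eval fun_upd_twist)
qed

lemma sg_sq: "sg a S * sg a S = 1"
  by (simp add: sg_def flip: power_add mult_2)

lemma sg_insert:
  assumes "b \<notin> S"
  shows "sg a (insert b S) = (if b < a then - sg a S else sg a S)"
proof -
  have "{c \<in> insert b S. c < a} = (if b < a then insert b {c \<in> S. c < a} else {c \<in> S. c < a})"
    by auto
  \<comment> \<open>S may be infinite; only its part below a enters the sign.\<close>
  moreover have "finite {c \<in> S. c < a}" by (rule finite_subset[of _ "{..<a}"]) auto
  ultimately show ?thesis using assms by (auto simp: sg_def)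
qed

lemma sg_delete:
  assumes "b \<in> S"
  shows "sg a (S - {b}) = (if b < a then - sg a S else sg a S)"
  using sg_insert[of b "S - {b}" a] assms by (auto simp: insert_absorb split: if_splits)

lemma ThTh: "Th a * Th b = - (Th b * Th a)"
proof (cases "a = b")
  case True
  then show ?thesis by (intro lop_eqI2) (auto simp: basic_eval)
next
  case False
  have "S - {a} - {b} = S - {b} - {a}" for S :: "nat set" by auto
  with False show ?thesis
    by (intro lop_eqI2) (auto simp: basic_eval sg_delete)
qed

lemma DtDt: "Dt a * Dt b = - (Dt b * Dt a)"
proof (cases "a = b")
  case True
  then show ?thesis by (intro lop_eqI2) (auto simp: basic_eval)
next
  case False
  then show ?thesis
    by (intro lop_eqI2) (auto simp: basic_eval sg_insert insert_commute)
qed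

lemma DtTh: "Dt a * Th b = (if a = b then 1 else 0) - Th b * Dt a"
proof (cases "a = b")
  case True
  show ?thesis unfolding True
    by (intro lop_eqI2)
      (auto simp: basic_eval sg_insert sg_delete sg_sq insert_absorb mult.assoc[symmetric])
next
  case False
  then have "insert a S - {b} = insert a (S - {b})" for S by auto
  with False show ?thesis
    by (intro lop_eqI2) (auto simp: basic_eval sg_insert sg_delete)
qed

lemma XTh: "Th a * X b = X b * Th a" and XDt: "Dt a * X b = X b * Dt a"
  and DTh: "Th a * D b = D b * Th a" and DDt: "Dt a * D b = D b * Dt a"
  by (intro lop_eqI2, auto simp: basic_eval)+

section \<open>The general linear action and the operators of Hodge type\<close>

text \<open>The Lie derivative along the vector field x_a d/dx_b: the first summand acts on the
  coefficients, the second on the differentials. It represents the matrix unit E_ab.\<close>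

definition T :: "nat \<Rightarrow> nat \<Rightarrow> lop" where
  "T a b = X a * D b + Th a * Dt b"

lemma T_X: "T a b * X c = X c * T a b + (if b = c then X a else 0)"
proof -
  have "T a b * X c = X a * (D b * X c) + Th a * (Dt b * X c)"
    by (simp add: T_def algebra_simps)
  also have "\<dots> = X a * X c * D b + (if b = c then X a else 0) + (Th a * X c) * Dt b"
    by (simp add: DX XDt algebra_simps)
  also have "\<dots> = X c * T a b + (if b = c then X a else 0)"
    by (simp add: T_def XTh XX[of a c] algebra_simps)
  finally show ?thesis .
qed

lemma T_D: "T a b * D c = D c * T a b - (if a = c then D b else 0)"
proof -
  have "D c * T a b = (D c * X a) * D b + (D c * Th a) * Dt b"
    by (simp add: T_def algebra_simps)
  also have "\<dots> = X a * (D c * D b) + (if a = c then D b else 0) + Th a * (D c * Dt b)"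
    by (simp add: DX DTh[symmetric] algebra_simps)
  also have "\<dots> = T a b * D c + (if a = c then D b else 0)"
    by (simp add: T_def DD[of c b] DDt[symmetric] algebra_simps)
  finally show ?thesis by simp
qed

lemma T_Th: "T a b * Th c = Th c * T a b + (if b = c then Th a else 0)"
proof -
  have "T a b * Th c = X a * (D b * Th c) + Th a * (Dt b * Th c)"
    by (simp add: T_def algebra_simps)
  also have "\<dots> = (X a * Th c) * D b + (if b = c then Th a else 0) - (Th a * Th c) * Dt b"
    by (simp add: DTh[symmetric] DtTh algebra_simps)
  also have "\<dots> = Th c * T a b + (if b = c then Th a else 0)"
    by (simp add: T_def XTh[symmetric] ThTh[of a c] algebra_simps)
  finally show ?thesis .
qed

lemma T_Dt: "T a b * Dt c = Dt c * T a b - (if a = c then Dt b else 0)"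
proof -
  have "Dt c * T a b = (Dt c * X a) * D b + (Dt c * Th a) * Dt b"
    by (simp add: T_def algebra_simps)
  also have "\<dots> = X a * (Dt c * D b) + (if a = c then Dt b else 0) - Th a * (Dt c * Dt b)"
    by (simp add: XDt DtTh algebra_simps)
  also have "\<dots> = T a b * Dt c + (if a = c then Dt b else 0)"
    by (simp add: T_def DDt DtDt[of c b] algebra_simps)
  finally show ?thesis by simp
qed

text \<open>Each of the four kinds of generators commutes with \<open>T a b\<close> up to a
  generator of the same kind, so moving \<open>T a b\<close> through the two products in
  \<open>T c d\<close> leaves just the structure constants of gl(2n).\<close>

lemma T_T:
  "T a b * T c d = T c d * T a b + (if b = c then T a d else 0) - (if a = d then T c b else 0)"
proof -
  have "T a b * T c d = (T a b * X c) * D d + (T a b * Th c) * Dt d"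
    by (simp add: T_def[of c d] algebra_simps)
  also have "\<dots> = X c * (T a b * D d) + Th c * (T a b * Dt d) + (if b = c then T a d else 0)"
    unfolding T_X T_Th by (simp add: T_def[of a d] algebra_simps)
  also have "\<dots> = T c d * T a b + (if b = c then T a d else 0) - (if a = d then T c b else 0)"
    unfolding T_D T_Dt by (simp add: T_def[of c b] T_def[of c d] algebra_simps)
  finally show ?thesis .
qed

section \<open>The pairing of the coordinates and the invariant operators\<close>

definition ix :: "nat \<Rightarrow> nat set" where
  "ix n = {1..2*n}"

lemma finite_ix [simp]: "finite (ix n)"
  by (simp add: ix_def)

lemma card_ix [simp]: "card (ix n) = 2 * n"
  by (simp add: ix_def)

definition pr :: "nat \<Rightarrow> nat \<Rightarrow> nat" where
  "pr n a = (if a \<le> n then a + n else a - n)"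

lemma pr_mem [simp]: "a \<in> ix n \<Longrightarrow> pr n a \<in> ix n"
  by (auto simp: pr_def ix_def)

lemma pr_pr [simp]: "a \<in> ix n \<Longrightarrow> pr n (pr n a) = a"
  by (auto simp: pr_def ix_def)

lemma pr_eq_iff: "a \<in> ix n \<Longrightarrow> b \<in> ix n \<Longrightarrow> pr n a = b \<longleftrightarrow> a = pr n b"
  by (auto simp: pr_def ix_def)

lemma pr_bij: "bij_betw (pr n) (ix n) (ix n)"
  by (rule bij_betw_byWitness[of _ "pr n"]) auto

lemma sum_pr: "(\<Sum>a\<in>ix n. f (pr n a)) = (\<Sum>a\<in>ix n. f a)"
  by (rule sum.reindex_bij_betw[OF pr_bij])

text \<open>d, the codifferential, their homotopy partners, the two degree operators, the Laplacian and the
  quadratic form, all taken with respect to the pairing of i with i + n.\<close>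

definition dE :: "nat \<Rightarrow> lop" where "dE n = (\<Sum>a\<in>ix n. Th a * D a)"
definition del :: "nat \<Rightarrow> lop" where "del n = (\<Sum>a\<in>ix n. D a * Dt (pr n a))"
definition io :: "nat \<Rightarrow> lop" where "io n = (\<Sum>a\<in>ix n. X a * Dt a)"
definition xw :: "nat \<Rightarrow> lop" where "xw n = (\<Sum>a\<in>ix n. X a * Th (pr n a))"
definition eu :: "nat \<Rightarrow> lop" where "eu n = (\<Sum>a\<in>ix n. X a * D a)"
definition qn :: "nat \<Rightarrow> lop" where "qn n = (\<Sum>a\<in>ix n. Th a * Dt a)"
definition lap :: "nat \<Rightarrow> lop" where "lap n = (\<Sum>a\<in>ix n. D a * D (pr n a))"
definition rsq :: "nat \<Rightarrow> lop" where "rsq n = (\<Sum>a\<in>ix n. X a * X (pr n a))"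

text \<open>d is defined without the bilinear form and commutes with all of gl(2n): the corrections
  coming from \<open>Th c\<close> at c = b and from \<open>D c\<close> at c = a are both
  \<open>Th a * D b\<close>, with opposite signs.\<close>

lemma T_dE:
  assumes "a \<in> ix n" "b \<in> ix n"
  shows "T a b * dE n = dE n * T a b"
proof -
  have "T a b * (Th c * D c) = (Th c * D c) * T a b
      + ((if b = c then Th a * D b else 0) - (if a = c then Th a * D b else 0))" for c
  proof -
    have "T a b * (Th c * D c) = (T a b * Th c) * D c" by (simp only: mult.assoc)
    also have "\<dots> = Th c * (T a b * D c) + (if b = c then Th a * D c else 0)"
      unfolding T_Th by (simp add: algebra_simps)
    finally show ?thesis unfolding T_D by (auto simp add: algebra_simps split: if_splits)
  qed
  then show ?thesis
    using assms by (simp add: dE_def sum_distrib_left sum_distrib_right sum.distrib sum_subtractf)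
qed

text \<open>The codifferential uses the form, so gl(2n) commutes with it only up to two terms.
  Replacing (a, b) by (\<open>pr n b\<close>, \<open>pr n a\<close>) interchanges these terms, which
  is why the difference in \<open>F_del\<close> commutes exactly.\<close>

lemma T_del:
  assumes "a \<in> ix n" "b \<in> ix n"
  shows "T a b * del n = del n * T a b - D b * Dt (pr n a) - D (pr n a) * Dt b"
proof -
  have "T a b * (D c * Dt (pr n c)) = (D c * Dt (pr n c)) * T a b
      - ((if a = c then D b * Dt (pr n a) else 0) + (if pr n a = c then D (pr n a) * Dt b else 0))"
    if "c \<in> ix n" for c
  proof -
    have "T a b * (D c * Dt (pr n c)) = (T a b * D c) * Dt (pr n c)" by (simp only: mult.assoc)
    also have "\<dots> = D c * (T a b * Dt (pr n c)) - (if a = c then D b * Dt (pr n c) else 0)"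
      unfolding T_D by (simp add: algebra_simps)
    finally show ?thesis
      unfolding T_Dt using pr_eq_iff[OF assms(1) that] that assms(1) by (auto simp add: algebra_simps)
  qed
  then have "T a b * del n = del n * T a b - (D b * Dt (pr n a) + D (pr n a) * Dt b)"
    using assms by (simp add: del_def sum_distrib_left sum_distrib_right sum_subtractf sum.distrib)
  then show ?thesis by (simp add: algebra_simps)
qed

lemma F_del:
  assumes "a \<in> ix n" "b \<in> ix n"
  shows "(T a b - T (pr n b) (pr n a)) * del n = del n * (T a b - T (pr n b) (pr n a))"
  using assms by (simp add: T_del algebra_simps)

section \<open>Homotopy formulas and the Laplacian\<close>

lemma sum_prod: "(sum f A :: lop) * sum g B = (\<Sum>a\<in>A. \<Sum>b\<in>B. f a * g b)"
  by (simp add: sum_distrib_left sum_distrib_right) (rule sum.swap)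

text \<open>Cartan's formula for the Euler field: on q-forms with coefficients of degree p the right
  side is the scalar p + q.\<close>

lemma dE_io: "dE n * io n + io n * dE n = eu n + qn n"
proof -
  have "(Th a * D a) * (X b * Dt b) + (X b * Dt b) * (Th a * D a)
      = (if a = b then X b * D a + Th a * Dt b else 0)" for a b
  proof -
    have "(X b * Dt b) * (Th a * D a) = X b * (Dt b * Th a) * D a"
      by (simp add: algebra_simps)
    also have "\<dots> = (if a = b then X b * D a else 0) - (X b * Th a) * (Dt b * D a)"
      by (simp add: DtTh algebra_simps)
    also have "\<dots> = (if a = b then X b * D a else 0) - Th a * (X b * D a) * Dt b"
      by (simp add: DDt flip: XTh) (simp add: algebra_simps)
    finally have "(X b * Dt b) * (Th a * D a) = (if a = b then X b * D a else 0) - Th a * (X b * D a) * Dt b" .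
    moreover have "(Th a * D a) * (X b * Dt b) = Th a * (D a * X b) * Dt b"
      by (simp add: algebra_simps)
    moreover have "\<dots> = Th a * (X b * D a) * Dt b + (if a = b then Th a * Dt b else 0)"
      by (simp add: DX algebra_simps)
    ultimately show ?thesis by simp
  qed
  then have "dE n * io n + (\<Sum>a\<in>ix n. \<Sum>b\<in>ix n. (X b * Dt b) * (Th a * D a)) = eu n + qn n"
    by (simp add: dE_def io_def eu_def qn_def sum_prod flip: sum.distrib)
  then show ?thesis
    by (simp add: io_def dE_def sum_prod) (subst sum.swap, simp)
qed

text \<open>The Hodge Laplacian of a flat space acts on the coefficients only: after anticommuting,
  just the terms with paired indices survive.\<close>

lemma dE_del: "dE n * del n + del n * dE n = lap n"
proof -
  have "(Th a * D a) * (D b * Dt (pr n b)) + (D b * Dt (pr n b)) * (Th a * D a)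
      = (if a = pr n b then D a * D b else 0)" for a b
  proof -
    have "(D b * Dt (pr n b)) * (Th a * D a) = D b * (Dt (pr n b) * Th a) * D a"
      by (simp add: algebra_simps)
    also have "\<dots> = (if a = pr n b then D a * D b else 0) - (D b * Th a) * (Dt (pr n b) * D a)"
      by (auto simp add: DtTh DD[of b "pr n b"] algebra_simps)
    also have "\<dots> = (if a = pr n b then D a * D b else 0) - Th a * (D b * D a) * Dt (pr n b)"
      by (simp add: DDt flip: DTh) (simp add: algebra_simps)
    finally show ?thesis by (simp add: DD[of b a] algebra_simps)
  qed
  then have "dE n * del n + (\<Sum>a\<in>ix n. \<Sum>b\<in>ix n. (D b * Dt (pr n b)) * (Th a * D a))
    = (\<Sum>a\<in>ix n. \<Sum>b\<in>ix n. if a = pr n b then D a * D b else 0)"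
    by (simp add: dE_def del_def sum_prod flip: sum.distrib)
  also have "\<dots> = (\<Sum>b\<in>ix n. \<Sum>a\<in>ix n. if a = pr n b then D a * D b else 0)"
    by (rule sum.swap)
  also have "\<dots> = (\<Sum>b\<in>ix n. D (pr n b) * D b)"
    using pr_mem by auto
  also have "\<dots> = lap n" by (simp add: lap_def DD[of "pr n _"])
  finally show ?thesis
    by (simp add: dE_def del_def sum_prod) (subst sum.swap, simp)
qed

text \<open>The counterpart of Cartan's formula for the codifferential. Contracting after
  multiplying counts the absent differentials, whence 2n - q + p on q-forms with coefficients of
  degree p.\<close>

lemma del_xw: "del n * xw n + xw n * del n = of_nat (2 * n) - qn n + eu n"
proof -
  have "(D a * Dt (pr n a)) * (X b * Th (pr n b)) + (X b * Th (pr n b)) * (D a * Dt (pr n a))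
      = (if a = b then X b * D a + 1 - Th (pr n a) * Dt (pr n a) else 0)"
    if "a \<in> ix n" "b \<in> ix n" for a b
  proof -
    have e: "pr n a = pr n b \<longleftrightarrow> a = b" using that by (metis pr_pr)
    have "(D a * Dt (pr n a)) * (X b * Th (pr n b)) = (D a * X b) * (Dt (pr n a) * Th (pr n b))"
      by (simp add: XDt[of "pr n a"] flip: mult.assoc) (simp add: XDt[of "pr n a"] mult.assoc)
    also have "\<dots> = (if a = b then X b * D a + 1 - Th (pr n a) * Dt (pr n a) else 0)
        - X b * (D a * Th (pr n b)) * Dt (pr n a)"
      by (simp add: DX DtTh e algebra_simps)
    also have "X b * (D a * Th (pr n b)) * Dt (pr n a) = (X b * Th (pr n b)) * (D a * Dt (pr n a))"
      by (simp flip: DTh) (simp add: algebra_simps)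
    finally show ?thesis by simp
  qed
  then have "del n * xw n + (\<Sum>a\<in>ix n. \<Sum>b\<in>ix n. (X b * Th (pr n b)) * (D a * Dt (pr n a)))
    = (\<Sum>a\<in>ix n. X a * D a + 1 - Th (pr n a) * Dt (pr n a))"
    by (simp add: del_def xw_def sum_prod flip: sum.distrib)
  also have "\<dots> = of_nat (2 * n) - qn n + eu n"
    by (simp add: sum.distrib sum_subtractf sum_pr[of "\<lambda>a. Th a * Dt a"] eu_def qn_def)
  finally show ?thesis
    by (simp add: xw_def del_def sum_prod) (subst sum.swap, simp)
qed

text \<open>Exchanging the two summations changes the sign, so twice the sum is 0. Applied to
  derivatives, which commute, against differentials or contractions, which anticommute.\<close>

lemma lop_antisym_sum:
  assumes "\<And>a b. a \<in> A \<Longrightarrow> b \<in> A \<Longrightarrow> f a b = - f b a"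
  shows "(\<Sum>a\<in>A. \<Sum>b\<in>A. f a b) = (0 :: lop)"
proof (rule lop_double_0)
  have "(\<Sum>a\<in>A. \<Sum>b\<in>A. f a b) = (\<Sum>a\<in>A. \<Sum>b\<in>A. f b a)"
    by (rule sum.swap)
  also have "\<dots> = (\<Sum>a\<in>A. \<Sum>b\<in>A. - f a b)"
    using assms by (intro sum.cong refl)
  finally show "(\<Sum>a\<in>A. \<Sum>b\<in>A. f a b) + (\<Sum>a\<in>A. \<Sum>b\<in>A. f a b) = 0"
    by (simp only: sum_negf eq_neg_iff_add_eq_0)
qed

lemma dE_dE: "dE n * dE n = 0"
proof -
  have *: "(Th a * D a) * (Th b * D b) = (Th a * Th b) * (D a * D b)" for a b
  proof -
    have "(Th a * D a) * (Th b * D b) = Th a * (D a * Th b) * D b" by (simp only: mult.assoc)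
    then show ?thesis by (simp only: DTh[symmetric] mult.assoc)
  qed
  show ?thesis unfolding dE_def sum_prod
  proof (rule lop_antisym_sum)
    fix a b
    show "(Th a * D a) * (Th b * D b) = - ((Th b * D b) * (Th a * D a))"
      unfolding * by (simp add: ThTh[of a b] DD[of a b])
  qed
qed

lemma del_del: "del n * del n = 0"
proof -
  have *: "(D a * Dt a') * (D b * Dt b') = (D a * D b) * (Dt a' * Dt b')" for a b a' b'
  proof -
    have "(D a * Dt a') * (D b * Dt b') = D a * (Dt a' * D b) * Dt b'" by (simp only: mult.assoc)
    then show ?thesis by (simp only: DDt mult.assoc)
  qed
  show ?thesis unfolding del_def sum_prod
  proof (rule lop_antisym_sum)
    fix a b
    show "(D a * Dt (pr n a)) * (D b * Dt (pr n b)) = - ((D b * Dt (pr n b)) * (D a * Dt (pr n a)))"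
      unfolding * by (simp add: DtDt[of "pr n a"] DD[of a b])
  qed
qed

lemma lap_del: "lap n * del n = del n * lap n"
proof -
  have "lap n * del n = dE n * (del n * del n) + del n * dE n * del n"
    unfolding dE_del[symmetric] by (simp add: algebra_simps)
  moreover have "del n * lap n = del n * dE n * del n + (del n * del n) * dE n"
    unfolding dE_del[symmetric] by (simp add: algebra_simps)
  ultimately show ?thesis by (simp add: del_del)
qed

section \<open>The Casimir operator expressed by the invariant operators\<close>

text \<open>The operator of E_ab - E_b'a' in so(2n), a prime denoting the paired index. Since
  \<open>FF n (pr n b) (pr n a) = - FF n a b\<close>, a sum over all a and b meets each root vector
  twice; this is the factor 2 in both evaluations of the Casimir operator.\<close>

definition FF :: "nat \<Rightarrow> nat \<Rightarrow> nat \<Rightarrow> lop" where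
  "FF n a b = T a b - T (pr n b) (pr n a)"

lemma X_D_X_D: "X a * D b * (X c * D d) = X a * X c * (D b * D d) + (if b = c then X a * D d else 0)"
proof -
  have "X a * D b * (X c * D d) = X a * (D b * X c) * D d" by (simp only: mult.assoc)
  then show ?thesis unfolding DX by (simp add: algebra_simps)
qed

lemma Th_Dt_Th_Dt:
  "Th a * Dt b * (Th c * Dt d) = (if b = c then Th a * Dt d else 0) - Th a * Th c * (Dt b * Dt d)"
proof -
  have "Th a * Dt b * (Th c * Dt d) = Th a * (Dt b * Th c) * Dt d" by (simp only: mult.assoc)
  then show ?thesis unfolding DtTh by (simp add: algebra_simps)
qed

lemma Th_Dt_X_D: "Th a * Dt b * (X c * D d) = X c * D d * (Th a * Dt b)"
proof -
  have "Th a * Dt b * (X c * D d) = Th a * (Dt b * X c) * D d" by (simp only: mult.assoc)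
  also have "\<dots> = (Th a * X c) * (Dt b * D d)" by (simp only: XDt mult.assoc)
  also have "\<dots> = X c * (Th a * D d) * Dt b" by (simp only: XTh DDt mult.assoc)
  also have "\<dots> = X c * D d * (Th a * Dt b)" by (simp only: DTh mult.assoc)
  finally show ?thesis .
qed

text \<open>The Casimir operator of gl(2n). Pure coefficient and pure differential terms reduce to
  the two degree operators; each of the two mixed sums becomes \<open>eu n - io n * dE n\<close>
  after reordering.\<close>

lemma casimir_part1:
  "(\<Sum>a\<in>ix n. \<Sum>b\<in>ix n. T a b * T b a)
     = eu n * eu n + eu n + of_nat (2 * n) * (eu n + qn n) - qn n * qn n + qn n - 2 * io n * dE n"
proof -
  let ?S = "\<lambda>f. \<Sum>a\<in>ix n. \<Sum>b\<in>ix n. (f a b :: lop)"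
  have cst: "?S (\<lambda>a b. g a) = of_nat (2 * n) * (\<Sum>a\<in>ix n. g a)" for g
    by (simp add: sum_distrib_left del: of_nat_mult)
  have "eu n * eu n = ?S (\<lambda>a b. X a * X b * (D a * D b)) + eu n"
    unfolding eu_def sum_prod X_D_X_D by (simp add: sum.distrib)
  moreover have "?S (\<lambda>a b. X a * D b * (X b * D a)) = ?S (\<lambda>a b. X a * X b * (D a * D b)) + of_nat (2 * n) * eu n"
  proof -
    have "X a * D b * (X b * D a) = X a * X b * (D a * D b) + X a * D a" for a b
      unfolding X_D_X_D by (simp add: DD[of b a])
    then show ?thesis by (simp add: sum.distrib cst eu_def del: of_nat_mult sum_constant)
  qed
  ultimately have 1: "?S (\<lambda>a b. X a * D b * (X b * D a)) = eu n * eu n - eu n + of_nat (2 * n) * eu n"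
    by simp
  have "qn n * qn n = qn n - ?S (\<lambda>a b. Th a * Th b * (Dt a * Dt b))"
    unfolding qn_def sum_prod Th_Dt_Th_Dt by (simp add: sum_subtractf)
  also have "?S (\<lambda>a b. Th a * Th b * (Dt a * Dt b)) = - ?S (\<lambda>a b. Th a * Th b * (Dt b * Dt a))"
  proof -
    have "Th a * Th b * (Dt a * Dt b) = - (Th a * Th b * (Dt b * Dt a))" for a b
      by (simp add: DtDt[of a b])
    then show ?thesis by (simp add: sum_negf)
  qed
  finally have "qn n * qn n = qn n + ?S (\<lambda>a b. Th a * Th b * (Dt b * Dt a))" by simp
  moreover have "?S (\<lambda>a b. Th a * Dt b * (Th b * Dt a)) = of_nat (2 * n) * qn n - ?S (\<lambda>a b. Th a * Th b * (Dt b * Dt a))"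
    unfolding Th_Dt_Th_Dt by (simp add: sum_subtractf cst qn_def del: of_nat_mult sum_constant)
  ultimately have 2: "?S (\<lambda>a b. Th a * Dt b * (Th b * Dt a)) = of_nat (2 * n) * qn n - qn n * qn n + qn n"
    by simp
  have c: "X a * D b * (Th b * Dt a) = (if a = b then X a * D a else 0) - X a * Dt a * (Th b * D b)" for a b
  proof -
    have "X a * Dt a * (Th b * D b) = X a * (Dt a * Th b) * D b" by (simp only: mult.assoc)
    also have "\<dots> = (if a = b then X a * D a else 0) - X a * (Th b * (Dt a * D b))"
      unfolding DtTh by (auto simp: algebra_simps)
    also have "X a * (Th b * (Dt a * D b)) = X a * (Th b * D b) * Dt a" by (simp only: DDt mult.assoc)
    also have "\<dots> = X a * D b * (Th b * Dt a)" by (simp only: DTh mult.assoc)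
    finally show ?thesis by simp
  qed
  have 3: "?S (\<lambda>a b. X a * D b * (Th b * Dt a)) = eu n - io n * dE n"
    unfolding c io_def dE_def sum_prod by (simp add: sum_subtractf eu_def)
  have 4: "?S (\<lambda>a b. Th a * Dt b * (X b * D a)) = eu n - io n * dE n"
    unfolding Th_Dt_X_D 3[symmetric] by (rule sum.swap)
  have "?S (\<lambda>a b. T a b * T b a) = ?S (\<lambda>a b. X a * D b * (X b * D a)) + ?S (\<lambda>a b. Th a * Dt b * (Th b * Dt a))
     + ?S (\<lambda>a b. X a * D b * (Th b * Dt a)) + ?S (\<lambda>a b. Th a * Dt b * (X b * D a))"
    by (simp add: T_def distrib_left distrib_right sum.distrib add.assoc add.commute add.left_commute)
  then show ?thesis unfolding 1 2 3 4 by (simp add: algebra_simps mult_2)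
qed

text \<open>Here the indices are contracted through the form: pure coefficient terms give
  \<open>rsq n * lap n\<close>, mixed terms \<open>xw n * del n\<close>, and the quartic term in the
  differentials contains the sum of \<open>Th a * Th (pr n a)\<close>, which vanishes because the
  form is symmetric.\<close>

lemma casimir_part2:
  "(\<Sum>a\<in>ix n. \<Sum>b\<in>ix n. T a b * T (pr n a) (pr n b)) = rsq n * lap n + eu n + qn n + 2 * xw n * del n"
proof -
  let ?S = "\<lambda>f. \<Sum>a\<in>ix n. \<Sum>b\<in>ix n. (f a b :: lop)"
  have 1: "?S (\<lambda>a b. X a * D b * (X (pr n a) * D (pr n b))) = rsq n * lap n + eu n"
  proof -
    have "X a * D b * (X (pr n a) * D (pr n b)) = X a * X (pr n a) * (D b * D (pr n b))
       + (if pr n a = b then X a * D a else 0)" if "a \<in> ix n" for a b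
      using that unfolding X_D_X_D by auto
    then show ?thesis unfolding rsq_def lap_def sum_prod eu_def by (simp add: sum.distrib)
  qed
  have 2: "?S (\<lambda>a b. Th a * Dt b * (Th (pr n a) * Dt (pr n b))) = qn n"
  proof -
    have z: "(\<Sum>a\<in>ix n. Th a * Th (pr n a)) = 0"
    proof (rule lop_double_0)
      have "(\<Sum>a\<in>ix n. Th a * Th (pr n a)) = (\<Sum>a\<in>ix n. Th (pr n a) * Th (pr n (pr n a)))"
        by (rule sum_pr[symmetric])
      also have "\<dots> = (\<Sum>a\<in>ix n. - (Th a * Th (pr n a)))"
        by (intro sum.cong refl, subst ThTh) simp
      finally show "(\<Sum>a\<in>ix n. Th a * Th (pr n a)) + (\<Sum>a\<in>ix n. Th a * Th (pr n a)) = 0"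
        by (simp only: sum_negf eq_neg_iff_add_eq_0)
    qed
    have "Th a * Dt b * (Th (pr n a) * Dt (pr n b)) = (if pr n a = b then Th a * Dt a else 0)
       - Th a * Th (pr n a) * (Dt b * Dt (pr n b))" if "a \<in> ix n" for a b
      using that unfolding Th_Dt_Th_Dt by auto
    then have "?S (\<lambda>a b. Th a * Dt b * (Th (pr n a) * Dt (pr n b)))
       = qn n - (\<Sum>a\<in>ix n. Th a * Th (pr n a)) * (\<Sum>b\<in>ix n. Dt b * Dt (pr n b))"
      unfolding qn_def sum_prod by (simp add: sum_subtractf)
    then show ?thesis unfolding z by simp
  qed
  have c: "X a * D b * (Th a' * Dt b') = X a * Th a' * (D b * Dt b')" for a b a' b'
  proof -
    have "X a * D b * (Th a' * Dt b') = X a * (D b * Th a') * Dt b'" by (simp only: mult.assoc)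
    then show ?thesis by (simp only: DTh[symmetric] mult.assoc)
  qed
  have 3: "?S (\<lambda>a b. X a * D b * (Th (pr n a) * Dt (pr n b))) = xw n * del n"
    unfolding c xw_def del_def sum_prod ..
  have 4: "?S (\<lambda>a b. Th a * Dt b * (X (pr n a) * D (pr n b))) = xw n * del n"
  proof -
    have "?S (\<lambda>a b. Th a * Dt b * (X (pr n a) * D (pr n b)))
      = ?S (\<lambda>a b. X (pr n a) * D (pr n b) * (Th (pr n (pr n a)) * Dt (pr n (pr n b))))"
      unfolding Th_Dt_X_D by simp
    also have "\<dots> = ?S (\<lambda>a b. X a * D (pr n b) * (Th (pr n a) * Dt (pr n (pr n b))))"
      by (rule sum_pr)
    also have "\<dots> = ?S (\<lambda>a b. X a * D b * (Th (pr n a) * Dt (pr n b)))"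
      by (intro sum.cong refl sum_pr)
    finally show ?thesis unfolding 3 .
  qed
  have "?S (\<lambda>a b. T a b * T (pr n a) (pr n b)) = ?S (\<lambda>a b. X a * D b * (X (pr n a) * D (pr n b)))
     + ?S (\<lambda>a b. Th a * Dt b * (Th (pr n a) * Dt (pr n b)))
     + ?S (\<lambda>a b. X a * D b * (Th (pr n a) * Dt (pr n b))) + ?S (\<lambda>a b. Th a * Dt b * (X (pr n a) * D (pr n b)))"
    by (simp add: T_def distrib_left distrib_right sum.distrib add.assoc add.commute add.left_commute)
  then show ?thesis unfolding 1 2 3 4 by (simp add: algebra_simps mult_2)
qed

text \<open>Expanding the two differences gives four sums, which reindexing by the pairing
  identifies in pairs. On closed and coclosed forms the last three terms vanish, which leaves the
  scalar in the two degrees.\<close>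

lemma casimir:
  "(\<Sum>a\<in>ix n. \<Sum>b\<in>ix n. FF n a b * FF n b a)
    = 2 * (eu n * eu n + of_nat (2 * n) * (eu n + qn n) - qn n * qn n
           - 2 * io n * dE n - rsq n * lap n - 2 * xw n * del n)"
proof -
  let ?S = "\<lambda>f. \<Sum>a\<in>ix n. \<Sum>b\<in>ix n. (f a b :: lop)"
  let ?A = "?S (\<lambda>a b. T a b * T b a)" and ?B = "?S (\<lambda>a b. T a b * T (pr n a) (pr n b))"
  have reindex: "?S (\<lambda>a b. g (pr n a) (pr n b)) = ?S g" for g
    by (subst sum_pr[of "\<lambda>a. \<Sum>b\<in>ix n. g a (pr n b)"]) (intro sum.cong refl sum_pr)
  have "?S (\<lambda>a b. T (pr n b) (pr n a) * T b a) = ?S (\<lambda>a b. T (pr n a) (pr n b) * T a b)"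
    by (rule sum.swap)
  also have "\<dots> = ?S (\<lambda>a b. T (pr n a) (pr n b) * T (pr n (pr n a)) (pr n (pr n b)))"
    by (intro sum.cong refl) simp
  also have "\<dots> = ?B" by (rule reindex)
  finally have 1: "?S (\<lambda>a b. T (pr n b) (pr n a) * T b a) = ?B" .
  have 2: "?S (\<lambda>a b. T (pr n b) (pr n a) * T (pr n a) (pr n b)) = ?A"
    by (subst reindex) (rule sum.swap)
  have "?S (\<lambda>a b. FF n a b * FF n b a) = ?A - ?B - ?S (\<lambda>a b. T (pr n b) (pr n a) * T b a)
     + ?S (\<lambda>a b. T (pr n b) (pr n a) * T (pr n a) (pr n b))"
    by (simp add: FF_def left_diff_distrib right_diff_distrib sum.distrib sum_subtractf)
  also have "\<dots> = 2 * (?A - ?B)" unfolding 1 2 by (simp add: algebra_simps mult_2)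
  finally show ?thesis unfolding casimir_part1 casimir_part2 by (simp add: algebra_simps)
qed

section \<open>Gradings and dimensions\<close>

interpretation FS: vector_space fscale
  by standard (auto simp: fun_eq_iff algebra_simps)

text \<open>The torus weight of a monomial, where x_i and dx_i have weight \<epsilon>_i, and x_(i+n)
  and dx_(i+n) have weight -\<epsilon>_i. The value 0 outside {1..n} makes equality of weights an
  equality of functions.\<close>

definition wtI :: "nat \<Rightarrow> idx \<Rightarrow> nat \<Rightarrow> int" where
  "wtI n I = (\<lambda>i. if i \<in> {1..n}
     then int (fst I i) - int (fst I (i + n)) + of_bool (i \<in> snd I) - of_bool (i + n \<in> snd I) else 0)"

text \<open>The degrees are integers, so that spaces of negative degree exist and are zero.\<close>

definition gidx :: "nat \<Rightarrow> int \<Rightarrow> int \<Rightarrow> idx set" where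
  "gidx n a b = {I. (\<forall>i. i \<notin> ix n \<longrightarrow> fst I i = 0) \<and> snd I \<subseteq> ix n
      \<and> int (\<Sum>i\<in>ix n. fst I i) = a \<and> int (card (snd I)) = b}"

definition fsup :: "idx set \<Rightarrow> form set" where
  "fsup A = {f. \<forall>I. f I \<noteq> 0 \<longrightarrow> I \<in> A}"

definition widx :: "nat \<Rightarrow> int \<Rightarrow> int \<Rightarrow> (nat \<Rightarrow> int) \<Rightarrow> idx set" where
  "widx n a b \<mu> = {I \<in> gidx n a b. wtI n I = \<mu>}"

abbreviation gr where "gr n a b \<equiv> fsup (gidx n a b)"
abbreviation sp where "sp n a b \<mu> \<equiv> fsup (widx n a b \<mu>)"

text \<open>The weight of the basis vector with index a: \<epsilon>_a in the first half of the
  indices, -\<epsilon>_(a-n) in the second.\<close>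

definition bw :: "nat \<Rightarrow> nat \<Rightarrow> nat \<Rightarrow> int" where
  "bw n a = (\<lambda>i. if i \<in> {1..n} then of_bool (a = i) - of_bool (a = i + n) else 0)"

lemma bw_pr: "a \<in> ix n \<Longrightarrow> bw n (pr n a) = - bw n a"
  by (auto simp: bw_def pr_def ix_def fun_eq_iff)

lemma fsupI: "(\<And>e S. f (e, S) \<noteq> 0 \<Longrightarrow> (e, S) \<in> A) \<Longrightarrow> f \<in> fsup A"
  by (auto simp: fsup_def)

lemma fsupD: "f \<in> fsup A \<Longrightarrow> f I \<noteq> 0 \<Longrightarrow> I \<in> A"
  by (cases I) (auto simp: fsup_def)

lemma subspace_fsup: "FS.subspace (fsup A)"
  unfolding FS.subspace_def fsup_def by force

text \<open>Written with sums on both sides to avoid truncated subtraction.\<close>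

lemma sum_upd:
  assumes "finite A" "a \<in> A"
  shows "(\<Sum>i\<in>A. (e(a := m)) i) + e a = (\<Sum>i\<in>A. e i) + (m :: nat)"
proof -
  have "(\<Sum>i\<in>A - {a}. (e(a := m)) i) = (\<Sum>i\<in>A - {a}. e i)"
    by (intro sum.cong) auto
  then show ?thesis using sum.remove[OF assms, of e] sum.remove[OF assms, of "e(a := m)"] by simp
qed

section \<open>Shifts of bidegree and weight\<close>

lemma X_sp:
  assumes "a \<in> ix n" "f \<in> sp n p q \<mu>"
  shows "app (X a) f \<in> sp n (p + 1) q (\<mu> + bw n a)"
proof (rule fsupI)
  fix e S assume "app (X a) f (e, S) \<noteq> 0"
  then have e: "e a > 0" "f (e(a := e a - 1), S) \<noteq> 0" by (auto simp: basic_eval split: if_splits)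
  then have w: "(e(a := e a - 1), S) \<in> widx n p q \<mu>" using fsupD assms(2) by blast
  have "int (\<Sum>i\<in>ix n. (e(a := e a - 1)) i) + 1 = int (\<Sum>i\<in>ix n. e i)"
    using sum_upd[OF finite_ix assms(1), of e "e a - 1"] e(1) by linarith
  moreover have "\<forall>i. i \<notin> ix n \<longrightarrow> e i = 0" using w assms(1)
    by (auto simp: widx_def gidx_def split: if_splits)
  moreover have "wtI n (e, S) = wtI n (e(a := e a - 1), S) + bw n a"
    using e(1) by (auto simp: wtI_def bw_def fun_eq_iff)
  ultimately show "(e, S) \<in> widx n (p + 1) q (\<mu> + bw n a)" using w
    by (auto simp: widx_def gidx_def)
qed

lemma D_sp:
  assumes "a \<in> ix n" "f \<in> sp n p q \<mu>"
  shows "app (D a) f \<in> sp n (p - 1) q (\<mu> - bw n a)"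
proof (rule fsupI)
  fix e S assume "app (D a) f (e, S) \<noteq> 0"
  then have e: "f (e(a := e a + 1), S) \<noteq> 0" by (auto simp: basic_eval split: if_splits)
  then have w: "(e(a := e a + 1), S) \<in> widx n p q \<mu>" using fsupD assms(2) by blast
  have "int (\<Sum>i\<in>ix n. (e(a := e a + 1)) i) - 1 = int (\<Sum>i\<in>ix n. e i)"
    using sum_upd[OF finite_ix assms(1), of e "e a + 1"] by linarith
  moreover have "\<forall>i. i \<notin> ix n \<longrightarrow> e i = 0" using w assms(1)
    by (auto simp: widx_def gidx_def split: if_splits)
  moreover have "wtI n (e, S) = wtI n (e(a := e a + 1), S) - bw n a"
    by (auto simp: wtI_def bw_def fun_eq_iff)
  ultimately show "(e, S) \<in> widx n (p - 1) q (\<mu> - bw n a)" using w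
    by (auto simp: widx_def gidx_def)
qed

lemma Th_sp:
  assumes "a \<in> ix n" "f \<in> sp n p q \<mu>"
  shows "app (Th a) f \<in> sp n p (q + 1) (\<mu> + bw n a)"
proof (rule fsupI)
  fix e S assume "app (Th a) f (e, S) \<noteq> 0"
  then have e: "a \<in> S" "f (e, S - {a}) \<noteq> 0" by (auto simp: basic_eval split: if_splits)
  then have w: "(e, S - {a}) \<in> widx n p q \<mu>" using fsupD assms(2) by blast
  then have S: "S \<subseteq> ix n" using assms(1) by (auto simp: widx_def gidx_def)
  then have "int (card S) = int (card (S - {a})) + 1"
    using e(1) finite_subset[OF S finite_ix] by (metis card.remove of_nat_Suc add.commute)
  moreover have "wtI n (e, S) = wtI n (e, S - {a}) + bw n a"
    using e(1) by (auto simp: wtI_def bw_def fun_eq_iff)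
  ultimately show "(e, S) \<in> widx n p (q + 1) (\<mu> + bw n a)" using w S
    by (auto simp: widx_def gidx_def)
qed

lemma Dt_sp:
  assumes "a \<in> ix n" "f \<in> sp n p q \<mu>"
  shows "app (Dt a) f \<in> sp n p (q - 1) (\<mu> - bw n a)"
proof (rule fsupI)
  fix e S assume "app (Dt a) f (e, S) \<noteq> 0"
  then have e: "a \<notin> S" "f (e, insert a S) \<noteq> 0" by (auto simp: basic_eval split: if_splits)
  then have w: "(e, insert a S) \<in> widx n p q \<mu>" using fsupD assms(2) by blast
  then have S: "S \<subseteq> ix n" using assms(1) by (auto simp: widx_def gidx_def)
  then have "int (card S) = int (card (insert a S)) - 1"
    using e(1) finite_subset[OF S finite_ix] by simp
  moreover have "wtI n (e, S) = wtI n (e, insert a S) - bw n a"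
    using e(1) by (auto simp: wtI_def bw_def fun_eq_iff)
  ultimately show "(e, S) \<in> widx n p (q - 1) (\<mu> - bw n a)" using w S
    by (auto simp: widx_def gidx_def)
qed

lemma fsup_sum: "(\<And>i. i \<in> A \<Longrightarrow> f i \<in> fsup B) \<Longrightarrow> sum f A \<in> fsup B"
  using subspace_fsup by (rule FS.subspace_sum)

lemma fsup_add: "f \<in> fsup B \<Longrightarrow> g \<in> fsup B \<Longrightarrow> f + g \<in> fsup B"
  using subspace_fsup by (rule FS.subspace_add)

lemma fsup_diff: "f \<in> fsup B \<Longrightarrow> g \<in> fsup B \<Longrightarrow> f - g \<in> fsup B"
  using subspace_fsup by (rule FS.subspace_diff)

lemma fsup_scale: "f \<in> fsup B \<Longrightarrow> fscale c f \<in> fsup B"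
  using subspace_fsup by (rule FS.subspace_scale)

lemma T_sp:
  assumes "a \<in> ix n" "b \<in> ix n" "f \<in> sp n p q \<mu>"
  shows "app (T a b) f \<in> sp n p q (\<mu> + bw n a - bw n b)"
  using X_sp[OF assms(1) D_sp[OF assms(2,3)]] Th_sp[OF assms(1) Dt_sp[OF assms(2,3)]]
  by (auto simp: T_def algebra_simps intro!: fsup_add)

lemma dE_sp:
  assumes "f \<in> sp n p q \<mu>"
  shows "app (dE n) f \<in> sp n (p - 1) (q + 1) \<mu>"
  unfolding dE_def app_sum_op
proof (rule fsup_sum)
  fix a assume a: "a \<in> ix n"
  show "app (Th a * D a) f \<in> sp n (p - 1) (q + 1) \<mu>"
    using Th_sp[OF a D_sp[OF a assms]] by simp
qed

lemma del_sp:
  assumes "f \<in> sp n p q \<mu>"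
  shows "app (del n) f \<in> sp n (p - 1) (q - 1) \<mu>"
  unfolding del_def app_sum_op
proof (rule fsup_sum)
  fix a assume a: "a \<in> ix n"
  show "app (D a * Dt (pr n a)) f \<in> sp n (p - 1) (q - 1) \<mu>"
    using D_sp[OF a Dt_sp[OF pr_mem[OF a] assms]] by (simp add: bw_pr a)
qed

lemma io_sp:
  assumes "f \<in> sp n p q \<mu>"
  shows "app (io n) f \<in> sp n (p + 1) (q - 1) \<mu>"
  unfolding io_def app_sum_op
proof (rule fsup_sum)
  fix a assume a: "a \<in> ix n"
  show "app (X a * Dt a) f \<in> sp n (p + 1) (q - 1) \<mu>"
    using X_sp[OF a Dt_sp[OF a assms]] by simp
qed

lemma xw_sp:
  assumes "f \<in> sp n p q \<mu>"
  shows "app (xw n) f \<in> sp n (p + 1) (q + 1) \<mu>"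
  unfolding xw_def app_sum_op
proof (rule fsup_sum)
  fix a assume a: "a \<in> ix n"
  show "app (X a * Th (pr n a)) f \<in> sp n (p + 1) (q + 1) \<mu>"
    using X_sp[OF a Th_sp[OF pr_mem[OF a] assms]] by (simp add: bw_pr a)
qed

lemma sum_fun_apply: "(\<Sum>i\<in>A. f i) x = (\<Sum>i\<in>A. f i x)"
  by (induction A rule: infinite_finite_induct) simp_all

lemma XD_app: "app (X a * D a) f (e, S) = of_nat (e a) * f (e, S)"
  by (auto simp: basic_eval upd_back)

lemma ThDt_app: "app (Th a * Dt a) f (e, S) = of_bool (a \<in> S) * f (e, S)"
  by (auto simp: basic_eval sg_delete insert_absorb mult.assoc[symmetric] sg_sq)

lemma eu_gr:
  assumes "f \<in> gr n p q"
  shows "app (eu n) f = fscale (of_int p) f"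
proof (rule ext, safe)
  fix e S
  have "app (eu n) f (e, S) = (\<Sum>a\<in>ix n. app (X a * D a) f (e, S))"
    unfolding eu_def app_sum_op by (rule sum_fun_apply)
  then have "app (eu n) f (e, S) = of_nat (\<Sum>i\<in>ix n. e i) * f (e, S)"
    unfolding XD_app by (simp add: sum_distrib_right)
  then show "app (eu n) f (e, S) = fscale (of_int p) f (e, S)"
    using fsupD[OF assms, of "(e, S)"] by (cases "f (e, S) = 0") (auto simp: gidx_def)
qed

lemma qn_gr:
  assumes "f \<in> gr n p q"
  shows "app (qn n) f = fscale (of_int q) f"
proof (rule ext, safe)
  fix e S
  have "app (qn n) f (e, S) = (\<Sum>a\<in>ix n. app (Th a * Dt a) f (e, S))"
    unfolding qn_def app_sum_op by (rule sum_fun_apply)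
  also have "\<dots> = of_nat (card (ix n \<inter> S)) * f (e, S)"
    unfolding ThDt_app by (simp add: sum_distrib_right[symmetric] of_bool_def sum.If_cases)
  finally show "app (qn n) f (e, S) = fscale (of_int q) f (e, S)"
    using fsupD[OF assms, of "(e, S)"] by (cases "f (e, S) = 0") (auto simp: gidx_def Int_absorb1)
qed

section \<open>Finite bases of monomials and the rank formula\<close>

lemma finite_gidx [simp]: "finite (gidx n a b)"
proof -
  let ?E = "{e. \<forall>i. (i \<in> ix n \<longrightarrow> e i \<in> {..nat a}) \<and> (i \<notin> ix n \<longrightarrow> e i = 0)}"
  have "gidx n a b \<subseteq> ?E \<times> Pow (ix n)"
  proof
    fix I assume I: "I \<in> gidx n a b"
    have "fst I i \<in> {..nat a}" if "i \<in> ix n" for i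
    proof -
      have "fst I i \<le> sum (fst I) (ix n)" using that by (intro member_le_sum) auto
      also have "\<dots> = nat a" using I by (simp only: gidx_def mem_Collect_eq) linarith
      finally show ?thesis by simp
    qed
    then have "fst I \<in> ?E" "snd I \<in> Pow (ix n)" using I by (auto simp: gidx_def)
    then show "I \<in> ?E \<times> Pow (ix n)" by (cases I) simp
  qed
  moreover have "finite ?E" by (rule finite_set_of_finite_funs) auto
  then have "finite (?E \<times> Pow (ix n))" by (rule finite_cartesian_product) simp
  ultimately show ?thesis by (rule finite_subset)
qed

lemma finite_widx [simp]: "finite (widx n a b \<mu>)"
  by (simp add: widx_def)

definition unitf :: "idx \<Rightarrow> form" where
  "unitf I = (\<lambda>J. of_bool (J = I))"

lemma form_expand:
  assumes "finite A" "f \<in> fsup A"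
  shows "f = (\<Sum>I\<in>A. fscale (f I) (unitf I))"
proof
  fix J
  show "f J = (\<Sum>I\<in>A. fscale (f I) (unitf I)) J"
    using fsupD[OF assms(2), of J] assms(1)
    by (auto simp: sum_fun_apply unitf_def of_bool_def if_distrib cong: if_cong)
qed

lemma inj_unitf: "inj unitf"
  by (auto simp: inj_on_def unitf_def fun_eq_iff of_bool_def split: if_splits)

lemma independent_unitf:
  assumes "finite A"
  shows "FS.independent (unitf ` A)"
proof (rule FS.independent_if_scalars_zero)
  fix u v assume 0: "(\<Sum>x\<in>unitf ` A. fscale (u x) x) = 0" and "v \<in> unitf ` A"
  then obtain I where I: "I \<in> A" "v = unitf I" by auto
  have "(\<Sum>J\<in>A. fscale (u (unitf J)) (unitf J)) = 0"
    using 0 unfolding sum.reindex[OF inj_on_subset[OF inj_unitf subset_UNIV]] o_def .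
  then have "(\<Sum>J\<in>A. fscale (u (unitf J)) (unitf J)) I = 0" by (simp only: zero_fun_apply)
  then show "u v = 0" using I assms
    by (auto simp: sum_fun_apply unitf_def of_bool_def if_distrib cong: if_cong)
qed (use assms in auto)

lemma fsup_span:
  assumes "finite A" shows "fsup A = FS.span (unitf ` A)"
proof
  show "fsup A \<subseteq> FS.span (unitf ` A)"
  proof
    fix f assume "f \<in> fsup A"
    then show "f \<in> FS.span (unitf ` A)"
      by (subst form_expand[OF assms], simp) (rule FS.span_sum, rule FS.span_scale, rule FS.span_base, simp)
  qed
  show "FS.span (unitf ` A) \<subseteq> fsup A"
    by (rule FS.span_minimal[OF _ subspace_fsup]) (auto simp: fsup_def unitf_def of_bool_def split: if_splits)
qed

lemma dim_fsup:
  assumes "finite A" shows "FS.dim (fsup A) = card A"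
  unfolding fsup_span[OF assms] FS.dim_span_eq_card_independent[OF independent_unitf[OF assms]]
  using inj_unitf by (intro card_image) (auto simp: inj_on_def)

text \<open>A basis of the kernel is extended to one of A. The added vectors span a complement on
  which Q is injective, so their images form a basis of the image.\<close>

lemma rank_nullity:
  assumes A: "FS.subspace A" "A \<subseteq> FS.span B" "finite B"
  shows "FS.dim A = FS.dim {f \<in> A. app Q f = 0} + FS.dim (app Q ` A)"
proof -
  let ?K = "{f \<in> A. app Q f = 0}"
  interpret L: Vector_Spaces.linear fscale fscale "app Q"
    by unfold_locales auto
  have K: "FS.subspace ?K" using A(1) by (auto simp: FS.subspace_def)
  obtain B1 where B1: "B1 \<subseteq> ?K" "FS.independent B1" "?K \<subseteq> FS.span B1"
    using FS.maximal_independent_subset by blast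
  obtain B2 where B2: "B1 \<subseteq> B2" "B2 \<subseteq> A" "FS.independent B2" "A \<subseteq> FS.span B2"
    using FS.maximal_independent_subset_extend[of B1 A] B1 by blast
  have fin: "finite B2" using FS.independent_span_bound[OF A(3) B2(3)] A(2) B2(2) by blast
  let ?C = "B2 - B1"
  have C: "?C \<subseteq> A" using B2 by auto
  have inj0: "x = 0" if x: "x \<in> FS.span ?C" "app Q x = 0" for x
  proof -
    have "x \<in> A" using FS.span_minimal[OF C A(1)] x(1) by blast
    then have "x \<in> FS.span B1" using B1(3) x(2) by auto
    then obtain w where w: "x = (\<Sum>v\<in>B1. fscale (w v) v)"
      using FS.span_finite[of B1] fin B2(1) finite_subset by blast
    obtain u where u: "x = (\<Sum>v\<in>?C. fscale (u v) v)"
      using FS.span_finite[of ?C] fin x(1) by blast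
    \<comment> \<open>Subtracting the two expansions of x, one in \<open>B1\<close> and one in
      \<open>?C\<close>, gives a single linear relation on \<open>B2\<close>.\<close>
    let ?g = "\<lambda>v. if v \<in> B1 then - w v else u v"
    have "(\<Sum>v\<in>B2. fscale (?g v) v) = (\<Sum>v\<in>?C. fscale (?g v) v) + (\<Sum>v\<in>B1. fscale (?g v) v)"
      using fin B2(1) by (rule sum.subset_diff[rotated])
    also have "(\<Sum>v\<in>?C. fscale (?g v) v) = x" unfolding u by (intro sum.cong) auto
    also have "(\<Sum>v\<in>B1. fscale (?g v) v) = - x" unfolding w
      by (simp add: sum_negf[symmetric]) 
    finally have "(\<Sum>v\<in>B2. fscale (?g v) v) = 0" by (simp only: add.right_inverse)
    then have "u v = 0" if "v \<in> ?C" for v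
      using FS.independentD[OF B2(3) fin order_refl, of ?g v] that by auto
    then show "x = 0" unfolding u by (simp add: fun_eq_iff sum_fun_apply)
  qed
  have sC: "FS.subspace (FS.span ?C)" by simp
  have inj: "inj_on (app Q) (FS.span ?C)"
    using inj0 FS.span_diff by (intro inj_onI) (metis app_diff right_minus_eq)
  have iC: "FS.independent (app Q ` ?C)"
    using L.independent_injective_image[OF FS.independent_mono[OF B2(3)] inj] by auto
  have "app Q ` A \<subseteq> FS.span (app Q ` ?C)"
  proof -
    have "app Q v \<in> FS.span (app Q ` ?C)" if "v \<in> B2" for v
    proof (cases "v \<in> B1")
      case True
      then show ?thesis using B1(1) FS.span_zero by auto
    next
      case False
      then show ?thesis using that by (auto intro: FS.span_base)
    qed
    then have "app Q ` FS.span B2 \<subseteq> FS.span (app Q ` ?C)"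
      unfolding L.span_image[symmetric] by (intro FS.span_minimal) auto
    then show ?thesis using B2(4) by blast
  qed
  then have "FS.dim (app Q ` A) = card (app Q ` ?C)"
    using FS.basis_card_eq_dim[of "app Q ` ?C" "app Q ` A"] iC C by (auto simp: image_mono)
  also have "\<dots> = card ?C"
    by (rule card_image) (use inj FS.span_superset inj_on_subset in blast)
  also have "\<dots> = card B2 - card B1" using fin B2(1) by (simp add: card_Diff_subset finite_subset)
  finally show ?thesis
    using FS.basis_card_eq_dim[OF B1(1,3,2)] FS.basis_card_eq_dim[OF B2(2,4,3)]
      card_mono[OF fin B2(1)] by linarith
qed

lemma widx_neg: "p < 0 \<or> q < 0 \<Longrightarrow> widx n p q \<mu> = {}"
  by (auto simp: widx_def gidx_def simp del: of_nat_sum)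

lemma fsup_empty [simp]: "fsup {} = {0}"
  by (auto simp: fsup_def fun_eq_iff)

lemma sp_gr: "f \<in> sp n p q \<mu> \<Longrightarrow> f \<in> gr n p q"
  by (auto simp: fsup_def widx_def)

lemma fscale_fscale [simp]: "fscale a (fscale b f) = fscale (a * b) f"
  by (simp add: fun_eq_iff)

lemma fscale_1 [simp]: "fscale 1 f = f"
  by (simp add: fun_eq_iff)

lemma fscale_add: "fscale a f + fscale b f = fscale (a + b) f"
  by (simp add: fun_eq_iff algebra_simps)

section \<open>Dimensions of the spaces of closed and of coclosed forms\<close>

definition Zf :: "nat \<Rightarrow> int \<Rightarrow> int \<Rightarrow> (nat \<Rightarrow> int) \<Rightarrow> form set" where
  "Zf n p q \<mu> = {f \<in> sp n p q \<mu>. app (dE n) f = 0}"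

definition Yf :: "nat \<Rightarrow> int \<Rightarrow> int \<Rightarrow> (nat \<Rightarrow> int) \<Rightarrow> form set" where
  "Yf n p q \<mu> = {f \<in> sp n p q \<mu>. app (del n) f = 0}"

definition Mf :: "nat \<Rightarrow> int \<Rightarrow> int \<Rightarrow> (nat \<Rightarrow> int) \<Rightarrow> form set" where
  "Mf n p q \<mu> = {f \<in> sp n p q \<mu>. app (dE n) f = 0 \<and> app (del n) f = 0}"

text \<open>The multiplicity of the weight \<mu> in Sym^p tensor Lambda^q. It is an integer because
  it enters alternating sums.\<close>

definition cnt :: "nat \<Rightarrow> int \<Rightarrow> int \<Rightarrow> (nat \<Rightarrow> int) \<Rightarrow> int" where
  "cnt n p q \<mu> = int (card (widx n p q \<mu>))"

lemma dim_sp: "int (FS.dim (sp n p q \<mu>)) = cnt n p q \<mu>"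
  by (simp add: dim_fsup cnt_def)

lemma dim_zero_space: "A \<subseteq> {0} \<Longrightarrow> FS.dim A = 0"
  using FS.dim_le_card[of A "{}"] by simp

lemma rank_nullity_sp:
  assumes "FS.subspace A" "A \<subseteq> sp n p q \<mu>"
  shows "FS.dim A = FS.dim {f \<in> A. app Q f = 0} + FS.dim (app Q ` A)"
  using assms(2) rank_nullity[OF assms(1), of "unitf ` widx n p q \<mu>"] by (simp add: fsup_span)

text \<open>The Poincare lemma in a single weight: for closed f the derivative of
  \<open>io n\<close> applied to f is (p + q) f. Among the nonzero spaces only the constants, p = q
  = 0, are excluded.\<close>

lemma dE_image:
  assumes "p + q \<noteq> 0"
  shows "app (dE n) ` sp n (p + 1) (q - 1) \<mu> = Zf n p q \<mu>"
proof
  show "app (dE n) ` sp n (p + 1) (q - 1) \<mu> \<subseteq> Zf n p q \<mu>"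
  proof
    fix g assume "g \<in> app (dE n) ` sp n (p + 1) (q - 1) \<mu>"
    then obtain f where f: "f \<in> sp n (p + 1) (q - 1) \<mu>" "g = app (dE n) f" by auto
    have "app (dE n) g = 0" unfolding f(2) app_simps(6)[symmetric] dE_dE by simp
    then show "g \<in> Zf n p q \<mu>" using dE_sp[OF f(1)] f(2) by (simp add: Zf_def)
  qed
  show "Zf n p q \<mu> \<subseteq> app (dE n) ` sp n (p + 1) (q - 1) \<mu>"
  proof
    fix f assume "f \<in> Zf n p q \<mu>"
    then have f: "f \<in> sp n p q \<mu>" "app (dE n) f = 0" by (auto simp: Zf_def)
    have "app (dE n * io n + io n * dE n) f = fscale (of_int p) f + fscale (of_int q) f"
      unfolding dE_io app_simps eu_gr[OF sp_gr[OF f(1)]] qn_gr[OF sp_gr[OF f(1)]] ..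
    then have "app (dE n) (app (io n) f) = fscale (of_int (p + q)) f"
      using f(2) by (simp only: app_simps app_0 fscale_add of_int_add add_0_right)
    then have "app (dE n) (fscale (1 / of_int (p + q)) (app (io n) f)) = f"
      using assms by (simp only: app_scale fscale_fscale) (simp flip: of_int_add)
    then show "f \<in> app (dE n) ` sp n (p + 1) (q - 1) \<mu>"
      using fsup_scale[OF io_sp[OF f(1)]] by (metis imageI)
  qed
qed

text \<open>For coclosed f the codifferential of \<open>xw n\<close> applied to f is (2n - q + p) f.
  Among the nonzero spaces only the constant forms of top degree, p = 0 and q = 2n, are
  excluded.\<close>

lemma del_image:
  assumes "2 * int n - q + p \<noteq> 0"
  shows "app (del n) ` sp n (p + 1) (q + 1) \<mu> = Yf n p q \<mu>"
proof
  show "app (del n) ` sp n (p + 1) (q + 1) \<mu> \<subseteq> Yf n p q \<mu>"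
  proof
    fix g assume "g \<in> app (del n) ` sp n (p + 1) (q + 1) \<mu>"
    then obtain f where f: "f \<in> sp n (p + 1) (q + 1) \<mu>" "g = app (del n) f" by auto
    have "app (del n) g = 0" unfolding f(2) app_simps(6)[symmetric] del_del by simp
    then show "g \<in> Yf n p q \<mu>" using del_sp[OF f(1)] f(2) by (simp add: Yf_def)
  qed
  show "Yf n p q \<mu> \<subseteq> app (del n) ` sp n (p + 1) (q + 1) \<mu>"
  proof
    fix f assume "f \<in> Yf n p q \<mu>"
    then have f: "f \<in> sp n p q \<mu>" "app (del n) f = 0" by (auto simp: Yf_def)
    have "app (del n * xw n + xw n * del n) f
        = fscale (of_int (2 * int n)) f - fscale (of_int q) f + fscale (of_int p) f"
      unfolding del_xw app_simps eu_gr[OF sp_gr[OF f(1)]] qn_gr[OF sp_gr[OF f(1)]] app_of_nat by simp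
    also have "\<dots> = fscale (of_int (2 * int n - q + p)) f"
      by (simp add: fun_eq_iff algebra_simps)
    finally have "app (del n) (app (xw n) f) = fscale (of_int (2 * int n - q + p)) f"
      using f(2) by (simp only: app_simps app_0 add_0_right)
    then have "app (del n) (fscale (1 / of_int (2 * int n - q + p)) (app (xw n) f))
       = fscale (1 / of_int (2 * int n - q + p) * of_int (2 * int n - q + p)) f"
      by (simp only: app_scale fscale_fscale)
    also have "1 / of_int (2 * int n - q + p) * of_int (2 * int n - q + p) = (1 :: complex)"
      using assms by (metis nonzero_eq_divide_eq of_int_eq_0_iff)
    finally have "app (del n) (fscale (1 / of_int (2 * int n - q + p)) (app (xw n) f)) = f"
      by (simp only: fscale_1)
    then show "f \<in> app (del n) ` sp n (p + 1) (q + 1) \<mu>"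
      using fsup_scale[OF xw_sp[OF f(1)]] by (metis imageI)
  qed
qed

lemma dim_Zf_step:
  assumes "p + q \<noteq> 0"
  shows "int (FS.dim (Zf n p q \<mu>)) = cnt n (p + 1) (q - 1) \<mu> - int (FS.dim (Zf n (p + 1) (q - 1) \<mu>))"
  using rank_nullity_sp[OF subspace_fsup order_refl, of n "p + 1" "q - 1" \<mu> "dE n"]
  by (simp add: dE_image[OF assms] dim_sp[symmetric] Zf_def)

lemma dim_Yf_step:
  assumes "2 * int n - q + p \<noteq> 0"
  shows "int (FS.dim (Yf n p q \<mu>)) = cnt n p q \<mu> - int (FS.dim (Yf n (p - 1) (q - 1) \<mu>))"
proof -
  have "app (del n) ` sp n p q \<mu> = Yf n (p - 1) (q - 1) \<mu>"
    using del_image[of n "q - 1" "p - 1" \<mu>] assms by simp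
  then show ?thesis
    using rank_nullity_sp[OF subspace_fsup order_refl, of n p q \<mu> "del n"]
    by (simp add: dim_sp[symmetric] Yf_def)
qed

lemma dim_neg:
  assumes "p < 0 \<or> q < 0"
  shows "FS.dim (Zf n p q \<mu>) = 0" "FS.dim (Yf n p q \<mu>) = 0" "cnt n p q \<mu> = 0"
  using widx_neg[OF assms, of n \<mu>] by (auto simp: Zf_def Yf_def cnt_def intro!: dim_zero_space)

text \<open>Each use of exactness lowers the form degree and raises the coefficient degree by one,
  so p + q stays positive until the form degree becomes negative.\<close>

lemma dim_Zf:
  assumes "p + int q > 0"
  shows "int (FS.dim (Zf n p (int q) \<mu>)) = (\<Sum>j=1..q. (-1) ^ (j - 1) * cnt n (p + int j) (int q - int j) \<mu>)"
  using assms
proof (induction q arbitrary: p)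
  case 0
  \<comment> \<open>A closed function of positive degree is 0: it would be the derivative of a form
    of degree -1.\<close>
  then show ?case using dim_Zf_step[of p 0 n \<mu>] by (simp add: dim_neg del: fscale_apply)
next
  case (Suc q)
  have "(\<Sum>j=1..Suc q. (-1) ^ (j - 1) * cnt n (p + int j) (int (Suc q) - int j) \<mu>)
      = cnt n (p + 1) (int q) \<mu> + (\<Sum>j=Suc 1..Suc q. (-1) ^ (j - 1) * cnt n (p + int j) (int (Suc q) - int j) \<mu>)"
    by (subst sum.atLeast_Suc_atMost) auto
  also have "(\<Sum>j=Suc 1..Suc q. (-1) ^ (j - 1) * cnt n (p + int j) (int (Suc q) - int j) \<mu>)
      = (\<Sum>j=1..q. - ((-1) ^ (j - 1) * cnt n (p + 1 + int j) (int q - int j) \<mu>))"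
    by (subst sum.shift_bounds_cl_Suc_ivl, intro sum.cong refl)
      (auto simp: algebra_simps power_eq_if)
  also have "\<dots> = - int (FS.dim (Zf n (p + 1) (int q) \<mu>))"
    using Suc.IH[of "p + 1"] Suc.prems by (simp add: sum_negf del: fscale_apply)
  finally show ?case using dim_Zf_step[of p "int (Suc q)" n \<mu>] Suc.prems by (simp del: fscale_apply)
qed

text \<open>Here both degrees fall by one, so the difference of the degrees is preserved. For p
  \<ge> 0 the hypotheses keep 2n - q + p positive; for p < 0, where it might vanish, all spaces are
  zero.\<close>

lemma dim_Yf:
  assumes "q \<le> n" "n > 0"
  shows "int (FS.dim (Yf n p (int q) \<mu>)) = (\<Sum>i=0..q. (-1) ^ i * cnt n (p - int i) (int q - int i) \<mu>)"
  using assms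
proof (induction q arbitrary: p)
  case 0
  show ?case
  proof (cases "p < 0")
    case True
    then show ?thesis by (simp add: dim_neg del: fscale_apply)
  next
    case False
    then show ?thesis using dim_Yf_step[of n 0 p \<mu>] 0 by (simp add: dim_neg del: fscale_apply)
  qed
next
  case (Suc q)
  show ?case
  proof (cases "p < 0")
    case True
    then show ?thesis by (simp add: dim_neg del: fscale_apply)
  next
    case False
    have "(\<Sum>i=0..Suc q. (-1) ^ i * cnt n (p - int i) (int (Suc q) - int i) \<mu>)
      = cnt n p (int (Suc q)) \<mu> + (\<Sum>i=Suc 0..Suc q. (-1) ^ i * cnt n (p - int i) (int (Suc q) - int i) \<mu>)"
      by (subst sum.atLeast_Suc_atMost) auto
    also have "(\<Sum>i=Suc 0..Suc q. (-1) ^ i * cnt n (p - int i) (int (Suc q) - int i) \<mu>)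
      = (\<Sum>i=0..q. - ((-1) ^ i * cnt n (p - 1 - int i) (int q - int i) \<mu>))"
      by (subst sum.shift_bounds_cl_Suc_ivl, intro sum.cong refl) (auto simp: algebra_simps)
    also have "\<dots> = - int (FS.dim (Yf n (p - 1) (int q) \<mu>))"
      using Suc.IH[of "p - 1"] Suc.prems by (simp add: sum_negf del: fscale_apply)
    finally show ?thesis using dim_Yf_step[of n "int (Suc q)" p \<mu>] Suc.prems False by (simp del: fscale_apply)
  qed
qed

section \<open>Surjectivity of the Laplacian on polynomial coefficients\<close>

text \<open>Integration in the coordinate a, sending x_a^m to x_a^(m+1) / (m+1): a right inverse of
  \<open>D a\<close> that commutes with the derivatives in the other coordinates.\<close>

lift_definition J :: "nat \<Rightarrow> lop" is
  "\<lambda>a f (e, S). if e a > 0 then f (e(a := e a - 1), S) / of_nat (e a) else 0"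
  by (auto simp: fun_eq_iff add_divide_distrib)

lemma J_app: "app (J a) f (e, S) = (if e a > 0 then f (e(a := e a - 1), S) / of_nat (e a) else 0)"
  by (simp add: J.rep_eq)

lemma DJ: "D a * J a = 1"
  by (intro lop_eqI2) (auto simp: basic_eval J_app upd_back simp del: of_nat_Suc of_nat_add)

lemma DJ_comm: "a \<noteq> b \<Longrightarrow> D a * J b = J b * D a"
  by (intro lop_eqI2) (auto simp: basic_eval J_app fun_upd_twist)

lemma J_sp:
  assumes "a \<in> ix n" "f \<in> sp n p q \<mu>"
  shows "app (J a) f \<in> sp n (p + 1) q (\<mu> + bw n a)"
proof (rule fsupI)
  fix e S assume "app (J a) f (e, S) \<noteq> 0"
  then have "app (X a) f (e, S) \<noteq> 0" by (auto simp: basic_eval J_app split: if_splits)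
  then show "(e, S) \<in> widx n (p + 1) q (\<mu> + bw n a)" by (rule fsupD[OF X_sp[OF assms]])
qed

lemma cop_left_comm: "P * (cop c * Q) = cop c * (P * Q)"
  by (rule lop_eqI) simp

text \<open>The Laplacian is D0 + R with D0 having the right inverse S and R nilpotent and commuting with S.\<close>

lemma lap_surj_aux:
  assumes "n > 0" "f \<in> sp n p q \<mu>"
    "app ((\<Sum>a\<in>ix n - {1, Suc n}. D a * D (pr n a)) ^ L) f = 0"
  shows "\<exists>g \<in> sp n (p + 2) q \<mu>. app (lap n) g = f"
  using assms(2,3)
proof (induction L arbitrary: f)
  case 0
  then have "f = 0" by (simp only: power_0 app_simps)
  then show ?case using FS.subspace_0[OF subspace_fsup] app_0 by metis
next
  case (Suc L)
  define R where "R = (\<Sum>a\<in>ix n - {1, Suc n}. D a * D (pr n a))"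
  \<comment> \<open>The factor 1/2 is there because the pair of coordinates 1 and n + 1 occurs twice
    in the sum defining \<open>lap n\<close>.\<close>
  define S where "S = cop (1/2) * J 1 * J (Suc n)"
  have ix: "1 \<in> ix n" "Suc n \<in> ix n" and pr: "pr n 1 = Suc n" "pr n (Suc n) = 1"
    using assms(1) by (auto simp: ix_def pr_def)
  have lap: "lap n = cop 2 * (D 1 * D (Suc n)) + R"
  proof -
    have e: "ix n - {1} - {Suc n} = ix n - {1, Suc n}" by blast
    have "lap n = D 1 * D (pr n 1) + (\<Sum>a\<in>ix n - {1}. D a * D (pr n a))"
      unfolding lap_def using ix by (intro sum.remove) simp_all
    also have "(\<Sum>a\<in>ix n - {1}. D a * D (pr n a))
        = D (Suc n) * D (pr n (Suc n)) + (\<Sum>a\<in>ix n - {1} - {Suc n}. D a * D (pr n a))"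
      using ix assms(1) by (intro sum.remove) simp_all
    finally have "lap n = D 1 * D (Suc n) + D 1 * D (Suc n) + R"
      unfolding e R_def[symmetric] pr DD[of "Suc n" 1] by (simp only: add.assoc)
    also have "D 1 * D (Suc n) + D 1 * D (Suc n) = cop 2 * (D 1 * D (Suc n))"
      using cop_add[of 1 1] by (simp add: mult_2)
    finally show ?thesis .
  qed
  have DS: "cop 2 * (D 1 * D (Suc n)) * S = 1"
  proof -
    have c: "D (Suc n) * J 1 = J 1 * D (Suc n)" using assms(1) by (intro DJ_comm) simp
    have "cop 2 * (D 1 * D (Suc n)) * S = cop 2 * (D 1 * D (Suc n) * (cop (1/2) * (J 1 * J (Suc n))))"
      by (simp only: S_def mult.assoc)
    also have "\<dots> = (cop 2 * cop (1/2)) * (D 1 * (D (Suc n) * J 1) * J (Suc n))"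
      unfolding cop_left_comm[of "D 1 * D (Suc n)"] by (simp only: mult.assoc)
    also have "\<dots> = (cop 2 * cop (1/2)) * ((D 1 * J 1) * (D (Suc n) * J (Suc n)))"
      unfolding c by (simp only: mult.assoc)
    also have "\<dots> = 1" unfolding cop_mult[symmetric] DJ by simp
    finally show ?thesis .
  qed
  have DSc: "D a * S = S * D a" if "a \<notin> {1, Suc n}" for a
  proof -
    have "D a * S = cop (1/2) * (D a * J 1) * J (Suc n)"
      by (simp only: S_def cop_left_comm[of "D a"] mult.assoc)
    also have "\<dots> = cop (1/2) * J 1 * (D a * J (Suc n))" using that by (simp add: DJ_comm mult.assoc)
    also have "\<dots> = S * D a" using that by (simp add: DJ_comm S_def mult.assoc)
    finally show ?thesis .
  qed
  have RS: "R * S = S * R"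
  proof -
    have "D a * D (pr n a) * S = S * (D a * D (pr n a))" if "a \<in> ix n - {1, Suc n}" for a
    proof -
      have "pr n a \<notin> {1, Suc n}" using that by (auto simp: ix_def pr_def split: if_splits)
      then have "D a * D (pr n a) * S = (D a * S) * D (pr n a)" by (simp add: DSc mult.assoc)
      also have "\<dots> = S * (D a * D (pr n a))" using that DSc[of a] by (simp add: mult.assoc)
      finally show ?thesis .
    qed
    then show ?thesis unfolding R_def sum_distrib_left sum_distrib_right by (intro sum.cong refl) auto
  qed
  have RLS: "R ^ m * S = S * R ^ m" for m
    by (induction m) (auto simp: RS mult.assoc, simp add: RS flip: mult.assoc)
  have S_sp: "app S g \<in> sp n (r + 2) q \<mu>" if "g \<in> sp n r q \<mu>" for g r
    using fsup_scale[OF J_sp[OF ix(1) J_sp[OF ix(2) that]], of "1/2"] bw_pr[OF ix(1), unfolded pr]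
    by (simp add: S_def algebra_simps)
  have R_sp: "app R f \<in> sp n (p - 2) q \<mu>"
    unfolding R_def app_sum_op
  proof (rule fsup_sum)
    fix a assume "a \<in> ix n - {1, Suc n}"
    then have a: "a \<in> ix n" by auto
    show "app (D a * D (pr n a)) f \<in> sp n (p - 2) q \<mu>"
      using D_sp[OF a D_sp[OF pr_mem[OF a] Suc.prems(1)]] by (simp add: bw_pr a algebra_simps)
  qed
  \<comment> \<open>Applying the Laplacian to S f gives f plus the error S (R f). The error is
    killed by one power of R fewer than f, so the induction hypothesis supplies a preimage of
    it.\<close>
  have "app (R ^ L) (app (S * R) f) = app (R ^ L * S * R) f" by simp
  also have "\<dots> = app S (app (R ^ Suc L) f)" unfolding RLS by (simp only: mult.assoc power_Suc2 app_simps)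
  also have "\<dots> = 0" using Suc.prems(2) by (simp only: R_def app_0)
  finally obtain g where g: "g \<in> sp n (p + 2) q \<mu>" "app (lap n) g = app (S * R) f"
    using Suc.IH[of "app (S * R) f"] S_sp[OF R_sp] unfolding R_def[symmetric] by auto
  have "app (lap n) (app S f) = f + app (S * R) f"
  proof -
    have "lap n * S = 1 + S * R" unfolding lap distrib_right DS RS ..
    then have "app (lap n * S) f = app (1 + S * R) f" by simp
    then show ?thesis by (simp only: app_simps)
  qed
  then have "app (lap n) (app S f - g) = f" unfolding app_diff g(2) by (simp only: add_diff_cancel_right')
  then show ?case using fsup_diff[OF S_sp[OF Suc.prems(1)] g(1)] by blast
qed

text \<open>R lowers the coefficient degree by 2, so its power with exponent |p| + 1 reaches a
  negative degree and annihilates f.\<close>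

lemma lap_surj:
  assumes "n > 0" "f \<in> sp n p q \<mu>"
  shows "\<exists>g \<in> sp n (p + 2) q \<mu>. app (lap n) g = f"
proof -
  define R where "R = (\<Sum>a\<in>ix n - {1, Suc n}. D a * D (pr n a))"
  have R_sp: "app R g \<in> sp n (r - 2) q \<mu>" if "g \<in> sp n r q \<mu>" for g r
    unfolding R_def app_sum_op
  proof (rule fsup_sum)
    fix a assume "a \<in> ix n - {1, Suc n}"
    then have a: "a \<in> ix n" by auto
    show "app (D a * D (pr n a)) g \<in> sp n (r - 2) q \<mu>"
      using D_sp[OF a D_sp[OF pr_mem[OF a] that]] by (simp add: bw_pr a algebra_simps)
  qed
  have "app (R ^ m) f \<in> sp n (p - 2 * int m) q \<mu>" for m
  proof (induction m)
    case (Suc m)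
    then show ?case using R_sp[OF Suc] by (simp add: algebra_simps)
  qed (use assms in simp)
  from this[of "Suc (nat \<bar>p\<bar>)"] have "app (R ^ Suc (nat \<bar>p\<bar>)) f = 0"
    using widx_neg[of "p - 2 * int (Suc (nat \<bar>p\<bar>))" q n \<mu>] by (simp add: abs_if split: if_splits)
  then show ?thesis using lap_surj_aux[OF assms] unfolding R_def by blast
qed

section \<open>The dimension of the space of closed and coclosed forms\<close>

text \<open>A coclosed y is the codifferential of some z. Write z as the Laplacian of z' and let
  \<xi> be the codifferential of z'. Then y is the Laplacian of \<xi>, and since \<xi> is coclosed
  this is the codifferential of the closed form d \<xi>.\<close>

lemma del_image_Zf:
  assumes "n > 0" "p \<ge> 0" "q \<le> int n"
  shows "app (del n) ` Zf n p q \<mu> = Yf n (p - 1) (q - 1) \<mu>"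
proof
  show "app (del n) ` Zf n p q \<mu> \<subseteq> Yf n (p - 1) (q - 1) \<mu>"
  proof
    fix g assume "g \<in> app (del n) ` Zf n p q \<mu>"
    then obtain f where f: "f \<in> sp n p q \<mu>" "g = app (del n) f" by (auto simp: Zf_def)
    have "app (del n) g = 0" unfolding f(2) app_simps(6)[symmetric] del_del by simp
    then show "g \<in> Yf n (p - 1) (q - 1) \<mu>" using del_sp[OF f(1)] f(2) by (simp add: Yf_def)
  qed
  show "Yf n (p - 1) (q - 1) \<mu> \<subseteq> app (del n) ` Zf n p q \<mu>"
  proof
    fix y assume "y \<in> Yf n (p - 1) (q - 1) \<mu>"
    then obtain z where z: "z \<in> sp n p q \<mu>" "y = app (del n) z"
      using del_image[of n "q - 1" "p - 1" \<mu>] assms by auto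
    obtain z' where z': "z' \<in> sp n (p + 2) q \<mu>" "app (lap n) z' = z"
      using lap_surj[OF assms(1) z(1)] by blast
    define \<xi> where "\<xi> = app (del n) z'"
    have \<xi>: "\<xi> \<in> sp n (p + 1) (q - 1) \<mu>" using del_sp[OF z'(1)] by (simp add: \<xi>_def add.commute)
    have "app (del n) \<xi> = 0" unfolding \<xi>_def app_simps(6)[symmetric] del_del by simp
    moreover have "app (lap n) \<xi> = y"
      unfolding \<xi>_def z(2) z'(2)[symmetric] app_simps(6)[symmetric] lap_del ..
    ultimately have "y = app (del n) (app (dE n) \<xi>)"
      unfolding dE_del[symmetric] by (simp only: app_simps app_0 add_0_left)
    moreover have "app (dE n) \<xi> \<in> Zf n p q \<mu>"
    proof -
      have "app (dE n) (app (dE n) \<xi>) = 0" unfolding app_simps(6)[symmetric] dE_dE by simp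
      then show ?thesis using dE_sp[OF \<xi>] by (simp add: Zf_def)
    qed
    ultimately show "y \<in> app (del n) ` Zf n p q \<mu>" by blast
  qed
qed

text \<open>The kernel of the codifferential on closed forms has codimension equal to the dimension
  of its image, the coclosed forms with both degrees lowered by one. The shift j = i + 1 merges the
  two alternating sums.\<close>

lemma dim_Mf:
  assumes "n > 0" "1 \<le> p" "p \<le> n"
  shows "int (FS.dim (Mf n (int k) (int p) \<mu>))
    = (\<Sum>j=1..p. (-1) ^ (j - 1) * (cnt n (int k + int j) (int p - int j) \<mu> - cnt n (int k - int j) (int p - int j) \<mu>))"
proof -
  have sub: "FS.subspace (Zf n (int k) (int p) \<mu>)"
    using subspace_fsup[of "widx n (int k) (int p) \<mu>"] by (auto simp: Zf_def FS.subspace_def)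
  have "Mf n (int k) (int p) \<mu> = {f \<in> Zf n (int k) (int p) \<mu>. app (del n) f = 0}"
    by (auto simp: Mf_def Zf_def)
  then have "int (FS.dim (Mf n (int k) (int p) \<mu>))
     = int (FS.dim (Zf n (int k) (int p) \<mu>)) - int (FS.dim (Yf n (int k - 1) (int p - 1) \<mu>))"
    using rank_nullity_sp[OF sub, of n "int k" "int p" \<mu> "del n"] del_image_Zf[of n "int k" "int p" \<mu>] assms
    by (simp add: Zf_def)
  also have "int (FS.dim (Yf n (int k - 1) (int p - 1) \<mu>))
     = (\<Sum>i=0..p-1. (-1) ^ i * cnt n (int k - 1 - int i) (int p - 1 - int i) \<mu>)"
    using dim_Yf[of "p - 1" n "int k - 1" \<mu>] assms by (simp add: of_nat_diff)
  also have "\<dots> = (\<Sum>j=Suc 0..Suc (p-1). (-1) ^ (j - 1) * cnt n (int k - int j) (int p - int j) \<mu>)"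
    by (subst sum.shift_bounds_cl_Suc_ivl) (auto simp: algebra_simps)
  also have "Suc (p - 1) = p" using assms by simp
  finally show ?thesis using dim_Zf[of "int k" p n \<mu>] assms
    by (simp add: sum_subtractf right_diff_distrib del: fscale_apply)
qed

section \<open>Modules over the orthogonal Lie algebra\<close>

lemma pr_inj: "a \<in> ix n \<Longrightarrow> b \<in> ix n \<Longrightarrow> pr n a = pr n b \<longleftrightarrow> a = b"
  by (auto simp: pr_def ix_def split: if_splits)

lemma Jform_pr: "i \<in> ix n \<Longrightarrow> Jform n i j = of_bool (j = pr n i)"
  "j \<in> ix n \<Longrightarrow> Jform n i j = of_bool (i = pr n j)"
  by (auto simp: Jform_def ix_def pr_def)

lemma Jform_out: "i \<notin> ix n \<Longrightarrow> Jform n i j = 0" "j \<notin> ix n \<Longrightarrow> Jform n i j = 0"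
  by (auto simp: Jform_def ix_def)

lemma mat_supp_iff: "mat_supp n A \<longleftrightarrow> (\<forall>a b. a \<notin> ix n \<or> b \<notin> ix n \<longrightarrow> A a b = 0)"
  by (auto simp: mat_supp_def ix_def)

lemma mmul_ix: "mmul n A B i j = (\<Sum>l\<in>ix n. A i l * B l j)"
  by (simp add: mmul_def ix_def)

text \<open>Multiplication by \<open>Jform n\<close> only permutes rows or columns by the pairing,
  so the matrix equation becomes an antisymmetry between single entries.\<close>

lemma so_iff: "A \<in> so n \<longleftrightarrow> (\<forall>a b. a \<notin> ix n \<or> b \<notin> ix n \<longrightarrow> A a b = 0)
    \<and> (\<forall>a\<in>ix n. \<forall>b\<in>ix n. A (pr n b) (pr n a) = - A a b)" (is "_ \<longleftrightarrow> ?s \<and> ?r")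
proof -
  have l: "mmul n (mtrans A) (Jform n) i j = (if j \<in> ix n then A (pr n j) i else 0)" for i j
    by (auto simp: mmul_ix mtrans_def Jform_pr(2) Jform_out of_bool_def if_distrib cong: if_cong)
  have r: "mmul n (Jform n) A i j = (if i \<in> ix n then A (pr n i) j else 0)" for i j
    by (auto simp: mmul_ix Jform_pr(1) Jform_out of_bool_def if_distrib[of "\<lambda>x. x * _"] cong: if_cong)
  have so: "A \<in> so n \<longleftrightarrow> mat_supp n A \<and> (\<forall>i j. (if j \<in> ix n then A (pr n j) i else 0)
      + (if i \<in> ix n then A (pr n i) j else 0) = 0)"
    by (simp only: so_def mem_Collect_eq l r)
  show ?thesis
  proof
    assume "A \<in> so n"
    then have A: "mat_supp n A" "\<And>i j. (if j \<in> ix n then A (pr n j) i else 0) + (if i \<in> ix n then A (pr n i) j else 0) = 0"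
      unfolding so by blast+
    have "A (pr n b) (pr n a) = - A a b" if "a \<in> ix n" "b \<in> ix n" for a b
      using A(2)[of "pr n a" b] that by (simp add: eq_neg_iff_add_eq_0 add.commute)
    with A(1) show "?s \<and> ?r" by (simp add: mat_supp_iff)
  next
    assume A: "?s \<and> ?r"
    have "A (pr n j) i + A (pr n i) j = 0" if "i \<in> ix n" "j \<in> ix n" for i j
    proof -
      have "A (pr n j) (pr n (pr n i)) = - A (pr n i) j" using A pr_mem[OF that(1)] that(2) by blast
      then show ?thesis using that(1) by simp
    qed
    then show "A \<in> so n" unfolding so using conjunct1[OF A] by (auto simp: mat_supp_iff)
  qed
qed

lemma soI:
  assumes "\<And>a b. a \<notin> ix n \<or> b \<notin> ix n \<Longrightarrow> A a b = 0"
    and "\<And>a b. a \<in> ix n \<Longrightarrow> b \<in> ix n \<Longrightarrow> A (pr n b) (pr n a) = - A a b"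
  shows "A \<in> so n"
  unfolding so_iff using assms by blast

lemma so_out: "A \<in> so n \<Longrightarrow> a \<notin> ix n \<or> b \<notin> ix n \<Longrightarrow> A a b = 0"
  and so_neg: "A \<in> so n \<Longrightarrow> a \<in> ix n \<Longrightarrow> b \<in> ix n \<Longrightarrow> A (pr n b) (pr n a) = - A a b"
  unfolding so_iff by blast+

section \<open>Generators of so(2n) and their heights\<close>

text \<open>For a = b this is a diagonal matrix, for b = \<open>pr n a\<close> it is 0, and
  otherwise it is a root vector.\<close>

definition Fm :: "nat \<Rightarrow> nat \<Rightarrow> nat \<Rightarrow> cmat" where
  "Fm n a b = (\<lambda>i j. of_bool (i = a \<and> j = b) - of_bool (i = pr n b \<and> j = pr n a))"

lemma Fm_so [simp]:
  assumes "a \<in> ix n" "b \<in> ix n" shows "Fm n a b \<in> so n"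
proof (rule soI)
  fix i j
  show "i \<notin> ix n \<or> j \<notin> ix n \<Longrightarrow> Fm n a b i j = 0" using assms by (auto simp: Fm_def)
  assume ij: "i \<in> ix n" "j \<in> ix n"
  have e: "pr n j = a \<longleftrightarrow> j = pr n a" "pr n i = b \<longleftrightarrow> i = pr n b"
    "pr n j = pr n b \<longleftrightarrow> j = b" "pr n i = pr n a \<longleftrightarrow> i = a"
    using pr_eq_iff[OF ij(2) assms(1)] pr_eq_iff[OF ij(1) assms(2)]
      pr_inj[OF ij(2) assms(2)] pr_inj[OF ij(1) assms(1)] by auto
  show "Fm n a b (pr n j) (pr n i) = - Fm n a b i j"
    unfolding Fm_def e by (simp add: conj_commute)
qed

lemma so_madd: "A \<in> so n \<Longrightarrow> B \<in> so n \<Longrightarrow> madd A B \<in> so n"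
  by (rule soI) (auto simp: madd_def so_out so_neg)

lemma so_msmult: "A \<in> so n \<Longrightarrow> msmult c A \<in> so n"
  by (rule soI) (auto simp: msmult_def so_out so_neg)

lemma so_zero: "(\<lambda>i j. 0) \<in> so n"
  by (rule soI) auto

lemma so_bracket:
  assumes "A \<in> so n" "B \<in> so n" shows "bracket n A B \<in> so n"
proof (rule soI)
  fix a b
  show "a \<notin> ix n \<or> b \<notin> ix n \<Longrightarrow> bracket n A B a b = 0"
    using assms by (auto simp: bracket_def mmul_ix so_out intro!: sum.neutral)
  assume ab: "a \<in> ix n" "b \<in> ix n"
  have m: "mmul n A B (pr n b) (pr n a) = mmul n B A a b" if "A \<in> so n" "B \<in> so n" for A B
  proof -
    have "mmul n A B (pr n b) (pr n a) = (\<Sum>l\<in>ix n. A (pr n b) (pr n l) * B (pr n l) (pr n a))"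
      unfolding mmul_ix by (rule sum_pr[symmetric])
    also have "\<dots> = (\<Sum>l\<in>ix n. B a l * A l b)"
      using that ab by (intro sum.cong refl) (simp add: so_neg mult.commute)
    finally show ?thesis unfolding mmul_ix .
  qed
  show "bracket n A B (pr n b) (pr n a) = - bracket n A B a b"
    unfolding bracket_def using m[OF assms] m[OF assms(2,1)] by simp
qed

text \<open>The pair (\<open>pr n b\<close>, \<open>pr n a\<close>) yields the same summand as (a,
  b), coefficient and generator both changing sign; hence the division by 2.\<close>

lemma so_expand:
  assumes "A \<in> so n"
  shows "A = (\<lambda>i j. \<Sum>s\<in>ix n \<times> ix n. (A (fst s) (snd s) / 2) * Fm n (fst s) (snd s) i j)"
proof (intro ext)
  fix i j
  have eq: "(\<Sum>s\<in>ix n \<times> ix n. (A (fst s) (snd s) / 2) * Fm n (fst s) (snd s) i j)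
    = (\<Sum>a\<in>ix n. \<Sum>b\<in>ix n. (A a b / 2) * of_bool (i = a \<and> j = b))
      - (\<Sum>a\<in>ix n. \<Sum>b\<in>ix n. (A a b / 2) * of_bool (i = pr n b \<and> j = pr n a))"
    by (simp add: sum.cartesian_product[symmetric] case_prod_beta Fm_def right_diff_distrib sum_subtractf
        sum.cartesian_product')
  have s: "(\<Sum>a\<in>ix n. \<Sum>b\<in>ix n. c a b * of_bool (x = a \<and> y = b)) = (if x \<in> ix n \<and> y \<in> ix n then c x y else 0)"
    for c :: cmat and x y
  proof -
    have "(\<Sum>b\<in>ix n. c a b * of_bool (x = a \<and> y = b)) = (if x = a then if y \<in> ix n then c a y else 0 else 0)" for a
    proof -
      have "(\<Sum>b\<in>ix n. c a b * of_bool (x = a \<and> y = b)) = (\<Sum>b\<in>ix n. if b = y then (if x = a then c a y else 0) else 0)"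
        by (intro sum.cong) auto
      then show ?thesis by simp
    qed
    then show ?thesis by simp
  qed
  show "A i j = (\<Sum>s\<in>ix n \<times> ix n. (A (fst s) (snd s) / 2) * Fm n (fst s) (snd s) i j)"
  proof (cases "i \<in> ix n \<and> j \<in> ix n")
    case True
    have "(\<Sum>a\<in>ix n. \<Sum>b\<in>ix n. (A a b / 2) * of_bool (i = pr n b \<and> j = pr n a))
        = (\<Sum>a\<in>ix n. \<Sum>b\<in>ix n. (A a b / 2) * of_bool (pr n j = a \<and> pr n i = b))"
    proof (intro sum.cong refl arg_cong2[of _ _ _ _ "(*)"] arg_cong[of _ _ of_bool])
      fix a b assume "a \<in> ix n" "b \<in> ix n"
      then show "(i = pr n b \<and> j = pr n a) = (pr n j = a \<and> pr n i = b)"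
        using True pr_eq_iff[of i n b] pr_eq_iff[of j n a] by blast
    qed
    also have "\<dots> = A (pr n j) (pr n i) / 2" unfolding s using True by simp
    finally show ?thesis unfolding eq s using True assms by (simp add: so_neg)
  next
    case False
    have "(\<Sum>a\<in>ix n. \<Sum>b\<in>ix n. (A a b / 2) * of_bool (i = pr n b \<and> j = pr n a)) = 0"
      using False by (intro sum.neutral ballI) auto
    then show ?thesis unfolding eq s using False assms by (auto simp: so_out)
  qed
qed

text \<open>The eigenvalues of the element H0 of the Cartan subalgebra given by half the sum of the positive
  roots; a root vector is positive iff it raises ht.\<close>

definition ht :: "nat \<Rightarrow> nat \<Rightarrow> int" where
  "ht n a = (if a \<le> n then int n - int a else int a - 2 * int n)"

lemma ht_pr: "a \<in> ix n \<Longrightarrow> ht n (pr n a) = - ht n a"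
  by (auto simp: ht_def pr_def ix_def)

text \<open>The only distinct indices of equal height are n and 2n, both of height 0; they are
  paired, and the corresponding generator is 0. So every generator that is neither diagonal nor zero
  raises or lowers the height.\<close>

lemma ht_eq:
  assumes "a \<in> ix n" "b \<in> ix n" "ht n a = ht n b"
  shows "a = b \<or> b = pr n a"
  using assms by (auto simp: ht_def ix_def pr_def split: if_splits)

lemma Fm_zero: "a \<in> ix n \<Longrightarrow> b = pr n a \<Longrightarrow> Fm n a b = (\<lambda>i j. 0)"
  by (auto simp: Fm_def fun_eq_iff)

definition H0 :: "nat \<Rightarrow> cmat" where
  "H0 n = (\<lambda>i j. if i = j \<and> i \<in> ix n then of_int (ht n i) else 0)"

lemma H0_so [simp]: "H0 n \<in> so n"
proof (rule soI)
  fix a b assume "a \<in> ix n" "b \<in> ix n"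
  moreover then have "pr n b = pr n a \<longleftrightarrow> a = b" by (simp add: pr_inj eq_commute)
  ultimately show "H0 n (pr n b) (pr n a) = - H0 n a b" by (auto simp: H0_def ht_pr)
qed (auto simp: H0_def)

lemma bracket_diag:
  assumes "a \<in> ix n" "b \<in> ix n" and "H \<in> cartan n"
  shows "bracket n H (Fm n a b) = msmult (H a a - H b b) (Fm n a b)"
proof (intro ext)
  fix i j
  have Hs: "H \<in> so n" "\<And>i j. i \<noteq> j \<Longrightarrow> H i j = 0" using assms(3) by (auto simp: cartan_def)
  have H: "H (pr n c) (pr n c) = - H c c" if "c \<in> ix n" for c
    using Hs(1) that by (simp add: so_neg)
  have "mmul n H B i j = (\<Sum>l\<in>ix n. if l = i then H i i * B i j else 0)" for B
    unfolding mmul_ix using Hs(2) by (intro sum.cong) auto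
  then have 1: "mmul n H B i j = (if i \<in> ix n then H i i * B i j else 0)" for B by simp
  have "mmul n B H i j = (\<Sum>l\<in>ix n. if l = j then B i j * H j j else 0)" for B
    unfolding mmul_ix using Hs(2) by (intro sum.cong) auto
  then have 2: "mmul n B H i j = (if j \<in> ix n then B i j * H j j else 0)" for B by simp
  show "bracket n H (Fm n a b) i j = msmult (H a a - H b b) (Fm n a b) i j"
    unfolding bracket_def 1 2 msmult_def using assms(1,2) H
    by (auto simp: Fm_def algebra_simps)
qed

lemma H0_cartan [simp]: "H0 n \<in> cartan n"
  by (auto simp: cartan_def) (simp add: H0_def)

lemma Fm_diag_cartan [simp]: "a \<in> ix n \<Longrightarrow> Fm n a a \<in> cartan n"
  by (auto simp: cartan_def) (auto simp: Fm_def)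

section \<open>Abstract modules and the submodule generated by a highest weight vector\<close>

text \<open>Common ground for three modules: the given representation V, the infinite-dimensional
  space of all forms, and their product.\<close>

locale so_module = vector_space sc
  for sc :: "complex \<Rightarrow> 'v::ab_group_add \<Rightarrow> 'v" +
  fixes n :: nat and \<rho> :: "cmat \<Rightarrow> 'v \<Rightarrow> 'v"
  assumes rho_add: "A \<in> so n \<Longrightarrow> \<rho> A (u + v) = \<rho> A u + \<rho> A v"
    and rho_scale: "A \<in> so n \<Longrightarrow> \<rho> A (sc c u) = sc c (\<rho> A u)"
    and rho_madd: "A \<in> so n \<Longrightarrow> B \<in> so n \<Longrightarrow> \<rho> (madd A B) u = \<rho> A u + \<rho> B u"
    and rho_msmult: "A \<in> so n \<Longrightarrow> \<rho> (msmult c A) u = sc c (\<rho> A u)"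
    and rho_bracket: "A \<in> so n \<Longrightarrow> B \<in> so n \<Longrightarrow> \<rho> (bracket n A B) u = \<rho> A (\<rho> B u) - \<rho> B (\<rho> A u)"
begin

lemma rho_0 [simp]: "A \<in> so n \<Longrightarrow> \<rho> A 0 = 0"
  using rho_scale[of A 0 0] by simp

lemma rho_diff: "A \<in> so n \<Longrightarrow> \<rho> A (u - v) = \<rho> A u - \<rho> A v"
  using rho_add[of A "u - v" v] by (simp add: algebra_simps)

lemma rho_zero_mat: "\<rho> (\<lambda>i j. 0) u = 0"
  using rho_msmult[of "\<lambda>i j. 0" 0 u] so_zero[of n] by (simp add: msmult_def)

lemma rho_lincomb:
  assumes "finite S" "\<And>s. s \<in> S \<Longrightarrow> G s \<in> so n"
  shows "(\<lambda>i j. \<Sum>s\<in>S. c s * G s i j) \<in> so n \<and>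
    \<rho> (\<lambda>i j. \<Sum>s\<in>S. c s * G s i j) u = (\<Sum>s\<in>S. sc (c s) (\<rho> (G s) u))"
  using assms
proof (induction S rule: finite_induct)
  case empty
  show ?case unfolding sum.empty using so_zero rho_zero_mat by auto
next
  case (insert x F)
  have e: "(\<lambda>i j. \<Sum>s\<in>insert x F. c s * G s i j) = madd (msmult (c x) (G x)) (\<lambda>i j. \<Sum>s\<in>F. c s * G s i j)"
    using insert.hyps by (auto simp: madd_def msmult_def)
  have IH: "(\<lambda>i j. \<Sum>s\<in>F. c s * G s i j) \<in> so n"
     "\<rho> (\<lambda>i j. \<Sum>s\<in>F. c s * G s i j) u = (\<Sum>s\<in>F. sc (c s) (\<rho> (G s) u))"
    using insert.IH insert.prems by auto
  have x: "G x \<in> so n" using insert.prems by auto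
  show ?case unfolding e using IH x so_msmult[OF x] so_madd insert.hyps
    by (simp add: rho_madd rho_msmult)
qed

lemma rho_expand:
  assumes "A \<in> so n"
  shows "\<rho> A u = (\<Sum>s\<in>ix n \<times> ix n. sc (A (fst s) (snd s) / 2) (\<rho> (Fm n (fst s) (snd s)) u))"
proof -
  have "\<rho> A u = \<rho> (\<lambda>i j. \<Sum>s\<in>ix n \<times> ix n. (A (fst s) (snd s) / 2) * Fm n (fst s) (snd s) i j) u"
    using so_expand[OF assms] by metis
  also have "\<dots> = (\<Sum>s\<in>ix n \<times> ix n. sc (A (fst s) (snd s) / 2) (\<rho> (Fm n (fst s) (snd s)) u))"
    by (rule rho_lincomb[THEN conjunct2]) auto
  finally show ?thesis .
qed

definition smod :: "'v set \<Rightarrow> bool" where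
  "smod W \<longleftrightarrow> subspace W \<and> (\<forall>A\<in>so n. \<forall>w\<in>W. \<rho> A w \<in> W)"

text \<open>By \<open>rho_expand\<close> every element of so(2n) acts as a combination of the
  generators.\<close>

lemma smodI:
  assumes "subspace W" "\<And>a b w. a \<in> ix n \<Longrightarrow> b \<in> ix n \<Longrightarrow> w \<in> W \<Longrightarrow> \<rho> (Fm n a b) w \<in> W"
  shows "smod W"
  unfolding smod_def using assms
  by (auto simp: rho_expand intro!: subspace_sum subspace_scale)

lemma smodD: "smod W \<Longrightarrow> subspace W" "smod W \<Longrightarrow> A \<in> so n \<Longrightarrow> w \<in> W \<Longrightarrow> \<rho> A w \<in> W"
  by (auto simp: smod_def)

definition gen :: "'v \<Rightarrow> 'v set" where
  "gen v = {u. \<forall>W. smod W \<and> v \<in> W \<longrightarrow> u \<in> W}"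

lemma smod_gen: "smod (gen v)"
  unfolding smod_def
proof (intro conjI ballI)
  show "subspace (gen v)"
    by (auto simp: gen_def subspace_def smod_def)
qed (auto simp: gen_def smod_def)

lemma gen_self: "v \<in> gen v" by (auto simp: gen_def)

lemma gen_least: "smod W \<Longrightarrow> v \<in> W \<Longrightarrow> gen v \<subseteq> W"
  by (auto simp: gen_def)

text \<open>Results of applying at most l lowering operators to v. The union of the spans turns out
  to be closed under all of so(2n), in the manner of the Poincare-Birkhoff-Witt theorem.\<close>

primrec words :: "'v \<Rightarrow> nat \<Rightarrow> 'v set" where
  "words v 0 = {v}"
| "words v (Suc l) = words v l \<union> {\<rho> (Fm n c d) w | c d w. c \<in> ix n \<and> d \<in> ix n \<and> ht n c < ht n d \<and> w \<in> words v l}"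

definition hw_vec :: "(nat \<Rightarrow> complex) \<Rightarrow> 'v \<Rightarrow> bool" where
  "hw_vec L v \<longleftrightarrow> (\<forall>a\<in>ix n. \<forall>b\<in>ix n. ht n b < ht n a \<longrightarrow> \<rho> (Fm n a b) v = 0)
     \<and> (\<forall>a\<in>ix n. \<rho> (Fm n a a) v = sc (L a) v)"

text \<open>Induction on the length. Moving the operator past the outermost lowering operator leaves
  their bracket acting on a shorter word. The bracket is expanded in the generators: the lowering
  ones make the word at most one step longer, the others are covered by the induction
  hypothesis.\<close>

lemma words_raise:
  assumes v: "hw_vec L v"
  shows "u \<in> words v l \<Longrightarrow> a \<in> ix n \<Longrightarrow> b \<in> ix n \<Longrightarrow> ht n b \<le> ht n a \<Longrightarrow> \<rho> (Fm n a b) u \<in> span (words v l)"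
proof (induction l arbitrary: u a b)
  case 0
  then have [simp]: "u = v" by simp
  consider "ht n b < ht n a" | "a = b" | "b = pr n a" using ht_eq 0 by fastforce
  then show ?case
  proof cases
    case 1 then show ?thesis using v 0 by (auto simp: hw_vec_def span_zero)
  next
    case 2
    then have "\<rho> (Fm n a b) u = sc (L a) v" using v 0 by (auto simp: hw_vec_def)
    then show ?thesis using span_scale[OF span_base[of v "{v}"]] by simp
  next
    case 3 then show ?thesis using 0 by (simp add: Fm_zero rho_zero_mat span_zero)
  qed
next
  case (Suc l)
  have mono: "span (words v l) \<subseteq> span (words v (Suc l))" by (rule span_mono) auto
  show ?case
  proof (cases "u \<in> words v l")
    case True
    then show ?thesis using Suc mono by blast
  next
    case False
    then obtain c d w where u: "u = \<rho> (Fm n c d) w" "c \<in> ix n" "d \<in> ix n" "ht n c < ht n d" "w \<in> words v l"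
      using Suc.prems(1) by auto
    have lower: "\<rho> (Fm n c' d') w' \<in> span (words v (Suc l))"
      if "w' \<in> span (words v l)" "c' \<in> ix n" "d' \<in> ix n" "ht n c' < ht n d'" for c' d' w'
      using that(1)
    proof (induction rule: span_induct_alt)
      case base
      then show ?case using that by (simp add: span_zero)
    next
      case (step c x y)
      have "\<rho> (Fm n c' d') x \<in> words v (Suc l)" using step.hyps that by auto
      then show ?case using step that by (auto simp: rho_add rho_scale intro!: span_add span_scale intro: span_base)
    qed
    have any: "\<rho> (Fm n a' b') w \<in> span (words v (Suc l))" if "a' \<in> ix n" "b' \<in> ix n" for a' b'
    proof (cases "ht n b' \<le> ht n a'")
      case True
      then show ?thesis using Suc.IH[OF u(5)] that mono by blast
    next
      case False
      then show ?thesis using lower[of w a' b'] that u(5) span_base by auto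
    qed
    have "\<rho> (Fm n a b) u = \<rho> (Fm n c d) (\<rho> (Fm n a b) w) + \<rho> (bracket n (Fm n a b) (Fm n c d)) w"
      using Suc.prems u by (simp add: rho_bracket)
    moreover have "\<rho> (Fm n c d) (\<rho> (Fm n a b) w) \<in> span (words v (Suc l))"
      using lower Suc.IH[OF u(5)] Suc.prems u by blast
    moreover have "\<rho> (bracket n (Fm n a b) (Fm n c d)) w \<in> span (words v (Suc l))"
    proof -
      have br: "bracket n (Fm n a b) (Fm n c d) \<in> so n" using Suc.prems u by (intro so_bracket Fm_so)
      show ?thesis
        unfolding rho_expand[OF br] by (intro span_sum span_scale any) (simp_all add: mem_Times_iff)
    qed
    ultimately show ?thesis by (simp add: span_add)
  qed
qed

lemma gen_subset_words:
  assumes v: "hw_vec L v" shows "gen v \<subseteq> (\<Union>l. span (words v l))"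
proof (rule gen_least)
  have mono: "words v l \<subseteq> words v m" if "l \<le> m" for l m
    using that by (induction m) (auto simp: le_Suc_eq)
  show "v \<in> (\<Union>l. span (words v l))" using span_base[of v "words v 0"] by (intro UN_I[of 0]) auto
  show "smod (\<Union>l. span (words v l))"
  proof (rule smodI)
    show "subspace (\<Union>l. span (words v l))"
      unfolding subspace_def
    proof (intro conjI ballI allI)
      show "0 \<in> (\<Union>l. span (words v l))" using span_zero by auto
      fix x y assume "x \<in> (\<Union>l. span (words v l))" "y \<in> (\<Union>l. span (words v l))"
      then obtain l m where "x \<in> span (words v l)" "y \<in> span (words v m)" by auto
      then have "x \<in> span (words v (max l m))" "y \<in> span (words v (max l m))"
        using span_mono[OF mono[of l "max l m"]] span_mono[OF mono[of m "max l m"]] by auto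
      then show "x + y \<in> (\<Union>l. span (words v l))" using span_add by blast
    qed (auto intro: span_scale)
    fix a b w assume ab: "a \<in> ix n" "b \<in> ix n" and "w \<in> (\<Union>l. span (words v l))"
    then obtain l where "w \<in> span (words v l)" by auto
    then have "\<rho> (Fm n a b) w \<in> span (words v (Suc l))"
    proof (induction rule: span_induct_alt)
      case base
      then show ?case using ab by (simp add: span_zero)
    next
      case (step c x y)
      have "\<rho> (Fm n a b) x \<in> span (words v (Suc l))"
      proof (cases "ht n b \<le> ht n a")
        case True
        then show ?thesis using words_raise[OF v step.hyps(1) ab] span_mono[OF mono[of l "Suc l"]] by auto
      next
        case False
        then have "\<rho> (Fm n a b) x \<in> words v (Suc l)" using step.hyps ab by fastforce
        then show ?thesis by (rule span_base)
      qed
      then show ?case using step ab by (auto simp: rho_add rho_scale intro!: span_add span_scale)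
    qed
    then show "\<rho> (Fm n a b) w \<in> (\<Union>l. span (words v l))" by blast
  qed
qed

text \<open>A lowering operator decreases the eigenvalue of \<open>H0 n\<close> by a positive
  integer, so v is the only word that can have the top eigenvalue.\<close>

lemma words_eigen:
  assumes "\<rho> (H0 n) v = sc h v"
  shows "u \<in> words v l \<Longrightarrow> u = v \<or> (\<exists>j\<ge>1. \<rho> (H0 n) u = sc (h - of_nat j) u)"
proof (induction l arbitrary: u)
  case (Suc l)
  show ?case
  proof (cases "u \<in> words v l")
    case False
    then obtain c d w where u: "u = \<rho> (Fm n c d) w" "c \<in> ix n" "d \<in> ix n" "ht n c < ht n d" "w \<in> words v l"
      using Suc.prems(1) by auto
    obtain j where j: "\<rho> (H0 n) w = sc (h - of_nat j) w"
      using Suc.IH[OF u(5)] assms by (metis diff_zero of_nat_0)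
    have b: "bracket n (H0 n) (Fm n c d) = msmult (of_int (ht n c - ht n d)) (Fm n c d)"
      using bracket_diag[OF u(2,3) H0_cartan] u(2,3) by (simp add: H0_def)
    have "\<rho> (H0 n) u = \<rho> (Fm n c d) (\<rho> (H0 n) w) + \<rho> (bracket n (H0 n) (Fm n c d)) w"
      using u by (simp add: rho_bracket)
    also have "\<dots> = sc (h - of_nat j + of_int (ht n c - ht n d)) u"
      using u by (simp add: j b rho_scale rho_msmult scale_left_distrib)
    also have "h - of_nat j + of_int (ht n c - ht n d) = h - of_nat (j + nat (ht n d - ht n c))"
      using u(4) by (simp add: of_nat_nat)
    finally show ?thesis using u(4) by (intro disjI2 exI[of _ "j + nat (ht n d - ht n c)"]) auto
  qed (use Suc.IH in auto)
qed simp

text \<open>Qop h l kills the eigenvectors of H0 with eigenvalue h - j for 1 \<le> j \<le> l, but none with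
  eigenvalue h.\<close>

primrec Qop :: "complex \<Rightarrow> nat \<Rightarrow> 'v \<Rightarrow> 'v" where
  "Qop h 0 u = u"
| "Qop h (Suc l) u = \<rho> (H0 n) (Qop h l u) - sc (h - of_nat (Suc l)) (Qop h l u)"

lemma Qop_add: "Qop h l (u + v) = Qop h l u + Qop h l v"
  by (induction l) (simp_all add: rho_add scale_right_distrib)

lemma Qop_scale: "Qop h l (sc c u) = sc c (Qop h l u)"
  by (induction l) (simp_all add: rho_scale scale_right_diff_distrib mult.commute)

lemma Qop_eigen:
  assumes "\<rho> (H0 n) u = sc (h - of_nat j) u"
  shows "Qop h l u = sc (\<Prod>i=1..l. of_nat i - of_nat j) u"
proof (induction l)
  case (Suc l)
  have "Qop h (Suc l) u = sc (\<Prod>i=1..l. of_nat i - of_nat j) (sc (h - of_nat j) u - sc (h - of_nat (Suc l)) u)"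
    by (simp only: Qop.simps Suc rho_scale[OF H0_so] assms scale_right_diff_distrib scale_scale mult.commute)
  also have "sc (h - of_nat j) u - sc (h - of_nat (Suc l)) u = sc (of_nat (Suc l) - of_nat j) u"
    by (simp add: scale_left_diff_distrib)
  finally show ?case by (simp add: mult.commute)
qed simp

text \<open>Write u as a multiple of v plus a combination u' of words with smaller eigenvalues. The
  operator \<open>Qop h M\<close> kills u' for large M, but u' is itself an eigenvector with
  eigenvalue h, on which this operator is invertible.\<close>

lemma hw_unique:
  assumes v: "hw_vec L v" and h: "\<rho> (H0 n) v = sc h v"
    and u: "u \<in> gen v" "\<rho> (H0 n) u = sc h u"
  shows "\<exists>c. u = sc c v"
proof -
  obtain l where "u \<in> span (words v l)" using gen_subset_words[OF v] u(1) by auto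
  then have "\<exists>c u'. u = sc c v + u' \<and> (\<exists>M. \<forall>m\<ge>M. Qop h m u' = 0)"
  proof (induction rule: span_induct_alt)
    case base
    show ?case by (intro exI[of _ 0]) (use Qop_scale[of h _ 0 0] in auto)
  next
    case (step c x y)
    then obtain d y' M where y: "y = sc d v + y'" "\<And>m. m \<ge> M \<Longrightarrow> Qop h m y' = 0" by blast
    consider "x = v" | j where "j \<ge> 1" "\<rho> (H0 n) x = sc (h - of_nat j) x"
      using words_eigen[OF h step.hyps(1)] by blast
    then show ?case
    proof cases
      case 1
      then show ?thesis using y by (intro exI[of _ "c + d"] exI[of _ y']) (auto simp: scale_left_distrib)
    next
      case 2
      have "Qop h m x = 0" if "m \<ge> j" for m
        unfolding Qop_eigen[OF 2(2)] using that 2(1) by (subst prod_zero) auto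
      then have "Qop h m (sc c x + y') = 0" if "m \<ge> max M j" for m
        using that y(2) by (simp add: Qop_add Qop_scale)
      then have "\<exists>M. \<forall>m\<ge>M. Qop h m (sc c x + y') = 0" by blast
      then show ?thesis using y(1) by (intro exI[of _ d] exI[of _ "sc c x + y'"]) auto
    qed
  qed
  then obtain c u' M where u': "u = sc c v + u'" "Qop h M u' = 0" by blast
  have "u' = u - sc c v" using u'(1) by simp
  then have "\<rho> (H0 n) u' = sc (h - of_nat 0) u'"
    using u(2) h by (simp add: rho_diff rho_scale scale_right_diff_distrib mult.commute)
  \<comment> \<open>For j = 0 the scalar is M!, which is nonzero.\<close>
  from Qop_eigen[OF this, of M] u'(2) have "u' = 0" by auto
  then show ?thesis using u'(1) by auto
qed

end

section \<open>The module of closed and coclosed forms\<close>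

definition RM :: "nat \<Rightarrow> cmat \<Rightarrow> lop" where
  "RM n A = (\<Sum>a\<in>ix n. \<Sum>b\<in>ix n. cop (A a b) * T a b)"

definition rM :: "nat \<Rightarrow> cmat \<Rightarrow> form \<Rightarrow> form" where
  "rM n A f = app (RM n A) f"

lemma RM_madd: "RM n (madd A B) = RM n A + RM n B"
  by (simp add: RM_def madd_def cop_add distrib_right sum.distrib)

lemma RM_msmult: "RM n (msmult c A) = cop c * RM n A"
  by (simp add: RM_def msmult_def cop_mult sum_distrib_left mult.assoc)

lemma RM_mult:
  "RM n A * RM n B = (\<Sum>a\<in>ix n. \<Sum>b\<in>ix n. \<Sum>c\<in>ix n. \<Sum>d\<in>ix n. cop (A a b * B c d) * (T a b * T c d))"
proof -
  have "RM n A * RM n B = (\<Sum>a\<in>ix n. \<Sum>b\<in>ix n. \<Sum>c\<in>ix n. \<Sum>d\<in>ix n. (cop (A a b) * T a b) * (cop (B c d) * T c d))"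
  proof -
    have 1: "RM n A * R = (\<Sum>a\<in>ix n. \<Sum>b\<in>ix n. (cop (A a b) * T a b) * R)" for R
      by (simp only: RM_def sum_distrib_right)
    have 2: "R * RM n B = (\<Sum>c\<in>ix n. \<Sum>d\<in>ix n. R * (cop (B c d) * T c d))" for R
      by (simp only: RM_def sum_distrib_left)
    show ?thesis unfolding 1 unfolding 2 ..
  qed
  moreover have "(cop x * T a b) * (cop y * T c d) = cop (x * y) * (T a b * T c d)" for x y a b c d
    by (simp only: mult.assoc cop_left_comm[of "T a b"] cop_mult)
  ultimately show ?thesis by simp
qed

lemma sum4_swap: "(\<Sum>a\<in>A. \<Sum>b\<in>A. \<Sum>c\<in>A. \<Sum>d\<in>A. g a b c d) = (\<Sum>a\<in>A. \<Sum>b\<in>A. \<Sum>c\<in>A. \<Sum>d\<in>A. g c d a b)"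
  for g :: "_ \<Rightarrow> _ \<Rightarrow> _ \<Rightarrow> _ \<Rightarrow> 'c::comm_monoid_add"
proof -
  have c: "(\<Sum>a\<in>A. \<Sum>b\<in>A. u a b) = (\<Sum>p\<in>A\<times>A. u (fst p) (snd p))" for u :: "_ \<Rightarrow> _ \<Rightarrow> 'c"
    by (simp add: sum.cartesian_product case_prod_beta)
  show ?thesis
    unfolding c[of "\<lambda>a b. \<Sum>c\<in>A. \<Sum>d\<in>A. g a b c d"] c[of "\<lambda>a b. \<Sum>c\<in>A. \<Sum>d\<in>A. g c d a b"]
    unfolding c by (rule sum.swap)
qed

text \<open>By bilinearity this reduces to \<open>T_T\<close>, whose two Kronecker deltas contract
  the coefficients to the entries of AB and of BA.\<close>

lemma RM_bracket: "RM n (bracket n A B) = RM n A * RM n B - RM n B * RM n A"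
proof -
  have "RM n B * RM n A = (\<Sum>a\<in>ix n. \<Sum>b\<in>ix n. \<Sum>c\<in>ix n. \<Sum>d\<in>ix n. cop (A a b * B c d) * (T c d * T a b))"
    unfolding RM_mult by (subst sum4_swap) (simp only: mult.commute[of "B _ _"])
  then have "RM n A * RM n B - RM n B * RM n A
     = (\<Sum>a\<in>ix n. \<Sum>b\<in>ix n. \<Sum>c\<in>ix n. \<Sum>d\<in>ix n. cop (A a b * B c d) * (T a b * T c d - T c d * T a b))"
    unfolding RM_mult by (simp only: sum_subtractf right_diff_distrib)
  also have "\<dots> = (\<Sum>a\<in>ix n. \<Sum>b\<in>ix n. \<Sum>c\<in>ix n. \<Sum>d\<in>ix n. (if c = b then cop (A a b * B c d) * T a d else 0))
     - (\<Sum>a\<in>ix n. \<Sum>b\<in>ix n. \<Sum>c\<in>ix n. \<Sum>d\<in>ix n. (if d = a then cop (A a b * B c d) * T c b else 0))"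
  proof -
    have "T a b * T c d - T c d * T a b = (if b = c then T a d else 0) - (if a = d then T c b else 0)" for a b c d
      using T_T[of a b c d] by (simp add: algebra_simps)
    then show ?thesis
      unfolding sum_subtractf[symmetric] by (intro sum.cong refl) (auto simp: right_diff_distrib)
  qed
  also have "(\<Sum>a\<in>ix n. \<Sum>b\<in>ix n. \<Sum>c\<in>ix n. \<Sum>d\<in>ix n. (if c = b then cop (A a b * B c d) * T a d else 0))
     = (\<Sum>a\<in>ix n. \<Sum>d\<in>ix n. cop (mmul n A B a d) * T a d)"
  proof (rule sum.cong[OF refl])
    fix a assume "a \<in> ix n"
    have "(\<Sum>b\<in>ix n. \<Sum>c\<in>ix n. \<Sum>d\<in>ix n. (if c = b then cop (A a b * B c d) * T a d else 0))
      = (\<Sum>b\<in>ix n. \<Sum>d\<in>ix n. \<Sum>c\<in>ix n. (if c = b then cop (A a b * B c d) * T a d else 0))"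
      by (intro sum.cong refl sum.swap)
    also have "\<dots> = (\<Sum>b\<in>ix n. \<Sum>d\<in>ix n. cop (A a b * B b d) * T a d)" by simp
    also have "\<dots> = (\<Sum>d\<in>ix n. \<Sum>b\<in>ix n. cop (A a b * B b d) * T a d)" by (rule sum.swap)
    finally show "(\<Sum>b\<in>ix n. \<Sum>c\<in>ix n. \<Sum>d\<in>ix n. (if c = b then cop (A a b * B c d) * T a d else 0))
       = (\<Sum>d\<in>ix n. cop (mmul n A B a d) * T a d)"
      by (simp add: mmul_ix cop_sum sum_distrib_right)
  qed
  also have "(\<Sum>a\<in>ix n. \<Sum>b\<in>ix n. \<Sum>c\<in>ix n. \<Sum>d\<in>ix n. (if d = a then cop (A a b * B c d) * T c b else 0))
     = (\<Sum>c\<in>ix n. \<Sum>b\<in>ix n. cop (mmul n B A c b) * T c b)"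
  proof -
    have "(\<Sum>a\<in>ix n. \<Sum>b\<in>ix n. \<Sum>c\<in>ix n. \<Sum>d\<in>ix n. (if d = a then cop (A a b * B c d) * T c b else 0))
      = (\<Sum>a\<in>ix n. \<Sum>b\<in>ix n. \<Sum>c\<in>ix n. cop (A a b * B c a) * T c b)" by simp
    also have "\<dots> = (\<Sum>a\<in>ix n. \<Sum>c\<in>ix n. \<Sum>b\<in>ix n. cop (A a b * B c a) * T c b)"
      by (intro sum.cong refl sum.swap)
    also have "\<dots> = (\<Sum>c\<in>ix n. \<Sum>a\<in>ix n. \<Sum>b\<in>ix n. cop (A a b * B c a) * T c b)" by (rule sum.swap)
    also have "\<dots> = (\<Sum>c\<in>ix n. \<Sum>b\<in>ix n. \<Sum>a\<in>ix n. cop (A a b * B c a) * T c b)"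
      by (intro sum.cong refl sum.swap)
    finally show ?thesis by (simp add: mmul_ix cop_sum sum_distrib_right mult.commute[of "A _ _"])
  qed
  finally show ?thesis
    by (simp add: RM_def bracket_def cop_diff left_diff_distrib sum_subtractf)
qed

lemma RM_Fm:
  assumes "a \<in> ix n" "b \<in> ix n" shows "RM n (Fm n a b) = FF n a b"
proof -
  have s: "(\<Sum>i\<in>ix n. \<Sum>j\<in>ix n. cop (of_bool (i = c \<and> j = d)) * T i j) = T c d"
    if "c \<in> ix n" "d \<in> ix n" for c d
  proof -
    have "(\<Sum>j\<in>ix n. cop (of_bool (i = c \<and> j = d)) * T i j) = (if i = c then T i d else 0)" for i
    proof -
      have "(\<Sum>j\<in>ix n. cop (of_bool (i = c \<and> j = d)) * T i j) = (\<Sum>j\<in>ix n. if j = d then (if i = c then T i d else 0) else 0)"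
        by (intro sum.cong) auto
      then show ?thesis using that by simp
    qed
    then show ?thesis using that by simp
  qed
  show ?thesis
    using s[OF assms] s[OF pr_mem pr_mem, OF assms(2,1)]
    by (simp add: RM_def Fm_def cop_diff left_diff_distrib sum_subtractf FF_def)
qed

interpretation MM: so_module fscale n "rM n" for n
  by unfold_locales (simp_all only: rM_def RM_madd RM_msmult RM_bracket app_add app_scale app_simps app_cop)

lemma rM_Fm: "a \<in> ix n \<Longrightarrow> b \<in> ix n \<Longrightarrow> rM n (Fm n a b) f = app (FF n a b) f"
  by (simp only: rM_def RM_Fm)

lemma T_diag: "app (T a a) f (e, S) = (of_nat (e a) + of_bool (a \<in> S)) * f (e, S)"
  unfolding T_def app_simps(3) plus_fun_apply XD_app ThDt_app by (simp add: algebra_simps)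

text \<open>Monomials are weight vectors: the entries of H at i and i + n are opposite, so the
  contributions of the two indices combine to the difference in \<open>wtI\<close>.\<close>

lemma RM_diag:
  assumes "H \<in> cartan n"
  shows "rM n H f I = (\<Sum>i\<in>{1..n}. H i i * of_int (wtI n I i)) * f I"
proof -
  obtain e S where I: "I = (e, S)" by (cases I)
  have Hs: "H \<in> so n" "\<And>i j. i \<noteq> j \<Longrightarrow> H i j = 0" using assms by (auto simp: cartan_def)
  have "RM n H = (\<Sum>a\<in>ix n. \<Sum>b\<in>ix n. if b = a then cop (H a a) * T a a else 0)"
    unfolding RM_def using Hs(2) by (intro sum.cong refl) auto
  then have R: "RM n H = (\<Sum>a\<in>ix n. cop (H a a) * T a a)" by simp
  have "rM n H f (e, S) = (\<Sum>a\<in>ix n. H a a * (of_nat (e a) + of_bool (a \<in> S))) * f (e, S)"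
    unfolding rM_def R app_sum_op by (simp add: sum_fun_apply T_diag sum_distrib_right mult.assoc)
  also have "(\<Sum>a\<in>ix n. H a a * (of_nat (e a) + of_bool (a \<in> S))) = (\<Sum>i\<in>{1..n}. H i i * of_int (wtI n I i))"
  proof -
    let ?G = "\<lambda>a. H a a * (of_nat (e a) + of_bool (a \<in> S))"
    have "ix n = {1..n} \<union> (\<lambda>i. i + n) ` {1..n}" by (auto simp: ix_def image_iff)
    then have "sum ?G (ix n) = sum ?G {1..n} + sum ?G ((\<lambda>i. i + n) ` {1..n})"
      by (simp only:) (rule sum.union_disjoint, auto)
    also have "sum ?G ((\<lambda>i. i + n) ` {1..n}) = (\<Sum>i\<in>{1..n}. ?G (i + n))"
      by (subst sum.reindex) (auto simp del: image_add_atLeastAtMost' simp: o_def)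
    also have "sum ?G {1..n} + (\<Sum>i\<in>{1..n}. ?G (i + n)) = (\<Sum>i\<in>{1..n}. H i i * of_int (wtI n I i))"
      unfolding sum.distrib[symmetric]
    proof (intro sum.cong refl)
      fix i assume i: "i \<in> {1..n}"
      then have "i \<in> ix n" "pr n i = i + n" by (auto simp: ix_def pr_def)
      then have "H (i + n) (i + n) = - H i i" using so_neg[OF Hs(1), of i i] by simp
      then show "H i i * (of_nat (e i) + of_bool (i \<in> S)) + H (i + n) (i + n) * (of_nat (e (i + n)) + of_bool (i + n \<in> S))
         = H i i * of_int (wtI n I i)" using i by (simp add: wtI_def I algebra_simps)
    qed
    finally show ?thesis .
  qed
  finally show ?thesis unfolding I .
qed

section \<open>Weight components of submodules\<close>

text \<open>Extends a weight to all 2n indices with \<mu>(i+n) = -\<mu>(i); these are the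
  eigenvalues of the diagonal generators \<open>FF n a a\<close>.\<close>

definition mm :: "nat \<Rightarrow> (nat \<Rightarrow> int) \<Rightarrow> nat \<Rightarrow> int" where
  "mm n \<mu> a = (if a \<le> n then \<mu> a else - \<mu> (a - n))"

lemma FF_diag:
  assumes "a \<in> ix n" "f \<in> sp n p q \<mu>"
  shows "app (FF n a a) f = fscale (of_int (mm n \<mu> a)) f"
proof
  fix I :: idx
  obtain e S where I: "I = (e, S)" by (cases I)
  show "app (FF n a a) f I = fscale (of_int (mm n \<mu> a)) f I"
  proof (cases "f I = 0")
    case True
    then show ?thesis unfolding I FF_def app_simps fun_diff_def T_diag by simp
  next
    case False
    then have "wtI n I = \<mu>" using fsupD[OF assms(2)] by (auto simp: widx_def)
    then have "of_int (mm n \<mu> a) = (of_nat (e a) + of_bool (a \<in> S)) - (of_nat (e (pr n a)) + of_bool (pr n a \<in> S) :: complex)"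
      using assms(1) by (auto simp: mm_def wtI_def I ix_def pr_def)
    then show ?thesis unfolding I FF_def app_simps fun_diff_def T_diag fscale_apply by (simp only: left_diff_distrib)
  qed
qed

lemma FF_sp:
  assumes "a \<in> ix n" "b \<in> ix n" "f \<in> sp n p q \<mu>"
  shows "app (FF n a b) f \<in> sp n p q (\<mu> + bw n a - bw n b)"
  using T_sp[OF assms] T_sp[OF pr_mem pr_mem assms(3), OF assms(2,1)] assms(1,2)
  by (auto simp: FF_def bw_pr algebra_simps intro!: fsup_diff)

text \<open>The relation [e,f] = h of the sl(2) attached to a root. The condition on b removes the
  delta terms between a generator and a paired one.\<close>

lemma FF_comm:
  assumes "a \<in> ix n" "b \<in> ix n" "b \<noteq> pr n a"
  shows "FF n a b * FF n b a = FF n b a * FF n a b + FF n a a - FF n b b"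
proof -
  have ne: "a \<noteq> pr n b" using assms by auto
  have "FF n a b * FF n b a = T a b * T b a - T a b * T (pr n a) (pr n b) - T (pr n b) (pr n a) * T b a
     + T (pr n b) (pr n a) * T (pr n a) (pr n b)"
    by (simp add: FF_def algebra_simps)
  also have "T a b * T b a = T b a * T a b + T a a - T b b" by (simp add: T_T[of a b])
  also have "T a b * T (pr n a) (pr n b) = T (pr n a) (pr n b) * T a b"
    using assms(3) ne by (simp add: T_T[of a b])
  also have "T (pr n b) (pr n a) * T b a = T b a * T (pr n b) (pr n a)"
    using assms(3) ne by (simp add: T_T[of "pr n b" "pr n a"])
  also have "T (pr n b) (pr n a) * T (pr n a) (pr n b) = T (pr n a) (pr n b) * T (pr n b) (pr n a)
      + T (pr n b) (pr n b) - T (pr n a) (pr n a)"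
    by (simp add: T_T[of "pr n b" "pr n a"])
  finally show ?thesis by (simp add: FF_def algebra_simps)
qed

lemma FF_zero: "a \<in> ix n \<Longrightarrow> FF n a (pr n a) = 0"
  by (simp add: FF_def)

definition proj :: "nat \<Rightarrow> (nat \<Rightarrow> int) \<Rightarrow> form \<Rightarrow> form" where
  "proj n \<mu> f = (\<lambda>I. if wtI n I = \<mu> then f I else 0)"

lemma proj_sp: "f \<in> gr n p q \<Longrightarrow> proj n \<mu> f \<in> sp n p q \<mu>"
  by (auto simp: fsup_def proj_def widx_def)

lemma proj_sum:
  assumes "f \<in> gr n p q"
  shows "f = (\<Sum>\<mu>\<in>wtI n ` gidx n p q. proj n \<mu> f)"
proof
  fix I
  show "f I = (\<Sum>\<mu>\<in>wtI n ` gidx n p q. proj n \<mu> f) I"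
  proof (cases "f I = 0")
    case True
    then show ?thesis by (simp add: sum_fun_apply proj_def)
  next
    case False
    then have "I \<in> gidx n p q" using fsupD[OF assms] by blast
    then show ?thesis by (auto simp: sum_fun_apply proj_def)
  qed
qed

lemma gr_closed:
  assumes "\<And>\<mu> f. f \<in> sp n p q \<mu> \<Longrightarrow> app Q f \<in> gr n p' q'" "f \<in> gr n p q"
  shows "app Q f \<in> gr n p' q'"
proof -
  have "app Q f = (\<Sum>\<mu>\<in>wtI n ` gidx n p q. app Q (proj n \<mu> f))"
    unfolding app_sum[symmetric] proj_sum[OF assms(2), symmetric] ..
  then show ?thesis using assms(1) proj_sp[OF assms(2)] by (simp only:) (rule fsup_sum, blast)
qed

definition MG :: "nat \<Rightarrow> int \<Rightarrow> int \<Rightarrow> form set" where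
  "MG n k p = {f \<in> gr n k p. app (dE n) f = 0 \<and> app (del n) f = 0}"

lemma FF_dE: "a \<in> ix n \<Longrightarrow> b \<in> ix n \<Longrightarrow> FF n a b * dE n = dE n * FF n a b"
  by (simp add: FF_def T_dE left_diff_distrib right_diff_distrib)

lemma smod_MG: "MM.smod n (MG n k p)"
proof (rule MM.smodI)
  show "FS.subspace (MG n k p)"
    using subspace_fsup[of "gidx n k p"] by (auto simp: MG_def FS.subspace_def simp del: fscale_apply plus_fun_apply)
  fix a b f assume ab: "a \<in> ix n" "b \<in> ix n" and f: "f \<in> MG n k p"
  have "app (dE n) (app (FF n a b) f) = app (FF n a b) (app (dE n) f)"
    "app (del n) (app (FF n a b) f) = app (FF n a b) (app (del n) f)"
    by (simp_all only: app_simps(6)[symmetric] FF_dE[OF ab] F_del[OF ab, folded FF_def])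
  then have "app (dE n) (app (FF n a b) f) = 0" "app (del n) (app (FF n a b) f) = 0"
    using f by (simp_all add: MG_def)
  moreover have "app (FF n a b) f \<in> gr n k p"
    using f by (intro gr_closed[OF sp_gr[OF FF_sp[OF ab]]]) (auto simp: MG_def)
  ultimately show "rM n (Fm n a b) f \<in> MG n k p" using ab by (simp add: MG_def rM_Fm)
qed

text \<open>Lagrange interpolation: the product of g - d over the other values d of g on A, divided
  by its value at c, is the indicator of g = c on A.\<close>

lemma diag_proj:
  assumes W: "FS.subspace W" "\<And>f. f \<in> W \<Longrightarrow> (\<lambda>I. g I * f I) \<in> W"
    and f: "f \<in> W" "f \<in> fsup A" "finite A"
  shows "(\<lambda>I. if g I = c then f I else 0) \<in> W"
proof -
  have prod: "(\<lambda>I. (\<Prod>d\<in>C. g I - d) * f I) \<in> W" if "finite C" for C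
    using that
  proof (induction C rule: finite_induct)
    case empty
    then show ?case using f by simp
  next
    case (insert d C)
    have "(\<lambda>I. g I * ((\<Prod>d\<in>C. g I - d) * f I)) - fscale d (\<lambda>I. (\<Prod>d\<in>C. g I - d) * f I) \<in> W"
      using W(2)[OF insert.IH] FS.subspace_scale[OF W(1) insert.IH] FS.subspace_diff[OF W(1)] by blast
    also have "(\<lambda>I. g I * ((\<Prod>d\<in>C. g I - d) * f I)) - fscale d (\<lambda>I. (\<Prod>d\<in>C. g I - d) * f I)
      = (\<lambda>I. (\<Prod>d\<in>insert d C. g I - d) * f I)"
      using insert.hyps by (auto simp: fun_eq_iff algebra_simps)
    finally show ?case .
  qed
  define C where "C = g ` A - {c}"
  have C: "finite C" using f(3) by (simp add: C_def)
  define z where "z = (\<Prod>d\<in>C. c - d)"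
  have "z \<noteq> 0" using C by (simp add: z_def C_def)
  have "fscale (1 / z) (\<lambda>I. (\<Prod>d\<in>C. g I - d) * f I) \<in> W"
    using FS.subspace_scale[OF W(1) prod[OF C]] .
  also have "fscale (1 / z) (\<lambda>I. (\<Prod>d\<in>C. g I - d) * f I) = (\<lambda>I. if g I = c then f I else 0)"
  proof
    fix I
    show "fscale (1 / z) (\<lambda>I. (\<Prod>d\<in>C. g I - d) * f I) I = (if g I = c then f I else 0)"
    proof (cases "g I = c \<or> f I = 0")
      case True
      then show ?thesis using \<open>z \<noteq> 0\<close> by (auto simp: z_def)
    next
      case False
      then have "g I \<in> C" using fsupD[OF f(2)] by (auto simp: C_def)
      then have "(\<Prod>d\<in>C. g I - d) = 0" using C by (intro prod_zero) auto
      then show ?thesis using False by simp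
    qed
  qed
  finally show ?thesis .
qed

text \<open>The generator \<open>Fm n i i\<close> multiplies each coefficient by the i-th coordinate
  of its weight, so the coordinates can be prescribed one after the other by interpolation.\<close>

lemma smod_proj:
  assumes W: "MM.smod n W" and f: "f \<in> W" "f \<in> gr n p q" and \<mu>: "\<And>i. i \<notin> {1..n} \<Longrightarrow> \<mu> i = 0"
  shows "proj n \<mu> f \<in> W"
proof -
  have "(\<lambda>I. if \<forall>i\<in>{1..m}. wtI n I i = \<mu> i then f I else 0) \<in> W" if "m \<le> n" for m
    using that
  proof (induction m)
    case 0
    then show ?case using f by simp
  next
    case (Suc m)
    let ?f = "\<lambda>I. if \<forall>i\<in>{1..m}. wtI n I i = \<mu> i then f I else 0"
    let ?g = "\<lambda>I. of_int (wtI n I (Suc m)) :: complex"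
    have cl: "(\<lambda>I. ?g I * h I) \<in> W" if "h \<in> W" for h
    proof -
      have m: "Suc m \<in> ix n" using Suc.prems by (simp add: ix_def)
      have "rM n (Fm n (Suc m) (Suc m)) h I = ?g I * h I" for I
      proof -
        have "rM n (Fm n (Suc m) (Suc m)) h I = (\<Sum>i\<in>{1..n}. Fm n (Suc m) (Suc m) i i * of_int (wtI n I i)) * h I"
          using m by (intro RM_diag) simp
        also have "(\<Sum>i\<in>{1..n}. Fm n (Suc m) (Suc m) i i * of_int (wtI n I i))
           = (\<Sum>i\<in>{1..n}. if i = Suc m then of_int (wtI n I i) else 0)"
          using Suc.prems by (intro sum.cong refl) (auto simp: Fm_def pr_def)
        also have "\<dots> = ?g I" using Suc.prems by simp
        finally show ?thesis .
      qed
      then have "rM n (Fm n (Suc m) (Suc m)) h = (\<lambda>I. ?g I * h I)" by (rule ext)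
      then show ?thesis using MM.smodD(2)[OF W Fm_so[OF m m] that] by simp
    qed
    have "(\<lambda>I. if ?g I = of_int (\<mu> (Suc m)) then ?f I else 0) \<in> W"
      using Suc f(2) by (intro diag_proj[OF MM.smodD(1)[OF W] cl, of ?f "gidx n p q"]) (auto simp: fsup_def)
    also have "(\<lambda>I. if ?g I = of_int (\<mu> (Suc m)) then ?f I else 0)
       = (\<lambda>I. if \<forall>i\<in>{1..Suc m}. wtI n I i = \<mu> i then f I else 0)"
      by (auto simp: fun_eq_iff atLeastAtMostSuc_conv)
    finally show ?case .
  qed
  from this[OF order_refl] show ?thesis
  proof (rule back_subst[of "\<lambda>g. g \<in> W"])
    have "(\<forall>i\<in>{1..n}. wtI n I i = \<mu> i) \<longleftrightarrow> wtI n I = \<mu>" for I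
    proof
      assume a: "\<forall>i\<in>{1..n}. wtI n I i = \<mu> i"
      show "wtI n I = \<mu>"
      proof
        fix i show "wtI n I i = \<mu> i"
          using a \<mu>[of i] by (cases "i \<in> {1..n}") (blast, simp add: wtI_def)
      qed
    qed simp
    then show "(\<lambda>I. if \<forall>i\<in>{1..n}. wtI n I i = \<mu> i then f I else 0) = proj n \<mu> f"
      by (simp add: proj_def)
  qed
qed

section \<open>Maximal vectors modulo a submodule\<close>

text \<open>The pairing of a weight with half the sum of the positive roots, which has coordinates
  n-1, n-2, ..., 0.\<close>

definition hgt :: "nat \<Rightarrow> (nat \<Rightarrow> int) \<Rightarrow> int" where
  "hgt n \<mu> = (\<Sum>i=1..n. (int n - int i) * \<mu> i)"

lemma hgt_bw: "a \<in> ix n \<Longrightarrow> hgt n (bw n a) = ht n a"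
proof -
  assume a: "a \<in> ix n"
  have "hgt n (bw n a) = (\<Sum>i=1..n. if i = (if a \<le> n then a else a - n) then ht n a else 0)"
    unfolding hgt_def using a by (intro sum.cong refl) (auto simp: bw_def ht_def ix_def)
  then show ?thesis using a by (auto simp: ix_def)
qed

lemma hgt_shift: "hgt n (\<mu> + \<nu> - \<tau>) = hgt n \<mu> + hgt n \<nu> - hgt n \<tau>"
  by (simp add: hgt_def algebra_simps sum.distrib sum_subtractf)

lemma max_vec:
  assumes U: "MM.smod n U" and W: "MM.smod n W" "W \<subseteq> MG n k p" "\<not> W \<subseteq> U"
  obtains \<mu> w where "w \<in> W" "w \<notin> U" "w \<in> sp n k p \<mu>"
    "\<And>a b. a \<in> ix n \<Longrightarrow> b \<in> ix n \<Longrightarrow> ht n b < ht n a \<Longrightarrow> app (FF n a b) w \<in> U"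
proof -
  let ?S = "{\<mu> \<in> wtI n ` gidx n k p. \<exists>w\<in>W - U. w \<in> sp n k p \<mu>}"
  have U0: "0 \<in> U" using FS.subspace_0[OF MM.smodD(1)[OF U]] .
  obtain f where f: "f \<in> W" "f \<notin> U" using W(3) by auto
  have fg: "f \<in> gr n k p" using f(1) W(2) by (auto simp: MG_def)
  have pW: "proj n \<mu> f \<in> W" if "\<mu> \<in> wtI n ` gidx n k p" for \<mu>
    using that by (intro smod_proj[OF W(1) f(1) fg]) (auto simp: wtI_def)
  have "\<exists>\<mu>\<in>wtI n ` gidx n k p. proj n \<mu> f \<notin> U"
  proof (rule ccontr)
    assume "\<not> ?thesis"
    then have "(\<Sum>\<mu>\<in>wtI n ` gidx n k p. proj n \<mu> f) \<in> U"
      by (intro FS.subspace_sum[OF MM.smodD(1)[OF U]]) auto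
    then show False using f(2) proj_sum[OF fg] by simp
  qed
  then have ne: "?S \<noteq> {}" using pW proj_sp[OF fg] by blast
  have fin: "finite ?S" by simp
  have "Max (hgt n ` ?S) \<in> hgt n ` ?S" using ne fin by (intro Max_in) auto
  then obtain \<mu> where \<mu>: "Max (hgt n ` ?S) = hgt n \<mu>" "\<mu> \<in> ?S" by (rule imageE)
  then obtain w where w: "w \<in> W" "w \<notin> U" "w \<in> sp n k p \<mu>" by blast
  have "app (FF n a b) w \<in> U" if ab: "a \<in> ix n" "b \<in> ix n" "ht n b < ht n a" for a b
  proof (rule ccontr)
    let ?e = "app (FF n a b) w" and ?\<nu> = "\<mu> + bw n a - bw n b"
    assume nU: "?e \<notin> U"
    have eW: "?e \<in> W" using MM.smodD(2)[OF W(1) Fm_so[OF ab(1,2)] w(1)] rM_Fm[OF ab(1,2)] by simp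
    have es: "?e \<in> sp n k p ?\<nu>" using FF_sp[OF ab(1,2) w(3)] .
    \<comment> \<open>A nonzero vector exhibits a monomial of weight \<open>?\<nu>\<close>, so this
      weight belongs to the finite set over which the maximum was taken.\<close>
    have "?e \<noteq> 0" using nU U0 by auto
    then obtain I where "?e I \<noteq> 0" by (auto simp: fun_eq_iff)
    then have "I \<in> widx n k p ?\<nu>" using fsupD[OF es] by blast
    then have "I \<in> gidx n k p" "wtI n I = ?\<nu>" by (auto simp: widx_def)
    then have "?\<nu> \<in> wtI n ` gidx n k p" by (metis imageI)
    then have "?\<nu> \<in> ?S" using eW nU es by blast
    then have "hgt n ?\<nu> \<le> hgt n \<mu>" unfolding \<mu>(1)[symmetric] using fin by (intro Max_ge) auto
    then show False using ab by (simp add: hgt_shift hgt_bw)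
  qed
  then show ?thesis using that w by blast
qed

lemma casimir_MG:
  assumes "f \<in> MG n k p"
  shows "(\<Sum>a\<in>ix n. \<Sum>b\<in>ix n. app (FF n a b) (app (FF n b a) f))
     = fscale (of_int (2 * (k * k + 2 * int n * (k + p) - p * p))) f"
proof -
  have g: "f \<in> gr n k p" and d: "app (dE n) f = 0" "app (del n) f = 0" using assms by (auto simp: MG_def)
  have l: "app (lap n) f = 0" unfolding dE_del[symmetric] app_simps d by simp
  have "(\<Sum>a\<in>ix n. \<Sum>b\<in>ix n. app (FF n a b) (app (FF n b a) f)) = app (\<Sum>a\<in>ix n. \<Sum>b\<in>ix n. FF n a b * FF n b a) f"
    by (simp only: app_sum_op app_simps)
  also have "\<dots> = fscale (of_int (2 * (k * k + 2 * int n * (k + p) - p * p))) f"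
    unfolding casimir mult_2 app_simps d l app_0 app_of_nat eu_gr[OF g] qn_gr[OF g] app_scale
    by (rule ext) (simp add: algebra_simps)
  finally show ?thesis .
qed

text \<open>The scalar by which \<open>FF n a b * FF n b a\<close> acts on a highest weight vector
  of weight \<mu>: if \<open>FF n a b\<close> raises, only the commutator survives; if it is
  diagonal, the square of an eigenvalue; if it lowers, the right factor already gives 0.\<close>

definition tfun :: "nat \<Rightarrow> (nat \<Rightarrow> int) \<Rightarrow> nat \<Rightarrow> nat \<Rightarrow> int" where
  "tfun n \<mu> a b = (if ht n b < ht n a \<and> b \<noteq> pr n a then mm n \<mu> a - mm n \<mu> b
     else if a = b then mm n \<mu> a * mm n \<mu> a else 0)"

text \<open>Modulo U the vector w is a highest weight vector, so the Casimir operator multiplies it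
  by the sum of \<open>tfun\<close>. If this differed from the eigenvalue on M(k,p), a nonzero
  multiple of w would lie in U.\<close>

lemma casimir_top:
  assumes U: "MM.smod n U" and w: "w \<in> MG n k p" "w \<notin> U" "w \<in> sp n k p \<mu>"
    and e: "\<And>a b. a \<in> ix n \<Longrightarrow> b \<in> ix n \<Longrightarrow> ht n b < ht n a \<Longrightarrow> app (FF n a b) w \<in> U"
  shows "(\<Sum>a\<in>ix n. \<Sum>b\<in>ix n. tfun n \<mu> a b) = 2 * (k * k + 2 * int n * (k + p) - p * p)" (is "?t = ?c")
proof (rule ccontr)
  assume ne: "?t \<noteq> ?c"
  note sU = MM.smodD(1)[OF U]
  have FU: "app (FF n a b) u \<in> U" if "a \<in> ix n" "b \<in> ix n" "u \<in> U" for a b u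
    using MM.smodD(2)[OF U Fm_so[OF that(1,2)] that(3)] rM_Fm[OF that(1,2)] by simp
  have trm: "app (FF n a b) (app (FF n b a) w) - fscale (of_int (tfun n \<mu> a b)) w \<in> U"
    if ab: "a \<in> ix n" "b \<in> ix n" for a b
  proof -
    consider "b = pr n a" "a \<noteq> b" | "a = b" | "b \<noteq> pr n a" "ht n a < ht n b" | "b \<noteq> pr n a" "ht n b < ht n a"
      using ht_eq[OF ab] by fastforce
    then show ?thesis
    proof cases
      case 1
      then have "FF n a b = 0" "tfun n \<mu> a b = 0" using FF_zero ab by (auto simp: tfun_def)
      moreover have "fscale 0 w = 0" by (simp add: fun_eq_iff)
      ultimately show ?thesis using FS.subspace_0[OF sU] by simp
    next
      case 2
      then have "app (FF n a b) (app (FF n b a) w) = fscale (of_int (tfun n \<mu> a b)) w"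
        using FF_diag[OF ab(1) w(3)] by (simp add: tfun_def)
      then show ?thesis using FS.subspace_0[OF sU] by simp
    next
      case 3
      then have "tfun n \<mu> a b = 0" by (auto simp: tfun_def)
      moreover have "app (FF n a b) (app (FF n b a) w) \<in> U" using FU ab e[OF ab(2,1)] 3 by blast
      moreover have "fscale 0 w = 0" by (simp add: fun_eq_iff)
      ultimately show ?thesis by simp
    next
      case 4
      have "app (FF n a b) (app (FF n b a) w) = app (FF n b a * FF n a b + FF n a a - FF n b b) w"
        unfolding FF_comm[OF ab 4(1), symmetric] by simp
      also have "\<dots> = app (FF n b a) (app (FF n a b) w) + fscale (of_int (tfun n \<mu> a b)) w"
        using 4 by (simp add: FF_diag[OF ab(1) w(3)] FF_diag[OF ab(2) w(3)] tfun_def fun_eq_iff algebra_simps)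
      finally show ?thesis using FU[OF ab(2,1) e[OF ab 4(2)]] by simp
    qed
  qed
  have "(\<Sum>a\<in>ix n. \<Sum>b\<in>ix n. app (FF n a b) (app (FF n b a) w) - fscale (of_int (tfun n \<mu> a b)) w) \<in> U"
    using trm by (intro FS.subspace_sum[OF sU])
  also have "(\<Sum>a\<in>ix n. \<Sum>b\<in>ix n. app (FF n a b) (app (FF n b a) w) - fscale (of_int (tfun n \<mu> a b)) w)
     = fscale (of_int ?c) w - fscale (of_int ?t) w"
    unfolding sum_subtractf casimir_MG[OF w(1)] of_int_sum FS.scale_sum_left ..
  also have "\<dots> = fscale (of_int (?c - ?t)) w"
    unfolding of_int_diff FS.scale_left_diff_distrib ..
  finally have "fscale (1 / of_int (?c - ?t)) (fscale (of_int (?c - ?t)) w) \<in> U"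
    using FS.subspace_scale[OF sU] by blast
  then show False using w(2) ne unfolding fscale_fscale by (simp del: of_int_diff of_int_sum)
qed

text \<open>The usual sl(2) argument modulo U. With s = \<mu>(i) - \<open>mm n \<mu> b\<close> and
  fm(m) the m-fold lowering of w, the raising operator sends fm(m+1) to (m+1)(s-m) fm(m) modulo U.
  For s < 0 no factor vanishes, so no fm(m) lies in U, although only finitely many weights
  occur.\<close>

lemma sl2_dominant:
  assumes U: "MM.smod n U" and w: "w \<notin> U" "w \<in> sp n k p \<mu>"
    and i: "i \<in> {1..n}" "b \<in> ix n" "b \<noteq> i" "b \<noteq> pr n i"
    and e: "app (FF n i b) w \<in> U"
  shows "mm n \<mu> b \<le> \<mu> i"
proof (rule ccontr)
  assume neg: "\<not> mm n \<mu> b \<le> \<mu> i"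
  note sU = MM.smodD(1)[OF U]
  have ii: "i \<in> ix n" "mm n \<nu> i = \<nu> i" for \<nu> using i(1) by (auto simp: ix_def mm_def)
  have FU: "app (FF n a b) u \<in> U" if "a \<in> ix n" "b \<in> ix n" "u \<in> U" for a b u
    using MM.smodD(2)[OF U Fm_so[OF that(1,2)] that(3)] rM_Fm[OF that(1,2)] by simp
  define fm where "fm = (\<lambda>m. (app (FF n b i) ^^ m) w)"
  define wm where "wm = (\<lambda>m::nat. (\<lambda>j. \<mu> j + int m * (bw n b j - bw n i j)))"
  have fms: "fm m \<in> sp n k p (wm m)" for m
  proof (induction m)
    case 0
    have "wm 0 = \<mu>" by (simp add: wm_def)
    then show ?case using w(2) by (simp add: fm_def)
  next
    case (Suc m)
    have "wm (Suc m) = wm m + bw n b - bw n i" by (simp add: wm_def fun_eq_iff algebra_simps)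
    then show ?case using FF_sp[OF i(2) ii(1) Suc] by (simp only: fm_def funpow.simps o_apply)
  qed
  define s where "s = \<mu> i - mm n \<mu> b"
  have wmi: "wm m i = \<mu> i - int m" "mm n (wm m) b = mm n \<mu> b + int m" for m
    using i by (auto simp: wm_def bw_def mm_def ix_def pr_def)
  have rel: "app (FF n i b) (fm (Suc m)) - fscale (of_int ((int m + 1) * (s - int m))) (fm m) \<in> U" for m
  proof (induction m)
    case 0
    have "app (FF n i b) (fm (Suc 0)) = app (FF n i b * FF n b i) w" by (simp add: fm_def)
    also have "\<dots> = app (FF n b i) (app (FF n i b) w) + fscale (of_int s) w"
      unfolding FF_comm[OF ii(1) i(2,4)] app_simps FF_diag[OF ii(1) w(2)] FF_diag[OF i(2) w(2)] ii
      by (simp add: s_def fun_eq_iff algebra_simps)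
    finally show ?case using FU[OF i(2) ii(1) e] by (simp add: fm_def)
  next
    case (Suc m)
    have st: "fm (Suc l) = app (FF n b i) (fm l)" for l by (simp add: fm_def)
    have "app (FF n i b) (fm (Suc (Suc m))) = app (FF n i b * FF n b i) (fm (Suc m))" by (simp add: st)
    also have "\<dots> = app (FF n b i) (app (FF n i b) (fm (Suc m))) + fscale (of_int (s - 2 * int (Suc m))) (fm (Suc m))"
      unfolding FF_comm[OF ii(1) i(2,4)] app_simps FF_diag[OF ii(1) fms] FF_diag[OF i(2) fms] ii wmi
      by (simp add: s_def fun_eq_iff algebra_simps)
    finally have "app (FF n i b) (fm (Suc (Suc m))) - fscale (of_int ((int (Suc m) + 1) * (s - int (Suc m)))) (fm (Suc m))
       = app (FF n b i) (app (FF n i b) (fm (Suc m)) - fscale (of_int ((int m + 1) * (s - int m))) (fm m))"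
      unfolding app_diff app_scale st[symmetric] by (simp add: fun_eq_iff algebra_simps)
    then show ?case using FU[OF i(2) ii(1) Suc] by (simp only:)
  qed
  have nU: "fm m \<notin> U" for m
  proof (induction m)
    case 0
    then show ?case using w by (simp add: fm_def)
  next
    case (Suc m)
    show ?case
    proof
      assume "fm (Suc m) \<in> U"
      then have "app (FF n i b) (fm (Suc m)) - (app (FF n i b) (fm (Suc m)) - fscale (of_int ((int m + 1) * (s - int m))) (fm m)) \<in> U"
        using FU[OF ii(1) i(2)] rel FS.subspace_diff[OF sU] by blast
      then have *: "fscale (of_int ((int m + 1) * (s - int m))) (fm m) \<in> U" by (simp only: diff_diff_eq2 add_diff_cancel_left')
      have z: "of_int ((int m + 1) * (s - int m)) \<noteq> (0::complex)" using neg by (simp only: of_int_eq_0_iff) (simp add: s_def)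
      have "fscale (1 / of_int ((int m + 1) * (s - int m))) (fscale (of_int ((int m + 1) * (s - int m))) (fm m)) \<in> U"
        using FS.subspace_scale[OF sU *] .
      then have "fm m \<in> U" using z unfolding fscale_fscale by (simp del: of_int_mult of_int_diff)
      then show False using Suc by blast
    qed
  qed
  \<comment> \<open>With this m the i-th coordinate of the weight of \<open>fm m\<close> is below
    -(k + p), the least value that the bidegree allows.\<close>
  define m where "m = nat (\<mu> i + k + p + 1)"
  have "fm m \<noteq> 0" using nU[of m] FS.subspace_0[OF sU] by auto
  then obtain I where "fm m I \<noteq> 0" by (auto simp: fun_eq_iff)
  then have I: "I \<in> widx n k p (wm m)" using fsupD[OF fms] by blast
  then have "wtI n I i = \<mu> i - int m" using wmi(1) by (auto simp: widx_def)
  moreover have "- (k + p) \<le> wtI n I i"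
  proof -
    have "fst I (i + n) \<le> (\<Sum>j\<in>ix n. fst I j)" using i(1) by (intro member_le_sum) (auto simp: ix_def)
    then have "int (fst I (i + n)) \<le> k" using I unfolding widx_def gidx_def by (simp del: of_nat_sum)
    moreover have "of_bool (i + n \<in> snd I) \<le> int (card (snd I))"
      using I finite_subset[OF _ finite_ix] by (auto simp: widx_def gidx_def Suc_le_eq card_gt_0_iff)
    then have "of_bool (i + n \<in> snd I) \<le> p" using I by (auto simp: widx_def gidx_def)
    ultimately show ?thesis using i(1) by (auto simp: wtI_def split: if_splits)
  qed
  moreover have "int m \<ge> \<mu> i + k + p + 1" by (simp add: m_def)
  ultimately show False by linarith
qed

lemma sum_ix: "(\<Sum>a\<in>ix n. g a) = (\<Sum>i=1..n. g i + g (i + n))" for g :: "nat \<Rightarrow> 'c::comm_monoid_add"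
proof -
  have "ix n = {1..n} \<union> (\<lambda>i. i + n) ` {1..n}" by (auto simp: ix_def image_iff)
  then have "sum g (ix n) = sum g {1..n} + sum g ((\<lambda>i. i + n) ` {1..n})"
    by (simp only:) (rule sum.union_disjoint, auto)
  moreover have "sum g ((\<lambda>i. i + n) ` {1..n}) = (\<Sum>i=1..n. g (i + n))"
    by (subst sum.reindex) (auto simp del: image_add_atLeastAtMost' simp: o_def)
  ultimately show ?thesis by (simp add: sum.distrib)
qed

text \<open>Twice the classical value (\<mu>, \<mu> + 2\<rho>), with \<rho> half the sum of the
  positive roots. For i < j the positive roots \<epsilon>_i - \<epsilon>_j and \<epsilon>_i +
  \<epsilon>_j together contribute 2\<mu>_i, and each is met twice among the four blocks of
  indices.\<close>

lemma tfun_sum: "(\<Sum>a\<in>ix n. \<Sum>b\<in>ix n. tfun n \<mu> a b) = 2 * (\<Sum>i=1..n. \<mu> i * (\<mu> i + 2 * (int n - int i)))"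
proof -
  let ?S = "\<lambda>f. \<Sum>i=1..n. \<Sum>j=1..n. (f i j :: int)"
  have "(\<Sum>a\<in>ix n. \<Sum>b\<in>ix n. tfun n \<mu> a b) = ?S (\<lambda>i j. tfun n \<mu> i j + tfun n \<mu> i (j + n) + (tfun n \<mu> (i + n) j + tfun n \<mu> (i + n) (j + n)))"
    by (simp add: sum_ix sum.distrib)
  also have "\<dots> = ?S (\<lambda>i j. (if i < j then 2 * \<mu> i else 0) + (if j < i then 2 * \<mu> j else 0) + (if i = j then 2 * (\<mu> i * \<mu> i) else 0))"
    by (intro sum.cong refl) (auto simp: tfun_def ht_def pr_def mm_def)
  also have "\<dots> = ?S (\<lambda>i j. if i < j then 2 * \<mu> i else 0) + ?S (\<lambda>i j. if j < i then 2 * \<mu> j else 0)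
       + ?S (\<lambda>i j. if i = j then 2 * (\<mu> i * \<mu> i) else 0)"
    by (simp only: sum.distrib)
  also have "?S (\<lambda>i j. if j < i then 2 * \<mu> j else 0) = ?S (\<lambda>i j. if i < j then 2 * \<mu> i else 0)"
    by (rule sum.swap)
  also have "?S (\<lambda>i j. if i = j then 2 * (\<mu> i * \<mu> i) else 0) = (\<Sum>i=1..n. 2 * (\<mu> i * \<mu> i))"
    by (intro sum.cong refl) simp
  also have "?S (\<lambda>i j. if i < j then 2 * \<mu> i else 0) = (\<Sum>i=1..n. (int n - int i) * (2 * \<mu> i))"
  proof (rule sum.cong[OF refl])
    fix i assume i: "i \<in> {1..n}"
    have "{1..n} \<inter> {j. i < j} = {i<..n}" using i by auto
    then show "(\<Sum>j=1..n. if i < j then 2 * \<mu> i else 0) = (int n - int i) * (2 * \<mu> i)"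
      using i by (simp add: sum.If_cases of_nat_diff)
  qed
  finally show ?thesis
    by (simp add: sum_distrib_left algebra_simps flip: sum.distrib)
qed

section \<open>Rigidity: only the top monomials attain the Casimir value\<close>

lemma abel_sum:
  fixes d c :: "nat \<Rightarrow> int"
  shows "(\<Sum>i=1..Suc m. d i * c i)
    = (\<Sum>i=1..m. (\<Sum>l=1..i. d l) * (c i - c (Suc i))) + (\<Sum>l=1..Suc m. d l) * c (Suc m)"
  by (induction m) (simp_all add: algebra_simps)

text \<open>The highest weight in coordinates: k\<omega>_1 + \<omega>_p for p \<le> n-2, k\<omega>_1
  + \<omega>_(n-1) + \<omega>_n for p = n-1, and k\<omega>_1 + 2\<omega>_n for p = n.\<close>

definition lamv :: "nat \<Rightarrow> nat \<Rightarrow> nat \<Rightarrow> int" where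
  "lamv k p i = (if i = 1 then int k + 1 else if 2 \<le> i \<and> i \<le> p then 1 else 0)"

text \<open>The monomial x_1^k dx_1 ... dx_p.\<close>

definition Iplus :: "nat \<Rightarrow> nat \<Rightarrow> idx" where
  "Iplus k p = ((\<lambda>i. if i = 1 then k else 0), {1..p})"

text \<open>Replacing dx_n by dx_(2n) changes the last weight coordinate from 1 to -1, which gives
  the weight k\<omega>_1 + 2\<omega>_(n-1).\<close>

definition Iminus :: "nat \<Rightarrow> nat \<Rightarrow> idx" where
  "Iminus k n = ((\<lambda>i. if i = 1 then k else 0), insert (2 * n) {1..n - 1})"

lemma lamv_partial: "1 \<le> p \<Longrightarrow> 1 \<le> j \<Longrightarrow> (\<Sum>i=1..j. lamv k p i) = int k + int (min j p)"
proof (induction j)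
  case (Suc j)
  then show ?case by (cases "j = 0") (auto simp: lamv_def min_def)
qed simp

lemma lamv_casimir:
  assumes "1 \<le> p" "p \<le> n"
  shows "(\<Sum>i=1..n. lamv k p i * (lamv k p i + 2 * (int n - int i)))
     = int k * int k + 2 * int n * (int k + int p) - int p * int p"
proof -
  have s: "(\<Sum>i=Suc 1..p. 1 + 2 * (int n - int i)) = 2 * int n * int p - int p * int p - 2 * int n + 1"
    using assms(1) by (induction p rule: dec_induct) (simp_all add: algebra_simps)
  have "(\<Sum>i=1..n. lamv k p i * (lamv k p i + 2 * (int n - int i)))
      = (\<Sum>i=1..p. lamv k p i * (lamv k p i + 2 * (int n - int i)))"
    using assms by (intro sum.mono_neutral_right) (auto simp: lamv_def)
  also have "\<dots> = (int k + 1) * (int k + 1 + 2 * (int n - 1))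
      + (\<Sum>i=Suc 1..p. lamv k p i * (lamv k p i + 2 * (int n - int i)))"
    using assms by (subst sum.atLeast_Suc_atMost) (auto simp: lamv_def)
  also have "(\<Sum>i=Suc 1..p. lamv k p i * (lamv k p i + 2 * (int n - int i))) = (\<Sum>i=Suc 1..p. 1 + 2 * (int n - int i))"
    by (intro sum.cong refl) (auto simp: lamv_def)
  finally show ?thesis unfolding s by (simp add: algebra_simps)
qed

text \<open>The exponents contribute at most k altogether. The differentials contribute at most 1 at
  each position, since dx_i and dx_(i+n) cancel, and at most p in total.\<close>

lemma wt_partial_bound:
  assumes I: "I \<in> gidx n (int k) (int p)" and j: "j \<le> n"
  shows "(\<Sum>i=1..j. \<bar>wtI n I i\<bar>) \<le> int k + int (min j p)"
proof -
  let ?e = "fst I" and ?S = "snd I"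
  have "(\<Sum>i=1..j. \<bar>wtI n I i\<bar>)
     \<le> (\<Sum>i=1..j. int (?e i) + int (?e (i + n)) + (of_bool (i \<in> ?S \<or> i + n \<in> ?S)))"
    using j by (intro sum_mono) (auto simp: wtI_def)
  also have "\<dots> = (\<Sum>i=1..j. int (?e i) + int (?e (i + n))) + (\<Sum>i=1..j. of_bool (i \<in> ?S \<or> i + n \<in> ?S))"
    by (rule sum.distrib)
  also have "(\<Sum>i=1..j. int (?e i) + int (?e (i + n))) \<le> (\<Sum>i=1..n. int (?e i) + int (?e (i + n)))"
    using j by (intro sum_mono2) auto
  also have "\<dots> = (\<Sum>a\<in>ix n. int (?e a))" by (rule sum_ix[symmetric])
  also have "\<dots> = int k" using I by (simp add: gidx_def)
  finally have 1: "(\<Sum>i=1..j. \<bar>wtI n I i\<bar>) \<le> int k + (\<Sum>i=1..j. of_bool (i \<in> ?S \<or> i + n \<in> ?S))" by simp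
  have "(\<Sum>i=1..j. of_bool (i \<in> ?S \<or> i + n \<in> ?S)) \<le> (\<Sum>i=1..j. 1 :: int)" by (intro sum_mono) auto
  moreover have "(\<Sum>i=1..j. of_bool (i \<in> ?S \<or> i + n \<in> ?S)) \<le> int p"
  proof -
    have "(\<Sum>i=1..j. of_bool (i \<in> ?S \<or> i + n \<in> ?S)) \<le> (\<Sum>i=1..n. of_bool (i \<in> ?S \<or> i + n \<in> ?S) :: int)"
      using j by (intro sum_mono2) auto
    also have "\<dots> \<le> (\<Sum>i=1..n. of_bool (i \<in> ?S) + of_bool (i + n \<in> ?S))" by (intro sum_mono) auto
    also have "\<dots> = (\<Sum>a\<in>ix n. of_bool (a \<in> ?S))" by (rule sum_ix[symmetric])
    also have "\<dots> = int p" using I by (simp add: gidx_def of_bool_def sum.If_cases Int_absorb1)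
    finally show ?thesis .
  qed
  ultimately show ?thesis using 1 by (auto simp: min_def)
qed

text \<open>Let \<nu> be the absolute value of the weight and D_j the partial sums of
  \<open>lamv k p\<close> - \<nu>. Equality of Casimir values reads: the sum of
  \<open>d i * c i\<close> is 0. Abel summation makes this a combination of the D_j with
  non-negative coefficients, at least 2 for j < n. As D_j \<ge> 0 by
  \<open>wt_partial_bound\<close>, all terms vanish and \<nu> is the top weight, which then leaves
  no freedom for the monomial.\<close>

lemma rigid:
  assumes n: "2 \<le> n" "1 \<le> p" "p \<le> n" and I: "I \<in> gidx n (int k) (int p)"
    and dom: "\<And>i j. 1 \<le> i \<Longrightarrow> i < j \<Longrightarrow> j \<le> n \<Longrightarrow> wtI n I j \<le> wtI n I i \<and> - wtI n I j \<le> wtI n I i"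
    and Q: "(\<Sum>i=1..n. wtI n I i * (wtI n I i + 2 * (int n - int i))) = int k * int k + 2 * int n * (int k + int p) - int p * int p"
  shows "I = Iplus k p \<or> (p = n \<and> I = Iminus k n)"
proof -
  define \<mu> where "\<mu> = wtI n I"
  define \<nu> where "\<nu> = (\<lambda>i. \<bar>\<mu> i\<bar>)"
  let ?L = "lamv k p"
  have pos: "\<mu> i \<ge> 0" if "1 \<le> i" "i < n" for i using dom[of i n] that by (auto simp: \<mu>_def)
  have \<nu>: "\<nu> i = \<mu> i" if "1 \<le> i" "i < n" for i using pos[OF that] by (simp add: \<nu>_def)
  have mono: "\<nu> (Suc i) \<le> \<nu> i" if "1 \<le> i" "i < n" for i
    using dom[of i "Suc i"] that pos[OF that] by (auto simp: \<nu>_def \<mu>_def)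
  have Lmono: "?L (Suc i) \<le> ?L i" if "1 \<le> i" for i using that by (auto simp: lamv_def)
  have L0: "?L i \<ge> 0" for i by (simp add: lamv_def)
  obtain m where m: "n = Suc m" using n(1) by (cases n) auto
  define c where "c = (\<lambda>i. ?L i + \<nu> i + 2 * (int n - int i))"
  define d where "d = (\<lambda>i. ?L i - \<nu> i)"
  define Dp where "Dp = (\<lambda>j. \<Sum>l=1..j. d l)"
  \<comment> \<open>By dominance only the last coordinate can be negative, and there the linear term
    has coefficient 0.\<close>
  have "(\<Sum>i=1..n. \<mu> i * (\<mu> i + 2 * (int n - int i))) = (\<Sum>i=1..n. \<nu> i * (\<nu> i + 2 * (int n - int i)))"
  proof (rule sum.cong[OF refl])
    fix i assume "i \<in> {1..n}"
    then show "\<mu> i * (\<mu> i + 2 * (int n - int i)) = \<nu> i * (\<nu> i + 2 * (int n - int i))"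
      using \<nu>[of i] by (cases "i = n") (auto simp: \<nu>_def)
  qed
  then have "(\<Sum>i=1..n. ?L i * (?L i + 2 * (int n - int i))) = (\<Sum>i=1..n. \<nu> i * (\<nu> i + 2 * (int n - int i)))"
    using Q lamv_casimir[OF n(2,3), of k] by (simp add: \<mu>_def)
  then have "(\<Sum>i=1..n. d i * c i) = 0"
    by (simp add: d_def c_def algebra_simps sum_subtractf sum.distrib)
  then have ab: "(\<Sum>i=1..m. Dp i * (c i - c (Suc i))) + Dp n * c n = 0"
    unfolding m abel_sum Dp_def by simp
  have D0: "Dp j \<ge> 0" if "1 \<le> j" "j \<le> n" for j
    using wt_partial_bound[OF I that(2)] lamv_partial[OF n(2) that(1), of k]
    by (simp add: Dp_def d_def sum_subtractf \<nu>_def \<mu>_def)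
  have cc: "c i - c (Suc i) \<ge> 2" if "1 \<le> i" "i \<le> m" for i
    using mono[of i] Lmono[of i] that m by (simp add: c_def)
  have cn: "c n \<ge> 0" using L0[of n] by (simp add: c_def \<nu>_def)
  have t0: "Dp i * (c i - c (Suc i)) \<ge> 0" if "i \<in> {1..m}" for i
    using D0[of i] cc[of i] that m by (intro mult_nonneg_nonneg) auto
  have n0: "Dp n * c n \<ge> 0" using D0[of n] cn n by auto
  have s0: "(\<Sum>i=1..m. Dp i * (c i - c (Suc i))) = 0" and Dn: "Dp n * c n = 0"
  proof -
    have "(\<Sum>i=1..m. Dp i * (c i - c (Suc i))) \<ge> 0" using t0 by (rule sum_nonneg)
    then show "(\<Sum>i=1..m. Dp i * (c i - c (Suc i))) = 0" "Dp n * c n = 0"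
      using ab n0 by linarith+
  qed
  have Di: "Dp i = 0" if "i \<le> m" for i
  proof (cases "i = 0")
    case False
    then have "Dp i * (c i - c (Suc i)) = 0" using s0 t0 that by (subst (asm) sum_nonneg_eq_0_iff) auto
    then show ?thesis using cc[of i] that False by auto
  qed (simp add: Dp_def)
  have step: "d i = Dp i - Dp (i - 1)" if "1 \<le> i" for i
    using that by (cases i) (auto simp: Dp_def)
  have eq: "\<nu> i = ?L i" if "1 \<le> i" "i < n" for i
    using step[OF that(1)] Di[of i] Di[of "i - 1"] that m by (simp add: d_def)
  \<comment> \<open>The factor \<open>c n\<close> may vanish, but it is the sum of the non-negative
    numbers \<open>?L n\<close> and \<open>\<nu> n\<close>, which are then both 0.\<close>
  have eqn: "\<nu> n = ?L n"
  proof -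
    have "d n * c n = 0" using step[of n] Di[of "n - 1"] Dn n m by simp
    moreover have "\<nu> n \<ge> 0" by (simp add: \<nu>_def)
    ultimately show ?thesis using L0[of n] by (auto simp: d_def c_def)
  qed
  obtain e S where IeS: "I = (e, S)" by (cases I)
  have S: "S \<subseteq> ix n" "card S = p" "finite S" and e: "(\<Sum>a\<in>ix n. e a) = k" "\<And>i. i \<notin> ix n \<Longrightarrow> e i = 0"
    using I finite_subset[OF _ finite_ix] by (auto simp: gidx_def IeS simp flip: of_nat_sum)
  have mu: "\<mu> i = int (e i) - int (e (i + n)) + of_bool (i \<in> S) - of_bool (i + n \<in> S)" if "1 \<le> i" "i \<le> n" for i
    using that by (simp add: \<mu>_def wtI_def IeS)
  have one: "1 \<in> ix n" using n by (simp add: ix_def)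
  have esum: "e 1 + (\<Sum>a\<in>ix n - {1}. e a) = k" using e(1) sum.remove[OF finite_ix one, of e] by simp
  have "\<mu> 1 = int k + 1" using eq[of 1] \<nu>[of 1] n by (simp add: lamv_def)
  then have m1: "int (e 1) - int (e (1 + n)) + of_bool (1 \<in> S) - of_bool (1 + n \<in> S) = int k + 1"
    using mu[of 1] n by simp
  \<comment> \<open>All exponents together amount to k, so the coordinate k + 1 needs them all at
    x_1, together with dx_1 and without dx_(n+1).\<close>
  have e1: "e 1 = k" and S1: "1 \<in> S" "1 + n \<notin> S" using m1 esum by (auto simp: of_bool_def split: if_splits)
  have e0: "e i = (if i = 1 then k else 0)" for i
  proof (cases "i \<in> ix n - {1}")
    case True
    have "(\<Sum>a\<in>ix n - {1}. e a) = 0" using esum e1 by simp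
    then show ?thesis using True by auto
  next
    case False
    then have "i = 1 \<or> i \<noteq> 1 \<and> i \<notin> ix n" by blast
    then show ?thesis using e1 e(2)[of i] by (elim disjE) simp_all
  qed
  have mS: "\<mu> i = of_bool (i \<in> S) - of_bool (i + n \<in> S)" if "2 \<le> i" "i \<le> n" for i
    using mu[of i] that by (simp add: e0)
  have inS: "i \<in> S" if "1 \<le> i" "i \<le> p" "i < n" for i
  proof (cases "i = 1")
    case False
    then have "\<mu> i = 1" using eq[of i] \<nu>[of i] that by (simp add: lamv_def)
    then show ?thesis using mS[of i] that False by (auto simp: of_bool_def split: if_splits)
  qed (use S1 in simp)
  have ee: "e = (\<lambda>i. if i = 1 then k else 0)" using e0 by auto
  show ?thesis
  proof (cases "p < n")
    case True
    then have "{1..p} \<subseteq> S" using inS by auto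
    then have "{1..p} = S" using S by (intro card_subset_eq) auto
    then show ?thesis by (simp add: IeS Iplus_def ee)
  next
    case False
    then have pn: "p = n" using n by simp
    have sub: "{1..n-1} \<subseteq> S" using inS pn by auto
    have "\<bar>\<mu> n\<bar> = 1" using eqn n pn by (simp add: \<nu>_def lamv_def)
    then have "n \<in> S \<or> 2 * n \<in> S" using mS[of n] n by (auto simp: of_bool_def mult_2 split: if_splits)
    then show ?thesis
    proof
      assume "n \<in> S"
      moreover have "{1..p} = insert n {1..n-1}" using pn n by auto
      ultimately have "{1..p} \<subseteq> S" using sub by simp
      then have "{1..p} = S" using S by (intro card_subset_eq) auto
      then show ?thesis by (simp add: IeS Iplus_def ee)
    next
      assume "2 * n \<in> S"
      then have "insert (2 * n) {1..n-1} \<subseteq> S" using sub by auto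
      then have "insert (2 * n) {1..n-1} = S" using S pn n by (intro card_subset_eq) auto
      then show ?thesis by (simp add: IeS Iminus_def ee pn)
    qed
  qed
qed

lemma wtI_Iplus_neq_Iminus: "2 \<le> n \<Longrightarrow> wtI n (Iplus k n) \<noteq> wtI n (Iminus k n)"
proof
  assume n: "2 \<le> n" and "wtI n (Iplus k n) = wtI n (Iminus k n)"
  then have "wtI n (Iplus k n) n = wtI n (Iminus k n) n" by simp
  moreover have "\<not> n \<le> n - Suc 0" using n by simp
  ultimately show False using n by (simp add: wtI_def Iplus_def Iminus_def mult_2)
qed

text \<open>A vector of W maximal modulo U is dominant and has the Casimir value of M(k,p), so
  \<open>rigid\<close> applies to each of its monomials. Taking U = {0}, or W the whole of M(k,p),
  yields the irreducibility and splitting statements below.\<close>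

lemma top_vector:
  assumes n: "2 \<le> n" "1 \<le> p" "p \<le> n"
    and U: "MM.smod n U" and W: "MM.smod n W" "W \<subseteq> MG n (int k) (int p)" "\<not> W \<subseteq> U"
  shows "(unitf (Iplus k p) \<in> W \<and> unitf (Iplus k p) \<notin> U)
    \<or> (p = n \<and> unitf (Iminus k n) \<in> W \<and> unitf (Iminus k n) \<notin> U)"
proof -
  obtain w \<mu> where w: "w \<in> W" "w \<notin> U" "w \<in> sp n (int k) (int p) \<mu>"
    and e: "\<And>a b. a \<in> ix n \<Longrightarrow> b \<in> ix n \<Longrightarrow> ht n b < ht n a \<Longrightarrow> app (FF n a b) w \<in> U"
    by (rule max_vec[OF U W]) (rule that)
  have "w \<noteq> 0" using w(2) FS.subspace_0[OF MM.smodD(1)[OF U]] by auto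
  then obtain I0 where I0: "w I0 \<noteq> 0" by (auto simp: fun_eq_iff)
  have wM: "w \<in> MG n (int k) (int p)" using w(1) W(2) by auto
  have Q: "(\<Sum>i=1..n. \<mu> i * (\<mu> i + 2 * (int n - int i))) = int k * int k + 2 * int n * (int k + int p) - int p * int p"
    using casimir_top[OF U wM w(2,3) e] unfolding tfun_sum by simp
  have dom: "\<mu> j \<le> \<mu> i \<and> - \<mu> j \<le> \<mu> i" if "1 \<le> i" "i < j" "j \<le> n" for i j
  proof -
    have i: "i \<in> {1..n}" "i \<in> ix n" "j \<in> ix n" "j + n \<in> ix n" "j \<noteq> i" "j \<noteq> pr n i" "j + n \<noteq> i" "j + n \<noteq> pr n i"
      using that by (auto simp: ix_def pr_def)
    have "ht n j < ht n i" "ht n (j + n) < ht n i" using that by (auto simp: ht_def)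
    then have "mm n \<mu> j \<le> \<mu> i" "mm n \<mu> (j + n) \<le> \<mu> i"
      using sl2_dominant[OF U w(2,3)] i e by blast+
    then show ?thesis using that by (simp add: mm_def)
  qed
  have rig: "I = Iplus k p \<or> (p = n \<and> I = Iminus k n)" if "w I \<noteq> 0" for I
  proof -
    have "I \<in> widx n (int k) (int p) \<mu>" using fsupD[OF w(3) that] .
    then have I: "I \<in> gidx n (int k) (int p)" "wtI n I = \<mu>" by (auto simp: widx_def)
    show ?thesis using rigid[OF n I(1)] dom Q unfolding I(2) by blast
  qed
  \<comment> \<open>The two candidates have different weights, so a weight vector involves only one
    of them.\<close>
  have uniq: "I = I0" if "w I \<noteq> 0" for I
  proof -
    have "wtI n I = wtI n I0" using fsupD[OF w(3)] I0 that by (auto simp: widx_def)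
    then show ?thesis using rig[OF that] rig[OF I0] wtI_Iplus_neq_Iminus[OF n(1), of k] by auto
  qed
  have "w = fscale (w I0) (unitf I0)"
    using uniq by (auto simp: fun_eq_iff unitf_def of_bool_def)
  then have u: "fscale (1 / w I0) w = unitf I0" using I0 by (metis fscale_fscale fscale_1 nonzero_eq_divide_eq times_divide_eq_left mult_1)
  have "unitf I0 \<in> W" using FS.subspace_scale[OF MM.smodD(1)[OF W(1)] w(1), of "1 / w I0"] u by simp
  moreover have "unitf I0 \<notin> U"
    using FS.subspace_scale[OF MM.smodD(1)[OF U], of "unitf I0" "w I0"] w(2) \<open>w = fscale (w I0) (unitf I0)\<close> by metis
  ultimately show ?thesis using rig[OF I0] by auto
qed

text \<open>The differentials S of a top monomial include dx_1, contain no paired indices, and with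
  an index contain every index of greater height. Derivatives see only x_1, so d dies against dx_1
  and the codifferential on the missing partner of dx_1; the condition on heights makes raising
  operators vanish.\<close>

lemma unit_MG:
  assumes n: "2 \<le> n" "1 \<le> p" "p \<le> n" and I: "I = Iplus k p \<or> (p = n \<and> I = Iminus k n)"
  shows "unitf I \<in> MG n (int k) (int p)"
    and "MM.hw_vec n (\<lambda>a. of_int (mm n (wtI n I) a)) (unitf I)"
    and "I \<in> gidx n (int k) (int p)"
proof -
  define e :: "nat \<Rightarrow> nat" where "e = (\<lambda>i. if i = 1 then k else 0)"
  define S where "S = snd I"
  have IeS: "I = (e, S)" using I by (auto simp: Iplus_def Iminus_def e_def S_def)
  have S1: "1 \<in> S" "S \<subseteq> ix n" "card S = p" using I n by (auto simp: Iplus_def Iminus_def S_def ix_def)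
  have Spr: "pr n a \<notin> S" if "a \<in> S" for a
    using I n that by (auto simp: Iplus_def Iminus_def S_def pr_def)
  have Sht: "b \<in> S \<Longrightarrow> a \<in> ix n \<Longrightarrow> b \<in> ix n \<Longrightarrow> ht n b < ht n a \<Longrightarrow> a \<in> S" for a b
    using I n by (auto simp: Iplus_def Iminus_def S_def ht_def ix_def split: if_splits)
  have ht1: "ht n a \<le> ht n 1" if "a \<in> ix n" for a using that n by (auto simp: ht_def ix_def)
  have esum: "(\<Sum>a\<in>ix n. e a) = k" using n by (simp add: e_def ix_def)
  show Ig: "I \<in> gidx n (int k) (int p)"
    using S1 esum n by (auto simp: gidx_def IeS e_def ix_def simp del: of_nat_sum)
  have D0: "app (D a) (unitf I) = 0" if "a \<noteq> 1" for a
    using that by (auto simp: fun_eq_iff D_app unitf_def IeS e_def split: if_splits)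
  have ThD: "app (Th a) (app (D b) (unitf I)) = 0" if "b = 1" "a \<in> S" for a b
    using that by (auto simp: fun_eq_iff D_app Th_app unitf_def IeS)
  have ThDt: "app (Th a) (app (Dt b) (unitf I)) = 0" if "a \<in> S" "a \<noteq> b" for a b
    using that by (auto simp: fun_eq_iff Dt_app Th_app unitf_def IeS)
  have Dt0: "app (Dt b) (unitf I) = 0" if "b \<notin> S" for b
    using that by (auto simp: fun_eq_iff Dt_app unitf_def IeS)
  have T0: "app (T a b) (unitf I) = 0" if "a \<in> ix n" "b \<in> ix n" "ht n b < ht n a" for a b
  proof -
    have "b \<noteq> 1" using ht1[OF that(1)] that(3) by auto
    then have "app (D b) (unitf I) = 0" by (rule D0)
    moreover have "app (Th a) (app (Dt b) (unitf I)) = 0"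
    proof (cases "b \<in> S")
      case True
      then show ?thesis using ThDt[of a b] Sht[OF True that] that(3) by auto
    next
      case False
      then show ?thesis by (simp only: Dt0[OF False] app_0)
    qed
    ultimately show ?thesis unfolding T_def app_simps by (simp only: app_0 add_0)
  qed
  have FF0: "app (FF n a b) (unitf I) = 0" if "a \<in> ix n" "b \<in> ix n" "ht n b < ht n a" for a b
    using T0[OF that] T0[OF pr_mem pr_mem, OF that(2,1)] that unfolding FF_def app_simps by (simp add: ht_pr)
  have dE0: "app (dE n) (unitf I) = 0"
  proof -
    have "app (Th a) (app (D a) (unitf I)) = 0" for a
      using S1(1) ThD[of a a] D0[of a] by (cases "a = 1") auto
    then show ?thesis unfolding dE_def app_sum_op app_simps by simp
  qed
  have del0: "app (del n) (unitf I) = 0"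
  proof -
    have "app (D a) (app (Dt (pr n a)) (unitf I)) = 0" if "a \<in> ix n" for a
    proof (cases "a = 1")
      case True
      then have "pr n a \<notin> S" using Spr S1 by auto
      from Dt0[OF this] show ?thesis by (simp only: app_0)
    next
      case False
      have "app (D a) (app (Dt (pr n a)) (unitf I)) = app (Dt (pr n a)) (app (D a) (unitf I))"
        unfolding app_simps(6)[symmetric] DDt ..
      then show ?thesis using D0[OF False] by (simp only: app_0)
    qed
    then show ?thesis unfolding del_def app_sum_op app_simps by simp
  qed
  have usp: "unitf I \<in> sp n (int k) (int p) (wtI n I)"
    using Ig by (auto simp: fsup_def unitf_def widx_def of_bool_def)
  show "unitf I \<in> MG n (int k) (int p)" using sp_gr[OF usp] dE0 del0 by (simp add: MG_def)
  show "MM.hw_vec n (\<lambda>a. of_int (mm n (wtI n I) a)) (unitf I)"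
    unfolding MM.hw_vec_def using FF0 FF_diag[OF _ usp] by (simp add: rM_Fm)
qed

section \<open>Comparison with abstract highest weight modules\<close>

lemma (in vector_space_pair) dim_inj_image:
  assumes "Vector_Spaces.linear s1 s2 f" "inj f"
  shows "vs2.dim (f ` S) = vs1.dim S"
proof -
  interpret f: Vector_Spaces.linear s1 s2 f by fact
  obtain B where B: "B \<subseteq> S" "vs1.independent B" "S \<subseteq> vs1.span B" "card B = vs1.dim S"
    by (rule vs1.basis_exists)
  have "vs2.independent (f ` B)"
    by (rule f.independent_injective_image[OF B(2)]) (rule inj_on_subset[OF assms(2) subset_UNIV])
  moreover have "f ` S \<subseteq> vs2.span (f ` B)"
    using B(3) by (auto simp: f.span_image)
  ultimately have "card (f ` B) = vs2.dim (f ` S)"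
    using B(1) by (intro vs2.basis_card_eq_dim) auto
  then show ?thesis
    using B(4) card_image[OF inj_on_subset[OF assms(2) subset_UNIV], of B] by simp
qed

lemma FS_dim_direct_sum:
  assumes A: "FS.subspace A" "FS.subspace B" "A \<inter> B \<subseteq> {0}" and fin: "A \<subseteq> fsup C" "B \<subseteq> fsup C" "finite C"
    and S: "S = {x + y | x y. x \<in> A \<and> y \<in> B}"
  shows "FS.dim S = FS.dim A + FS.dim B"
proof -
  obtain B1 where B1: "B1 \<subseteq> A" "FS.independent B1" "A \<subseteq> FS.span B1" "card B1 = FS.dim A"
    by (rule FS.basis_exists)
  obtain B2 where B2: "B2 \<subseteq> B" "FS.independent B2" "B \<subseteq> FS.span B2" "card B2 = FS.dim B"
    by (rule FS.basis_exists)
  have "B1 \<subseteq> FS.span (unitf ` C)" using B1(1) fin(1) unfolding fsup_span[OF fin(3)] by (rule order_trans)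
  then have f1: "finite B1"
    using FS.independent_span_bound[OF finite_imageI[OF fin(3)] B1(2)] by simp
  have "B2 \<subseteq> FS.span (unitf ` C)" using B2(1) fin(2) unfolding fsup_span[OF fin(3)] by (rule order_trans)
  then have f2: "finite B2"
    using FS.independent_span_bound[OF finite_imageI[OF fin(3)] B2(2)] by simp
  have "0 \<notin> B1" using B1(2) FS.dependent_zero by blast
  then have dis: "B1 \<inter> B2 = {}" using A(3) B1(1) B2(1) by blast
  have "FS.independent (B1 \<union> B2)"
  proof (rule FS.independent_if_scalars_zero)
    fix u v assume 0: "(\<Sum>x\<in>B1 \<union> B2. fscale (u x) x) = 0" and v: "v \<in> B1 \<union> B2"
    let ?x = "\<Sum>x\<in>B1. fscale (u x) x" and ?y = "\<Sum>x\<in>B2. fscale (u x) x"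
    have xy: "?x + ?y = 0" using 0 sum.union_disjoint[OF f1 f2 dis, of "\<lambda>x. fscale (u x) x"] by metis
    have x: "?x \<in> A" using B1(1) by (intro FS.subspace_sum[OF A(1)] FS.subspace_scale[OF A(1)]) auto
    have y: "?y \<in> B" using B2(1) by (intro FS.subspace_sum[OF A(2)] FS.subspace_scale[OF A(2)]) auto
    have "?x = - ?y" using xy by (rule add_eq_0_iff2[THEN iffD1])
    then have "?x \<in> B" using FS.subspace_neg[OF A(2) y] by metis
    then have x0: "?x = 0" using x A(3) by blast
    from xy have y0: "?y = 0" unfolding x0 by (simp only: add_0)
    show "u v = 0" using v FS.independentD[OF B1(2) f1 order_refl x0] FS.independentD[OF B2(2) f2 order_refl y0] by blast
  qed (use f1 f2 in simp)
  moreover have "B1 \<union> B2 \<subseteq> S"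
  proof
    fix x assume "x \<in> B1 \<union> B2"
    then have "x + 0 \<in> S \<or> 0 + x \<in> S"
      unfolding S using B1(1) B2(1) FS.subspace_0[OF A(1)] FS.subspace_0[OF A(2)] by blast
    then show "x \<in> S" by (metis add_0 add_0_right)
  qed
  moreover have "S \<subseteq> FS.span (B1 \<union> B2)"
    unfolding S FS.span_Un using B1(3) B2(3) by blast
  ultimately have "card (B1 \<union> B2) = FS.dim S" by (intro FS.basis_card_eq_dim)
  then show ?thesis using card_Un_disjoint[OF f1 f2 dis] B1(4) B2(4) by simp
qed

lemma lie_rep_so_module:
  assumes "lie_rep n sc \<rho>" shows "so_module sc n \<rho>"
proof -
  interpret vector_space sc using assms by (simp add: lie_rep_def)
  have lin: "Vector_Spaces.linear sc sc (\<rho> A)" if "A \<in> so n" for A using assms that by (simp add: lie_rep_def)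
  show ?thesis
  proof unfold_locales
    fix A u v c assume A: "A \<in> so n"
    interpret L: Vector_Spaces.linear sc sc "\<rho> A" using lin[OF A] .
    show "\<rho> A (u + v) = \<rho> A u + \<rho> A v" "\<rho> A (sc c u) = sc c (\<rho> A u)" by (simp_all add: L.add L.scale)
  qed (use assms in \<open>auto simp: lie_rep_def\<close>)
qed

text \<open>The root is \<epsilon>_a - \<epsilon>_b if both indices lie in the first half,
  \<epsilon>_(b-n) - \<epsilon>_(a-n) if both lie in the second, and \<epsilon>_a + \<epsilon>_(b-n)
  if only b lies in the second. The remaining position cannot raise the height.\<close>

lemma Fm_pos_root:
  assumes "a \<in> ix n" "b \<in> ix n" "ht n b < ht n a" "b \<noteq> pr n a"
  shows "Fm n a b \<in> pos_root_vecs n"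
proof -
  have Hp: "H (i + n) (i + n) = - H i i" if "H \<in> cartan n" "i \<in> {1..n}" for H i
  proof -
    have "i \<in> ix n" "pr n i = i + n" using that(2) by (auto simp: ix_def pr_def)
    then show ?thesis using that(1) so_neg[of H n i i] by (simp add: cartan_def)
  qed
  have key: "Fm n a b \<in> pos_root_vecs n"
    if "1 \<le> i" "i < j" "j \<le> n" "s = 1 \<or> s = -1" "\<And>H. H \<in> cartan n \<Longrightarrow> H a a - H b b = H i i + s * H j j" for i j s
    unfolding pos_root_vecs_def using that Fm_so[OF assms(1,2)] bracket_diag[OF assms(1,2)] by auto
  consider "a \<le> n" "b \<le> n" | "a \<le> n" "b > n" | "a > n" "b > n" | "a > n" "b \<le> n" by linarith
  then show ?thesis
  proof cases
    case 1
    then show ?thesis using assms by (intro key[of a b "-1"]) (auto simp: ix_def ht_def)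
  next
    case 2
    define j where "j = b - n"
    have j: "b = j + n" "j \<in> {1..n}" "j \<noteq> a" using 2 assms by (auto simp: j_def ix_def pr_def)
    have a: "a \<in> {1..n}" using 2 assms by (auto simp: ix_def)
    show ?thesis
    proof (cases "a < j")
      case True
      then show ?thesis using a j(2) unfolding j(1) by (intro key[unfolded j(1), of a j 1]) (auto simp: Hp)
    next
      case False
      then show ?thesis using a j(2,3) unfolding j(1) by (intro key[unfolded j(1), of j a 1]) (auto simp: Hp)
    qed
  next
    case 3
    define i j where "i = a - n" and "j = b - n"
    have j: "a = i + n" "b = j + n" "j \<in> {1..n}" "i \<in> {1..n}" "j < i"
      using 3 assms by (auto simp: i_def j_def ix_def ht_def)
    show ?thesis using j(3-5) unfolding j(1,2) by (intro key[unfolded j(1,2), of j i "-1"]) (auto simp: Hp)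
  next
    case 4
    then show ?thesis using assms by (auto simp: ix_def ht_def)
  qed
qed

text \<open>\<open>H0 n\<close> does not see the last coordinate, the only one in which the two top
  weights for p = n differ; both monomials have the same eigenvalue.\<close>

lemma unit_H0:
  assumes "p \<le> n" "I = Iplus k p \<or> (p = n \<and> I = Iminus k n)" "2 \<le> n"
  shows "rM n (H0 n) (unitf I) = fscale (of_int (hgt n (wtI n (Iplus k p)))) (unitf I)"
proof
  fix K
  have h: "hgt n (wtI n I) = hgt n (wtI n (Iplus k p))"
    unfolding hgt_def
  proof (rule sum.cong[OF refl])
    fix i assume "i \<in> {1..n}"
    then show "(int n - int i) * wtI n I i = (int n - int i) * wtI n (Iplus k p) i"
      using assms by (cases "i = n") (simp, elim disjE conjE, simp, simp add: wtI_def Iplus_def Iminus_def, arith)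
  qed
  have "rM n (H0 n) (unitf I) K = (\<Sum>i\<in>{1..n}. H0 n i i * of_int (wtI n K i)) * unitf I K"
    by (rule RM_diag) simp
  also have "(\<Sum>i\<in>{1..n}. H0 n i i * of_int (wtI n K i)) = of_int (hgt n (wtI n K))"
    unfolding hgt_def of_int_sum by (intro sum.cong refl) (auto simp: H0_def ht_def ix_def)
  finally show "rM n (H0 n) (unitf I) K = fscale (of_int (hgt n (wtI n (Iplus k p)))) (unitf I) K"
    using h by (simp add: unitf_def)
qed

lemma unitf_ne0: "unitf I \<noteq> 0"
proof
  assume "unitf I = 0"
  then have "unitf I I = 0" by simp
  then show False by (simp add: unitf_def)
qed

text \<open>The submodule generated by the pair of highest weight vectors is the graph of the embedding.\<close>

lemma embed_irrep:
  fixes sc :: "complex \<Rightarrow> 'v::ab_group_add \<Rightarrow> 'v"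
  assumes n: "2 \<le> n" "1 \<le> p" "p \<le> n" and I: "I = Iplus k p \<or> (p = n \<and> I = Iminus k n)"
    and V: "irrep_hw n sc \<rho> lam" and lam: "\<And>i. i \<in> {1..n} \<Longrightarrow> lam i = of_int (wtI n I i)"
  obtains \<phi> where "Vector_Spaces.linear sc fscale \<phi>" "inj \<phi>"
    "\<forall>A\<in>so n. \<forall>x. \<phi> (\<rho> A x) = rM n A (\<phi> x)"
    "MM.smod n (range \<phi>)" "range \<phi> \<subseteq> MG n (int k) (int p)" "unitf I \<in> range \<phi>"
    "\<And>I'. I' = Iplus k p \<or> (p = n \<and> I' = Iminus k n) \<Longrightarrow> unitf I' \<in> range \<phi> \<Longrightarrow> I' = I"
proof -
  have rep: "lie_rep n sc \<rho>" and irr: "\<And>W. module.subspace sc W \<Longrightarrow> (\<And>A w. A \<in> so n \<Longrightarrow> w \<in> W \<Longrightarrow> \<rho> A w \<in> W) \<Longrightarrow> W = {0} \<or> W = UNIV"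
    using V by (auto simp: irrep_hw_def irreducible_rep_def)
  obtain v where v: "v \<noteq> 0" "v \<in> weight_space n sc \<rho> lam" "\<And>A. A \<in> pos_root_vecs n \<Longrightarrow> \<rho> A v = 0"
    using V by (auto simp: irrep_hw_def)
  interpret S: so_module sc n \<rho> using lie_rep_so_module[OF rep] .
  \<comment> \<open>Scalar multiplication and action on the product of V with the space of
    forms.\<close>
  define scp where "scp = (\<lambda>c (x, f). (sc c x, fscale c f))"
  define rp where "rp = (\<lambda>A (x, f). (\<rho> A x, rM n A f))"
  interpret PP: so_module scp n rp
    unfolding scp_def rp_def
    by unfold_locales
      (auto simp: S.scale_right_distrib S.scale_left_distrib FS.scale_right_distrib FS.scale_left_distrib
        S.rho_add S.rho_scale S.rho_madd S.rho_msmult S.rho_bracket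
        MM.rho_add MM.rho_scale MM.rho_madd MM.rho_msmult MM.rho_bracket simp del: fscale_apply plus_fun_apply)
  let ?u = "unitf I"
  let ?h = "of_int (hgt n (wtI n (Iplus k p))) :: complex"
  have wtF: "wt n lam (Fm n a a) = of_int (mm n (wtI n I) a)" if a: "a \<in> ix n" for a
  proof -
    have "wt n lam (Fm n a a) = (\<Sum>i\<in>{1..n}. if i = (if a \<le> n then a else a - n) then of_int (mm n (wtI n I) a) else 0)"
      unfolding wt_def using a lam by (intro sum.cong refl) (auto simp: Fm_def pr_def ix_def mm_def)
    then show ?thesis using a by (auto simp: ix_def)
  qed
  have vH: "\<rho> H v = sc (wt n lam H) v" if "H \<in> cartan n" for H
    using v(2) that by (simp add: weight_space_def)
  have wtH0: "wt n lam (H0 n) = ?h"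
  proof -
    have "hgt n (wtI n I) = hgt n (wtI n (Iplus k p))"
      unfolding hgt_def
    proof (rule sum.cong[OF refl])
      fix i assume "i \<in> {1..n}"
      then show "(int n - int i) * wtI n I i = (int n - int i) * wtI n (Iplus k p) i"
        using n I by (cases "i = n") (simp, elim disjE conjE, simp, simp add: wtI_def Iplus_def Iminus_def, arith)
    qed
    moreover have "wt n lam (H0 n) = of_int (hgt n (wtI n I))"
      unfolding wt_def hgt_def of_int_sum using lam by (intro sum.cong refl) (auto simp: H0_def ht_def ix_def)
    ultimately show ?thesis by simp
  qed
  have hwp: "PP.hw_vec (\<lambda>a. of_int (mm n (wtI n I) a)) (v, ?u)"
  proof -
    have "\<rho> (Fm n a b) v = 0" if "a \<in> ix n" "b \<in> ix n" "ht n b < ht n a" for a b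
      using v(3)[OF Fm_pos_root[OF that]] Fm_zero[OF that(1), of b] S.rho_zero_mat by (cases "b = pr n a") auto
    then show ?thesis
      using unit_MG(2)[OF n I] vH wtF unfolding PP.hw_vec_def MM.hw_vec_def
      by (auto simp: zero_prod_def rp_def scp_def)
  qed
  have H0p: "rp (H0 n) (v, ?u) = scp ?h (v, ?u)"
    using vH[OF H0_cartan] wtH0 unit_H0[OF n(3) I n(1)] by (simp add: rp_def scp_def)
  define R where "R = PP.gen (v, ?u)"
  have Rm: "PP.smod R" and Rv: "(v, ?u) \<in> R" unfolding R_def by (rule PP.smod_gen, rule PP.gen_self)
  note Rs = PP.smodD(1)[OF Rm]
  have R0: "(0, 0) \<in> R" using PP.subspace_0[OF Rs] by (simp add: zero_prod_def)
  have Radd: "(x + x', f + f') \<in> R" if "(x, f) \<in> R" "(x', f') \<in> R" for x x' f f'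
    using PP.subspace_add[OF Rs that] by simp
  have Rdiff: "(x - x', f - f') \<in> R" if "(x, f) \<in> R" "(x', f') \<in> R" for x x' f f'
    using PP.subspace_diff[OF Rs that] by simp
  have Rsc: "(sc c x, fscale c f) \<in> R" if "(x, f) \<in> R" for c x f
    using PP.subspace_scale[OF Rs that] by (simp add: scp_def)
  have Rrp: "(\<rho> A x, rM n A f) \<in> R" if "(x, f) \<in> R" "A \<in> so n" for A x f
    using PP.smodD(2)[OF Rm that(2,1)] by (simp add: rp_def)
  have uniq: "\<exists>c. (x, f) = (sc c v, fscale c ?u)"
    if "(x, f) \<in> R" "\<rho> (H0 n) x = sc ?h x" "rM n (H0 n) f = fscale ?h f" for x f
    using PP.hw_unique[OF hwp H0p that(1)[unfolded R_def]] that(2,3) by (simp add: rp_def scp_def)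
  have RMG: "f \<in> MG n (int k) (int p)" if "(x, f) \<in> R" for x f
  proof -
    note sMG = MM.smodD(1)[OF smod_MG[of n "int k" "int p"]]
    have "PP.smod (UNIV \<times> MG n (int k) (int p))"
      unfolding PP.smod_def
    proof (intro conjI ballI)
      show "PP.subspace (UNIV \<times> MG n (int k) (int p))"
        unfolding PP.subspace_def using FS.subspace_0[OF sMG] FS.subspace_add[OF sMG] FS.subspace_scale[OF sMG]
        by (auto simp: scp_def zero_prod_def simp del: fscale_apply plus_fun_apply)
    qed (use MM.smodD(2)[OF smod_MG] in \<open>auto simp: rp_def\<close>)
    then have "R \<subseteq> UNIV \<times> MG n (int k) (int p)"
      unfolding R_def using unit_MG(1)[OF n I] by (intro PP.gen_least) auto
    then show ?thesis using that by auto
  qed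
  \<comment> \<open>These x form a submodule of V. Were it all of V, then (v, 0) would be a multiple
    of the generating pair, although the second entry of that pair is nonzero.\<close>
  have K1: "x = 0" if "(x, 0) \<in> R" for x
  proof -
    have "{x. (x, 0) \<in> R} = {0} \<or> {x. (x, 0) \<in> R} = UNIV"
    proof (rule irr)
      show "S.subspace {x. (x, 0) \<in> R}"
        unfolding S.subspace_def using R0 Radd[of _ 0 _ 0] Rsc[of _ 0] by auto
      show "\<rho> A w \<in> {x. (x, 0) \<in> R}" if "A \<in> so n" "w \<in> {x. (x, 0) \<in> R}" for A w
        using Rrp[of w 0 A] that MM.rho_0[OF that(1)] by simp
    qed
    moreover have "{x. (x, 0) \<in> R} \<noteq> UNIV"
    proof
      assume "{x. (x, 0) \<in> R} = UNIV"
      then have "(v, 0) \<in> R" by auto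
      then obtain c where "v = sc c v" "0 = fscale c ?u"
        using uniq[of v 0] vH[OF H0_cartan] wtH0 MM.rho_0[OF H0_so] by auto
      then have "c = 0" using FS.scale_eq_0_iff[of c ?u] unitf_ne0 by metis
      then show False using \<open>v = sc c v\<close> v(1) by simp
    qed
    ultimately show ?thesis using that by auto
  qed
  \<comment> \<open>If this submodule of M(k,p) were nonzero, it would contain a top monomial.
    Paired with 0 this has the top eigenvalue of \<open>H0 n\<close>, hence is a multiple of (v,
    \<open>?u\<close>), impossible as v is nonzero.\<close>
  have K2: "f = 0" if "(0, f) \<in> R" for f
  proof -
    let ?K = "{f. (0, f) \<in> R}"
    have "MM.smod n ?K"
      unfolding MM.smod_def
    proof (intro conjI ballI)
      show "FS.subspace ?K"
        unfolding FS.subspace_def using R0 Radd[of 0 _ 0] Rsc[of 0] by auto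
      show "rM n A f \<in> ?K" if "A \<in> so n" "f \<in> ?K" for A f
        using Rrp[of 0 f A] that S.rho_0[OF that(1)] by simp
    qed
    moreover have "MM.smod n {0}"
      unfolding MM.smod_def FS.subspace_def by (auto simp: MM.rho_0 simp del: fscale_apply)
    moreover have "?K \<subseteq> MG n (int k) (int p)" using RMG by auto
    ultimately have "?K \<subseteq> {0} \<or> (\<exists>I'. (I' = Iplus k p \<or> (p = n \<and> I' = Iminus k n)) \<and> unitf I' \<in> ?K)"
      using top_vector[OF n, of "{0}" ?K] by blast
    moreover have False if I': "I' = Iplus k p \<or> (p = n \<and> I' = Iminus k n)" "unitf I' \<in> ?K" for I'
    proof -
      obtain c where c: "0 = sc c v" "unitf I' = fscale c ?u"
        using uniq[of 0 "unitf I'"] I' unit_H0[OF n(3) I'(1) n(1)] S.rho_0[OF H0_so] by auto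
      then have "c = 0" using v(1) by (metis S.scale_eq_0_iff)
      then show False using c(2) unitf_ne0[of I'] FS.scale_zero_left by metis
    qed
    ultimately show ?thesis using that by blast
  qed
  have dom: "\<exists>f. (x, f) \<in> R" for x
  proof -
    have "{x. \<exists>f. (x, f) \<in> R} = {0} \<or> {x. \<exists>f. (x, f) \<in> R} = UNIV"
    proof (rule irr)
      show "S.subspace {x. \<exists>f. (x, f) \<in> R}"
        unfolding S.subspace_def using R0 Radd Rsc by blast
    qed (use Rrp in blast)
    then show ?thesis using Rv v(1) by auto
  qed
  define \<phi> where "\<phi> = (\<lambda>x. THE f. (x, f) \<in> R)"
  have \<phi>_eq: "\<phi> x = f" if "(x, f) \<in> R" for x f
    unfolding \<phi>_def
  proof (rule the_equality)
    fix g assume "(x, g) \<in> R"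
    then have "(0, g - f) \<in> R" using Rdiff[OF _ that, of x g] by simp
    then show "g = f" using K2 by (metis eq_iff_diff_eq_0)
  qed (rule that)
  have \<phi>R: "(x, \<phi> x) \<in> R" for x using dom[of x] \<phi>_eq by auto
  have inj: "x = y" if "\<phi> x = \<phi> y" for x y
  proof -
    have "(x - y, \<phi> x - \<phi> x) \<in> R" using Rdiff[OF \<phi>R[of x] \<phi>R[of y]] that by metis
    then have "(x - y, 0) \<in> R" by (metis diff_self)
    from K1[OF this] show ?thesis by (simp only: right_minus_eq)
  qed
  have lin: "Vector_Spaces.linear sc fscale \<phi>"
  proof (unfold_locales, goal_cases)
    case (1 x y) then show ?case by (rule \<phi>_eq[OF Radd[OF \<phi>R \<phi>R]])
  next
    case (2 c x) then show ?case by (rule \<phi>_eq[OF Rsc[OF \<phi>R]])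
  qed
  have eqv: "\<phi> (\<rho> A x) = rM n A (\<phi> x)" if "A \<in> so n" for A x
    by (rule \<phi>_eq[OF Rrp[OF \<phi>R that]])
  interpret L: Vector_Spaces.linear sc fscale \<phi> by (rule lin)
  have sm: "MM.smod n (range \<phi>)"
    unfolding MM.smod_def
  proof (intro conjI ballI)
    show "FS.subspace (range \<phi>)" by (rule L.subspace_image) simp
    show "rM n A f \<in> range \<phi>" if "A \<in> so n" "f \<in> range \<phi>" for A f
      using that eqv[OF that(1), symmetric] by auto
  qed
  \<comment> \<open>The other top monomial would have the same eigenvalue of \<open>H0 n\<close>,
    and by \<open>uniq\<close> that eigenspace within R consists of multiples of the generating
    pair.\<close>
  have last: "I' = I" if I': "I' = Iplus k p \<or> (p = n \<and> I' = Iminus k n)" "unitf I' \<in> range \<phi>" for I'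
  proof -
    obtain x where x: "unitf I' = \<phi> x" using I'(2) by auto
    have "\<phi> (\<rho> (H0 n) x) = fscale ?h (\<phi> x)"
      using eqv[OF H0_so] unit_H0[OF n(3) I'(1) n(1)] x by metis
    also have "\<dots> = \<phi> (sc ?h x)" by (rule L.scale[symmetric])
    finally have "\<rho> (H0 n) x = sc ?h x" by (rule inj)
    then obtain c where "unitf I' = fscale c ?u"
      using uniq[OF \<phi>R[of x]] unit_H0[OF n(3) I'(1) n(1)] unfolding x by auto
    then have "unitf I' I' = c * unitf I I'" by (metis fscale_apply)
    then show "I' = I" by (auto simp: unitf_def of_bool_def split: if_splits)
  qed
  have "unitf I \<in> range \<phi>" using \<phi>_eq[OF Rv] by (metis rangeI)
  moreover have "range \<phi> \<subseteq> MG n (int k) (int p)" using RMG \<phi>R by blast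
  moreover have "inj \<phi>" using inj by (auto simp: inj_def)
  moreover have "\<forall>A\<in>so n. \<forall>x. \<phi> (\<rho> A x) = rM n A (\<phi> x)" using eqv by blast
  ultimately show ?thesis using that[OF lin _ _ sm _ _ last] by blast
qed

section \<open>Weight multiplicities read off in the model\<close>

text \<open>Each diagonal generator reads off one coordinate, so being a weight vector is a
  condition on the support alone.\<close>

lemma model_weight:
  assumes "f \<in> gr n k p"
  shows "(\<forall>H\<in>cartan n. rM n H f = fscale (wt n mu H) f) \<longleftrightarrow> (\<forall>J. f J \<noteq> 0 \<longrightarrow> (\<forall>i\<in>{1..n}. mu i = of_int (wtI n J i)))"
proof (intro iffI allI impI ballI)
  fix J i assume H: "\<forall>H\<in>cartan n. rM n H f = fscale (wt n mu H) f" and J: "f J \<noteq> 0" and i: "i \<in> {1..n}"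
  have ii: "i \<in> ix n" using i by (auto simp: ix_def)
  have Fi: "Fm n i i j j = (if j = i then 1 else 0)" if "j \<in> {1..n}" for j
    using i that by (auto simp: Fm_def pr_def)
  have "rM n (Fm n i i) f J = wt n mu (Fm n i i) * f J" using H Fm_diag_cartan[OF ii] by simp
  then have "(\<Sum>j\<in>{1..n}. Fm n i i j j * of_int (wtI n J j)) = wt n mu (Fm n i i)"
    using J RM_diag[OF Fm_diag_cartan[OF ii], of f J] by simp
  moreover have "(\<Sum>j\<in>{1..n}. Fm n i i j j * of_int (wtI n J j)) = (\<Sum>j\<in>{1..n}. if j = i then of_int (wtI n J j) else 0)"
    using Fi by (intro sum.cong refl) simp
  moreover have "wt n mu (Fm n i i) = (\<Sum>j\<in>{1..n}. if j = i then complex_of_real (mu j) else 0)"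
    unfolding wt_def using Fi by (intro sum.cong refl) simp
  ultimately have "complex_of_real (mu i) = of_int (wtI n J i)" using i by simp
  then show "mu i = of_int (wtI n J i)" by (metis of_real_eq_iff of_real_of_int_eq)
next
  fix H assume J: "\<forall>J. f J \<noteq> 0 \<longrightarrow> (\<forall>i\<in>{1..n}. mu i = of_int (wtI n J i))" and H: "H \<in> cartan n"
  show "rM n H f = fscale (wt n mu H) f"
  proof
    fix J
    show "rM n H f J = fscale (wt n mu H) f J"
    proof (cases "f J = 0")
      case False
      have "(\<Sum>i\<in>{1..n}. H i i * of_int (wtI n J i)) = wt n mu H"
        unfolding wt_def
      proof (rule sum.cong[OF refl])
        fix i assume "i \<in> {1..n}"
        then have "mu i = of_int (wtI n J i)" using J False by blast
        then show "H i i * of_int (wtI n J i) = complex_of_real (mu i) * H i i" by simp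
      qed
      then show ?thesis by (simp add: RM_diag[OF H])
    qed (simp add: RM_diag[OF H])
  qed
qed

text \<open>An injective intertwining map carries the weight space onto the part of its range
  supported on that weight. Monomials have integral weights, hence the floor in one case and the
  value 0 in the other.\<close>

lemma wmult_image:
  assumes \<phi>: "Vector_Spaces.linear sc fscale \<phi>" "inj \<phi>" "\<forall>A\<in>so n. \<forall>x. \<phi> (\<rho> A x) = rM n A (\<phi> x)"
    and M: "range \<phi> \<subseteq> MG n k p"
  shows "in_PG n mu \<Longrightarrow> wmult n sc \<rho> mu = FS.dim (range \<phi> \<inter> sp n k p (\<lambda>i. if i \<in> {1..n} then \<lfloor>mu i\<rfloor> else 0))"
    and "\<not> in_PG n mu \<Longrightarrow> wmult n sc \<rho> mu = 0"
proof -
  interpret L: Vector_Spaces.linear sc fscale \<phi> by fact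
  interpret P: vector_space_pair sc fscale ..
  have e: "\<rho> H x = sc c x \<longleftrightarrow> rM n H (\<phi> x) = fscale c (\<phi> x)" if "H \<in> so n" for H x c
    using \<phi>(2,3) that L.scale by (metis injD)
  have W: "\<phi> ` weight_space n sc \<rho> mu = {f \<in> range \<phi>. \<forall>J. f J \<noteq> 0 \<longrightarrow> (\<forall>i\<in>{1..n}. mu i = of_int (wtI n J i))}"
  proof -
    have "x \<in> weight_space n sc \<rho> mu \<longleftrightarrow> (\<forall>J. \<phi> x J \<noteq> 0 \<longrightarrow> (\<forall>i\<in>{1..n}. mu i = of_int (wtI n J i)))" for x
    proof -
      have "\<phi> x \<in> gr n k p" using M by (auto simp: MG_def)
      from model_weight[OF this] show ?thesis unfolding weight_space_def using e by (auto simp: cartan_def)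
    qed
    then show ?thesis by auto
  qed
  have d: "wmult n sc \<rho> mu = FS.dim (\<phi> ` weight_space n sc \<rho> mu)"
    unfolding wmult_def by (rule P.dim_inj_image[OF \<phi>(1,2), symmetric])
  show "wmult n sc \<rho> mu = FS.dim (range \<phi> \<inter> sp n k p (\<lambda>i. if i \<in> {1..n} then \<lfloor>mu i\<rfloor> else 0))" if PG: "in_PG n mu"
  proof -
    have "(\<forall>i\<in>{1..n}. mu i = of_int (wtI n J i)) \<longleftrightarrow> wtI n J = (\<lambda>i. if i \<in> {1..n} then \<lfloor>mu i\<rfloor> else 0)" for J
    proof
      assume a: "\<forall>i\<in>{1..n}. mu i = of_int (wtI n J i)"
      show "wtI n J = (\<lambda>i. if i \<in> {1..n} then \<lfloor>mu i\<rfloor> else 0)"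
      proof
        fix i
        show "wtI n J i = (if i \<in> {1..n} then \<lfloor>mu i\<rfloor> else 0)"
        proof (cases "i \<in> {1..n}")
          case True
          then have "mu i = of_int (wtI n J i)" using a by blast
          then have "\<lfloor>mu i\<rfloor> = wtI n J i" by simp
          then show ?thesis using True by simp
        next
          case False
          then show ?thesis by (simp only: wtI_def if_False)
        qed
      qed
    next
      assume "wtI n J = (\<lambda>i. if i \<in> {1..n} then \<lfloor>mu i\<rfloor> else 0)"
      then show "\<forall>i\<in>{1..n}. mu i = of_int (wtI n J i)" using PG by (auto simp: in_PG_def elim: Ints_cases)
    qed
    then have "{f \<in> range \<phi>. \<forall>J. f J \<noteq> 0 \<longrightarrow> (\<forall>i\<in>{1..n}. mu i = of_int (wtI n J i))}
       = range \<phi> \<inter> sp n k p (\<lambda>i. if i \<in> {1..n} then \<lfloor>mu i\<rfloor> else 0)"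
      using M unfolding MG_def fsup_def widx_def by blast
    then show ?thesis unfolding d W by simp
  qed
  show "wmult n sc \<rho> mu = 0" if nPG: "\<not> in_PG n mu"
  proof -
    have "{f \<in> range \<phi>. \<forall>J. f J \<noteq> 0 \<longrightarrow> (\<forall>i\<in>{1..n}. mu i = of_int (wtI n J i))} \<subseteq> {0}"
    proof
      fix f assume f: "f \<in> {f \<in> range \<phi>. \<forall>J. f J \<noteq> 0 \<longrightarrow> (\<forall>i\<in>{1..n}. mu i = of_int (wtI n J i))}"
      obtain j where j: "j \<in> {1..n}" "mu j \<notin> \<int>" using nPG unfolding in_PG_def by blast
      have "f J = 0" for J
      proof (rule ccontr)
        assume "f J \<noteq> 0"
        then have "mu j = of_int (wtI n J j)" using f j(1) by blast
        then show False using j(2) by (metis Ints_of_int)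
      qed
      then show "f \<in> {0}" by (simp add: fun_eq_iff)
    qed
    then show ?thesis unfolding d W by (rule dim_zero_space)
  qed
qed

section \<open>Counting monomials\<close>

text \<open>Subsets are grouped by size. The limit m may exceed the size of Y, the extra binomials
  being 0; limits independent of Y allow sums to be exchanged later.\<close>

lemma sum_Pow_card:
  fixes g :: "nat \<Rightarrow> int"
  assumes "finite Y" "card Y \<le> m"
  shows "(\<Sum>A\<in>Pow Y. g (card A)) = (\<Sum>\<beta>=0..m. int (card Y choose \<beta>) * g \<beta>)"
proof -
  have "(\<Sum>A\<in>Pow Y. g (card A)) = (\<Sum>\<beta>=0..m. \<Sum>A\<in>{A \<in> Pow Y. card A = \<beta>}. g (card A))"
    using assms by (intro sum.group[symmetric]) (auto intro: order_trans[OF card_mono])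
  also have "\<dots> = (\<Sum>\<beta>=0..m. int (card Y choose \<beta>) * g \<beta>)"
    using n_subsets[OF assms(1)] by (intro sum.cong refl) (simp add: Pow_def)
  finally show ?thesis .
qed

lemma sum_Pow_Un:
  fixes g :: "nat \<Rightarrow> nat \<Rightarrow> int"
  assumes fin: "finite Y" "finite Z" and dis: "Y \<inter> Z = {}" and m: "card Y \<le> m" "card Z \<le> m'"
  shows "(\<Sum>A\<in>Pow (Y \<union> Z). g (card (A \<inter> Y)) (card (A \<inter> Z)))
    = (\<Sum>\<beta>=0..m. \<Sum>\<gamma>=0..m'. int (card Y choose \<beta>) * int (card Z choose \<gamma>) * g \<beta> \<gamma>)"
proof -
  have "(\<Sum>A\<in>Pow (Y \<union> Z). g (card (A \<inter> Y)) (card (A \<inter> Z)))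
      = (\<Sum>q\<in>Pow Y \<times> Pow Z. g (card (fst q)) (card (snd q)))"
    using dis by (intro sum.reindex_bij_witness[of _ "\<lambda>q. fst q \<union> snd q" "\<lambda>A. (A \<inter> Y, A \<inter> Z)"])
      (auto simp: Int_Un_distrib2 intro!: arg_cong2[of _ _ _ _ g] arg_cong[of _ _ card])
  also have "\<dots> = (\<Sum>A\<in>Pow Y. \<Sum>B\<in>Pow Z. g (card A) (card B))"
    by (simp add: sum.cartesian_product case_prod_beta)
  also have "\<dots> = (\<Sum>A\<in>Pow Y. \<Sum>\<gamma>=0..m'. int (card Z choose \<gamma>) * g (card A) \<gamma>)"
    by (intro sum.cong refl sum_Pow_card[OF fin(2) m(2)])
  also have "\<dots> = (\<Sum>\<beta>=0..m. int (card Y choose \<beta>) * (\<Sum>\<gamma>=0..m'. int (card Z choose \<gamma>) * g \<beta> \<gamma>))"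
    by (rule sum_Pow_card[OF fin(1) m(1)])
  finally show ?thesis by (simp add: sum_distrib_left mult.assoc)
qed

lemma card_compositions:
  assumes "n > 0"
  shows "card {t :: nat \<Rightarrow> nat. (\<forall>i. i \<notin> {1..n} \<longrightarrow> t i = 0) \<and> (\<Sum>i=1..n. t i) = m} = (m + n - 1) choose (n - 1)"
proof -
  let ?A = "{t :: nat \<Rightarrow> nat. (\<forall>i. i \<notin> {1..n} \<longrightarrow> t i = 0) \<and> (\<Sum>i=1..n. t i) = m}"
  let ?B = "{l :: nat list. length l = n \<and> sum_list l = m}"
  have sl: "sum_list (map t [1..<Suc n]) = (\<Sum>i=1..n. t i)" for t :: "nat \<Rightarrow> nat"
    using sum_set_upt_conv_sum_list_nat[of t 1 "Suc n"] by (simp add: atLeastLessThanSuc_atLeastAtMost del: upt_Suc)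
  have "bij_betw (\<lambda>t. map t [1..<Suc n]) ?A ?B"
  proof (rule bij_betw_byWitness[of _ "\<lambda>l i. if i \<in> {1..n} then l ! (i - 1) else 0"])
    show "\<forall>t\<in>?A. (\<lambda>i. if i \<in> {1..n} then map t [1..<Suc n] ! (i - 1) else 0) = t"
      by (auto simp: fun_eq_iff simp del: upt_Suc)
    show inv: "\<forall>l\<in>?B. map (\<lambda>i. if i \<in> {1..n} then l ! (i - 1) else 0) [1..<Suc n] = l"
      by (auto intro!: nth_equalityI simp del: upt_Suc)
    show "(\<lambda>t. map t [1..<Suc n]) ` ?A \<subseteq> ?B" using sl by (auto simp del: upt_Suc)
    show "(\<lambda>l i. if i \<in> {1..n} then l ! (i - 1) else 0) ` ?B \<subseteq> ?A"
    proof
      fix t assume "t \<in> (\<lambda>l i. if i \<in> {1..n} then l ! (i - 1) else 0) ` ?B"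
      then obtain l where l: "l \<in> ?B" "t = (\<lambda>i. if i \<in> {1..n} then l ! (i - 1) else 0)" by blast
      have "(\<Sum>i=1..n. t i) = m" unfolding sl[symmetric] using inv l by (simp del: upt_Suc)
      then show "t \<in> ?A" using l(2) by auto
    qed
  qed
  then have "card ?A = card ?B" by (rule bij_betw_same_card)
  also have "\<dots> = (m + n - 1) choose m" by (rule card_length_sum_list)
  also have "\<dots> = (m + n - 1) choose (n - 1)" using assms by (subst binomial_symmetric) auto
  finally show ?thesis .
qed

section \<open>Counting exponents and differentials of a given weight\<close>

definition expo :: "nat \<Rightarrow> int \<Rightarrow> (nat \<Rightarrow> int) \<Rightarrow> (nat \<Rightarrow> nat) set" where
  "expo n a \<nu> = {e. (\<forall>i. i \<notin> ix n \<longrightarrow> e i = 0) \<and> int (\<Sum>i\<in>ix n. e i) = a \<and> (\<forall>i\<in>{1..n}. int (e i) - int (e (i + n)) = \<nu> i)}"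

text \<open>The exponents of x_i and x_(i+n) are determined by their difference \<nu>(i) and their
  minimum t(i), and add up to |\<nu>(i)| + 2 t(i). So the t(i) are arbitrary with sum x, and stars
  and bars applies.\<close>

lemma card_expo:
  assumes "n > 0" and a: "a = (\<Sum>i=1..n. \<bar>\<nu> i\<bar>) + 2 * x"
  shows "int (card (expo n a \<nu>)) = binom (x + int n - 1) (int n - 1)"
proof -
  let ?A = "{t :: nat \<Rightarrow> nat. (\<forall>i. i \<notin> {1..n} \<longrightarrow> t i = 0) \<and> int (\<Sum>i=1..n. t i) = x}"
  let ?f = "\<lambda>(e :: nat \<Rightarrow> nat) i. if i \<in> {1..n} then min (e i) (e (i + n)) else 0"
  let ?g = "\<lambda>(t :: nat \<Rightarrow> nat) i. if i \<in> {1..n} then t i + nat (\<nu> i)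
      else if i \<in> {n + 1..2 * n} then t (i - n) + nat (- \<nu> (i - n)) else 0"
  have "bij_betw ?f (expo n a \<nu>) ?A"
  proof (rule bij_betw_byWitness[of _ ?g])
    show "\<forall>e\<in>expo n a \<nu>. ?g (?f e) = e"
    proof (intro ballI ext)
      fix e i assume e: "e \<in> expo n a \<nu>"
      have d: "int (e j) - int (e (j + n)) = \<nu> j" if "j \<in> {1..n}" for j using e that by (simp add: expo_def)
      consider "i \<in> {1..n}" | "i \<in> {n+1..2*n}" | "i \<notin> ix n"
        unfolding ix_def atLeastAtMost_iff by linarith
      then show "?g (?f e) i = e i"
      proof cases
        case 1 then show ?thesis using d[of i] by (simp add: min_def) linarith
      next
        case 2 
        then have j: "i - n \<in> {1..n}" "i - n + n = i" "i \<notin> {1..n}" by auto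
        then show ?thesis using d[OF j(1)] 2 by (simp add: min_def) linarith
      next
        case 3 then show ?thesis using e by (auto simp: expo_def ix_def)
      qed
    qed
    show "\<forall>t\<in>?A. ?f (?g t) = t" by (auto simp: fun_eq_iff min_def)
    show "?f ` expo n a \<nu> \<subseteq> ?A"
    proof
      fix t assume "t \<in> ?f ` expo n a \<nu>"
      then obtain e where e: "e \<in> expo n a \<nu>" "t = ?f e" by blast
      have "int (\<Sum>i\<in>ix n. e i) = (\<Sum>i=1..n. \<bar>\<nu> i\<bar> + 2 * int (t i))"
        unfolding sum_ix of_nat_sum
      proof (rule sum.cong[OF refl])
        fix i assume i: "i \<in> {1..n}"
        then have "int (e i) - int (e (i + n)) = \<nu> i" using e(1) by (simp add: expo_def)
        moreover have "t i = min (e i) (e (i + n))" using e(2) i by simp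
        ultimately show "int (e i + e (i + n)) = \<bar>\<nu> i\<bar> + 2 * int (t i)"
          by (simp add: min_def)
      qed
      then have "int (\<Sum>i=1..n. t i) = x" using e(1) a
        by (simp add: expo_def sum.distrib flip: sum_distrib_left)
      then show "t \<in> ?A" using e(2) by simp
    qed
    show "?g ` ?A \<subseteq> expo n a \<nu>"
    proof
      fix e assume "e \<in> ?g ` ?A"
      then obtain t where t: "t \<in> ?A" "e = ?g t" by blast
      have "int (\<Sum>i\<in>ix n. e i) = (\<Sum>i=1..n. \<bar>\<nu> i\<bar> + 2 * int (t i))"
        unfolding sum_ix of_nat_sum
      proof (rule sum.cong[OF refl])
        fix i assume "i \<in> {1..n}"
        then show "int (e i + e (i + n)) = \<bar>\<nu> i\<bar> + 2 * int (t i)"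
          using t(2) by auto
      qed
      also have "\<dots> = a" using t(1) a by (simp add: sum.distrib flip: sum_distrib_left)
      finally have "int (\<Sum>i\<in>ix n. e i) = a" .
      moreover have "\<forall>i\<in>{1..n}. int (e i) - int (e (i + n)) = \<nu> i" using t(2) by auto
      moreover have "\<forall>i. i \<notin> ix n \<longrightarrow> e i = 0" using t(2) by (auto simp: ix_def)
      ultimately show "e \<in> expo n a \<nu>" unfolding expo_def by blast
    qed
  qed
  then have c: "card (expo n a \<nu>) = card ?A" by (rule bij_betw_same_card)
  show ?thesis
  proof (cases "x < 0")
    case True
    then have "?A = {}" by (auto simp del: of_nat_sum)
    then have "card (expo n a \<nu>) = 0" unfolding c by (simp only: card.empty)
    then show ?thesis using True by (simp add: binom_def)
  next
    case False
    then have "?A = {t. (\<forall>i. i \<notin> {1..n} \<longrightarrow> t i = 0) \<and> (\<Sum>i=1..n. t i) = nat x}"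
      by (auto simp del: of_nat_sum)
    then have "card ?A = (nat x + n - 1) choose (n - 1)" using card_compositions[OF assms(1), of "nat x"] by simp
    moreover have "nat (x + int n - 1) = nat x + n - 1" "nat (int n - 1) = n - 1" using False assms(1) by auto
    ultimately show ?thesis using False c assms(1) by (simp add: binom_def)
  qed
qed

lemma cnt_sum_expo:
  assumes \<mu>: "\<And>i. i \<notin> {1..n} \<Longrightarrow> \<mu> i = 0"
  shows "cnt n a (int b) \<mu> = (\<Sum>S | S \<subseteq> ix n \<and> card S = b.
    int (card (expo n a (\<lambda>i. \<mu> i - of_bool (i \<in> S) + of_bool (i + n \<in> S)))))"
proof -
  let ?A = "{S. S \<subseteq> ix n \<and> card S = b}"
  let ?E = "\<lambda>S. expo n a (\<lambda>i. \<mu> i - of_bool (i \<in> S) + of_bool (i + n \<in> S))"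
  have eq: "(e, S) \<in> widx n a (int b) \<mu> \<longleftrightarrow> S \<in> ?A \<and> e \<in> ?E S" for e S
  proof -
    have "wtI n (e, S) = \<mu> \<longleftrightarrow> (\<forall>i\<in>{1..n}. wtI n (e, S) i = \<mu> i)"
    proof
      assume a: "\<forall>i\<in>{1..n}. wtI n (e, S) i = \<mu> i"
      show "wtI n (e, S) = \<mu>"
      proof
        fix i show "wtI n (e, S) i = \<mu> i"
          using a \<mu>[of i] by (cases "i \<in> {1..n}") (blast, simp add: wtI_def)
      qed
    qed simp
    also have "\<dots> \<longleftrightarrow> (\<forall>i\<in>{1..n}. int (e i) - int (e (i + n)) = \<mu> i - of_bool (i \<in> S) + of_bool (i + n \<in> S))"
      by (intro ball_cong refl) (auto simp: wtI_def)
    finally show ?thesis by (auto simp: widx_def gidx_def expo_def)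
  qed
  have "widx n a (int b) \<mu> = (\<lambda>q. (snd q, fst q)) ` Sigma ?A ?E"
  proof (rule set_eqI)
    fix I :: idx
    obtain e S where I: "I = (e, S)" by (cases I)
    show "I \<in> widx n a (int b) \<mu> \<longleftrightarrow> I \<in> (\<lambda>q. (snd q, fst q)) ` Sigma ?A ?E"
      unfolding I eq by (auto simp: image_iff)
  qed
  then have c: "card (widx n a (int b) \<mu>) = card (Sigma ?A ?E)"
    by (simp only:) (rule card_image, auto simp: inj_on_def)
  have fA: "finite ?A" by (rule finite_subset[of _ "Pow (ix n)"]) auto
  have "finite (?E S)" if "S \<in> ?A" for S
  proof -
    have "?E S \<subseteq> fst ` widx n a (int b) \<mu>"
    proof
      fix e assume "e \<in> ?E S"
      then have "(e, S) \<in> widx n a (int b) \<mu>" using eq that by blast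
      then show "e \<in> fst ` widx n a (int b) \<mu>" by force
    qed
    then show ?thesis by (rule finite_subset) simp
  qed
  then have "card (Sigma ?A ?E) = (\<Sum>S\<in>?A. card (?E S))" using fA by (intro card_SigmaI) auto
  then show ?thesis unfolding cnt_def c by simp
qed

text \<open>A subset S of the odd generators is encoded by the set A of positions at which exactly one of
  the two weights is taken, the subset D of A where its sign agrees with that of \<open>\<mu>\<close>, and
  the set B of positions at which both are taken.\<close>

lemma cnt_triples:
  assumes n: "n > 0" and \<mu>: "\<And>i. i \<notin> {1..n} \<Longrightarrow> \<mu> i = 0"
    and a: "a = (\<Sum>i=1..n. \<bar>\<mu> i\<bar>) + int b + 2 * x"
  shows "cnt n a (int b) \<mu> = (\<Sum>A\<in>Pow {1..n}. \<Sum>D\<in>Pow A. \<Sum>B\<in>Pow ({1..n} - A).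
     if card A + 2 * card B = b
     then binom (x + int (card B) + int (card (D \<inter> {i. \<mu> i \<noteq> 0})) + int n - 1) (int n - 1) else 0)"
proof -
  define P where "P = {1..n}"
  define Y where "Y = {i. \<mu> i \<noteq> 0}"
  \<comment> \<open>Of the two differentials at position i, u selects the one whose weight has the
    sign of \<mu>(i), and v the other; a vanishing \<mu>(i) is treated as positive.\<close>
  define u where "u = (\<lambda>i. if \<mu> i \<ge> 0 then i else i + n)"
  define v where "v = (\<lambda>i. if \<mu> i \<ge> 0 then i + n else i)"
  define bn where "bn = (\<lambda>y. binom (y + int n - 1) (int n - 1))"
  define toS where "toS = (\<lambda>(A, D, B). u ` (D \<union> B) \<union> v ` ((A - D) \<union> B))"
  define frS where "frS = (\<lambda>S. ({i \<in> P. (u i \<in> S) \<noteq> (v i \<in> S)}, {i \<in> P. u i \<in> S \<and> v i \<notin> S}, {i \<in> P. u i \<in> S \<and> v i \<in> S}))"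
  let ?Q = "{(A, D, B). A \<subseteq> P \<and> D \<subseteq> A \<and> B \<subseteq> P - A \<and> card A + 2 * card B = b}"
  have inj: "i = j" if "i \<in> P" "j \<in> P" "u i = u j \<or> v i = v j" for i j
    using that by (auto simp: u_def v_def P_def split: if_splits)
  have uv: "u i \<noteq> v j" if "i \<in> P" "j \<in> P" for i j
    using that n by (auto simp: u_def v_def P_def split: if_splits)
  have ixP: "\<exists>i\<in>P. s = u i \<or> s = v i" if "s \<in> ix n" for s
  proof (cases "s \<le> n")
    case True
    then show ?thesis using that by (intro bexI[of _ s]) (auto simp: ix_def P_def u_def v_def)
  next
    case False
    then show ?thesis using that by (intro bexI[of _ "s - n"]) (auto simp: ix_def P_def u_def v_def)
  qed
  have uix: "u i \<in> ix n" "v i \<in> ix n" if "i \<in> P" for i using that by (auto simp: u_def v_def ix_def P_def)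
  have injU: "inj_on u Q" "inj_on v Q" if "Q \<subseteq> P" for Q
    using inj that by (auto simp: inj_on_def subset_iff)
  have memu: "u i \<in> toS (A, D, B) \<longleftrightarrow> i \<in> D \<union> B" and memv: "v i \<in> toS (A, D, B) \<longleftrightarrow> i \<in> (A - D) \<union> B"
    if "i \<in> P" "A \<subseteq> P" "D \<subseteq> A" "B \<subseteq> P - A" for i A D B
  proof -
    have sub: "D \<union> B \<subseteq> P" "(A - D) \<union> B \<subseteq> P" using that by auto
    have "u i \<in> u ` (D \<union> B) \<longleftrightarrow> i \<in> D \<union> B" "v i \<in> v ` ((A - D) \<union> B) \<longleftrightarrow> i \<in> (A - D) \<union> B"
      using inj_on_image_mem_iff[OF injU(1)[OF order_refl] that(1) sub(1)]
        inj_on_image_mem_iff[OF injU(2)[OF order_refl] that(1) sub(2)] by blast+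
    moreover have "u i \<notin> v ` ((A - D) \<union> B)" "v i \<notin> u ` (D \<union> B)"
      using uv[OF that(1)] uv[OF _ that(1)] sub by (metis imageE subsetD)+
    ultimately show "u i \<in> toS (A, D, B) \<longleftrightarrow> i \<in> D \<union> B" "v i \<in> toS (A, D, B) \<longleftrightarrow> i \<in> (A - D) \<union> B"
      unfolding toS_def by (simp_all only: prod.case Un_iff[of _ "u ` _"] simp_thms)
  qed
  have card_toS: "card (toS (A, D, B)) = card A + 2 * card B" if "A \<subseteq> P" "D \<subseteq> A" "B \<subseteq> P - A" for A D B
  proof -
    have sub: "D \<union> B \<subseteq> P" "(A - D) \<union> B \<subseteq> P" using that by auto
    have fin: "finite A" "finite D" "finite B"
      using that finite_subset[of _ P] by (auto simp: P_def intro: finite_subset)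
    have "u ` (D \<union> B) \<inter> v ` ((A - D) \<union> B) = {}" using uv sub by (auto simp: subset_iff)
    then have "card (toS (A, D, B)) = card (D \<union> B) + card ((A - D) \<union> B)"
      unfolding toS_def using fin injU[OF sub(1)] injU[OF sub(2)]
      by (simp add: card_Un_disjoint card_image)
    moreover have "card (D \<union> B) = card D + card B" "card ((A - D) \<union> B) = card (A - D) + card B"
      using that fin by (auto intro!: card_Un_disjoint)
    moreover have "card D + card (A - D) = card A"
      using fin that by (simp add: card_Diff_subset card_mono)
    ultimately show ?thesis by simp
  qed
  have toS_frS: "toS (frS S) = S" if sub: "S \<subseteq> ix n" for S
  proof
    show "toS (frS S) \<subseteq> S" unfolding toS_def frS_def by auto
    show "S \<subseteq> toS (frS S)"
    proof
      fix s assume s: "s \<in> S"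
      then obtain i where i: "i \<in> P" "s = u i \<or> s = v i" using ixP sub s by blast
      then show "s \<in> toS (frS S)" using s unfolding toS_def frS_def by auto
    qed
  qed
  have frS_toS: "frS (toS (A, D, B)) = (A, D, B)" if "A \<subseteq> P" "D \<subseteq> A" "B \<subseteq> P - A" for A D B
    unfolding frS_def using memu[OF _ that] memv[OF _ that] that by (auto simp: subset_iff)
  have frS_sub: "fst (frS S) \<subseteq> P" "fst (snd (frS S)) \<subseteq> fst (frS S)" "snd (snd (frS S)) \<subseteq> P - fst (frS S)" for S
    by (auto simp: frS_def)
  have toS_ix: "toS (A, D, B) \<subseteq> ix n" if "A \<subseteq> P" "D \<subseteq> A" "B \<subseteq> P - A" for A D B
    using that uix unfolding toS_def by (auto simp: subset_iff)
  have val: "int (card (expo n a (\<lambda>i. \<mu> i - of_bool (i \<in> toS (A, D, B)) + of_bool (i + n \<in> toS (A, D, B)))))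
     = bn (x + int (card B) + int (card (D \<inter> Y)))" if q: "A \<subseteq> P" "D \<subseteq> A" "B \<subseteq> P - A" and b: "card A + 2 * card B = b" for A D B
    unfolding bn_def
  proof (rule card_expo[OF n])
    let ?S = "toS (A, D, B)"
    \<comment> \<open>The weight left to the polynomial part is shorter by 1 at positions of D where
      \<mu> is nonzero and longer by 1 at the other positions of A; at positions of B the two
      differentials cancel.\<close>
    have "(\<Sum>i=1..n. \<bar>\<mu> i - of_bool (i \<in> ?S) + of_bool (i + n \<in> ?S)\<bar>)
        = (\<Sum>i\<in>P. \<bar>\<mu> i\<bar> + of_bool (i \<in> A) - 2 * of_bool (i \<in> D \<inter> Y))"
      unfolding P_def[symmetric]
    proof (rule sum.cong[OF refl])
      fix i assume i: "i \<in> P"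
      show "\<bar>\<mu> i - of_bool (i \<in> ?S) + of_bool (i + n \<in> ?S)\<bar> = \<bar>\<mu> i\<bar> + of_bool (i \<in> A) - 2 * of_bool (i \<in> D \<inter> Y)"
      proof (cases "\<mu> i \<ge> 0")
        case True
        then have "i \<in> ?S \<longleftrightarrow> i \<in> D \<union> B" "i + n \<in> ?S \<longleftrightarrow> i \<in> (A - D) \<union> B"
          using memu[OF i q] memv[OF i q] by (simp_all add: u_def v_def)
        then show ?thesis using True q i by (auto simp: Y_def)
      next
        case False
        then have "i + n \<in> ?S \<longleftrightarrow> i \<in> D \<union> B" "i \<in> ?S \<longleftrightarrow> i \<in> (A - D) \<union> B"
          using memu[OF i q] memv[OF i q] by (simp_all add: u_def v_def)
        then show ?thesis using False q i by (auto simp: Y_def)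
      qed
    qed
    also have "\<dots> = (\<Sum>i\<in>P. \<bar>\<mu> i\<bar>) + int (card A) - 2 * int (card (D \<inter> Y))"
    proof -
      have "(\<Sum>i\<in>P. of_bool (i \<in> C) :: int) = int (card C)" if "C \<subseteq> P" for C
        using that by (simp add: of_bool_def sum.If_cases Int_absorb1 P_def)
      from this[of A] this[of "D \<inter> Y"] show ?thesis
        using q by (auto simp: sum.distrib sum_subtractf simp flip: sum_distrib_left)
    qed
    finally show "a = (\<Sum>i=1..n. \<bar>\<mu> i - of_bool (i \<in> ?S) + of_bool (i + n \<in> ?S)\<bar>)
       + 2 * (x + int (card B) + int (card (D \<inter> Y)))"
      using a b by (simp add: P_def)
  qed
  have finP: "finite P" by (simp add: P_def)
  have "cnt n a (int b) \<mu> = (\<Sum>S | S \<subseteq> ix n \<and> card S = b.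
      int (card (expo n a (\<lambda>i. \<mu> i - of_bool (i \<in> S) + of_bool (i + n \<in> S)))))"
    by (rule cnt_sum_expo[OF \<mu>])
  also have "\<dots> = (\<Sum>(A, D, B)\<in>?Q. bn (x + int (card B) + int (card (D \<inter> Y))))"
  proof (rule sum.reindex_bij_witness[of _ toS frS])
    fix S assume S: "S \<in> {S. S \<subseteq> ix n \<and> card S = b}"
    obtain A D B where f: "frS S = (A, D, B)" by (metis prod_cases3)
    have sub: "A \<subseteq> P" "D \<subseteq> A" "B \<subseteq> P - A" using frS_sub[of S] by (simp_all add: f)
    have tS: "toS (A, D, B) = S" using toS_frS[of S] S f by simp
    have cS: "card A + 2 * card B = b" using card_toS[OF sub] tS S by simp
    show "toS (frS S) = S" using toS_frS S by blast
    show "frS S \<in> ?Q" using sub cS by (simp add: f)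
    show "(case frS S of (A, D, B) \<Rightarrow> bn (x + int (card B) + int (card (D \<inter> Y))))
       = int (card (expo n a (\<lambda>i. \<mu> i - of_bool (i \<in> S) + of_bool (i + n \<in> S))))"
      using val[OF sub cS] tS by (simp add: f)
  next
    fix q assume "q \<in> ?Q"
    then obtain A D B where q: "q = (A, D, B)" "A \<subseteq> P" "D \<subseteq> A" "B \<subseteq> P - A" "card A + 2 * card B = b" by auto
    show "frS (toS q) = q" unfolding q(1) by (rule frS_toS[OF q(2-4)])
    show "toS q \<in> {S. S \<subseteq> ix n \<and> card S = b}" unfolding q(1) using toS_ix[OF q(2-4)] card_toS[OF q(2-4)] q(5) by simp
  qed
  also have "\<dots> = (\<Sum>q\<in>Sigma (Pow P) (\<lambda>A. Sigma (Pow A) (\<lambda>D. {B \<in> Pow (P - A). card A + 2 * card B = b})).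
      bn (x + int (card (snd (snd q))) + int (card (fst (snd q) \<inter> Y))))"
    by (rule sum.cong) auto
  also have "\<dots> = (\<Sum>A\<in>Pow P. \<Sum>D\<in>Pow A. \<Sum>B | B \<in> Pow (P - A) \<and> card A + 2 * card B = b.
      bn (x + int (card B) + int (card (D \<inter> Y))))" (is "_ = (\<Sum>A\<in>Pow P. \<Sum>D\<in>Pow A. sum (?h D) (?F A))")
  proof -
    have fA: "finite A" if "A \<in> Pow P" for A using that finP finite_subset by auto
    have fF: "finite (?F A)" for A using finP by simp
    have "(\<Sum>A\<in>Pow P. \<Sum>D\<in>Pow A. sum (?h D) (?F A))
        = (\<Sum>A\<in>Pow P. \<Sum>q\<in>Sigma (Pow A) (\<lambda>D. ?F A). ?h (fst q) (snd q))"
    proof (rule sum.cong[OF refl])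
      fix A assume "A \<in> Pow P"
      then show "(\<Sum>D\<in>Pow A. sum (?h D) (?F A)) = (\<Sum>q\<in>Sigma (Pow A) (\<lambda>D. ?F A). ?h (fst q) (snd q))"
        using sum.Sigma[of "Pow A" "\<lambda>D. ?F A" ?h] fA fF by (simp add: case_prod_beta)
    qed
    also have "\<dots> = (\<Sum>q\<in>Sigma (Pow P) (\<lambda>A. Sigma (Pow A) (\<lambda>D. ?F A)). ?h (fst (snd q)) (snd (snd q)))"
      using sum.Sigma[of "Pow P" "\<lambda>A. Sigma (Pow A) (\<lambda>D. ?F A)" "\<lambda>A q. ?h (fst q) (snd q)"] fA fF finP
      by (simp add: case_prod_beta)
    finally show ?thesis by simp
  qed
  also have "\<dots> = (\<Sum>A\<in>Pow P. \<Sum>D\<in>Pow A. \<Sum>B\<in>Pow (P - A).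
     if card A + 2 * card B = b then bn (x + int (card B) + int (card (D \<inter> Y))) else 0)"
    using finP by (intro sum.cong refl sum.inter_filter) auto
  finally show ?thesis unfolding P_def Y_def bn_def .
qed

lemma binom_int: "binom (int m) (int k) = int (m choose k)"
  by (simp add: binom_def binomial_eq_0)

text \<open>Pascal's rule for y \<ge> 0; for negative y the convention makes all three terms
  0.\<close>

lemma binom_pascal:
  assumes "2 \<le> n"
  shows "binom (y + int n - 1) (int n - 1) - binom (y - 1 + int n - 1) (int n - 1) = binom (y + int n - 2) (int n - 2)"
proof (cases "y < 0")
  case True
  then show ?thesis by (simp add: binom_def)
next
  case False
  then obtain m where m: "y = int m" by (intro that[of "nat y"]) simp
  obtain q where q: "n = Suc (Suc q)" using assms by (intro that[of "n - 2"]) simp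
  have e: "y + int n - 1 = int (Suc (m + q))" "int n - 1 = int (Suc q)" "y - 1 + int n - 1 = int (m + q)"
    "y + int n - 2 = int (m + q)" "int n - 2 = int q"
    using m q by auto
  show ?thesis unfolding e binom_int by simp
qed

text \<open>The counts for Sym^(k+j) and Sym^(k-j) differ by a shift of j in the upper argument;
  this is the origin of the innermost sum in \<open>mult_formula\<close>.\<close>

lemma binom_telescope:
  assumes "2 \<le> n" "1 \<le> j"
  shows "(\<Sum>i=0..j-1. binom (y - int i + int n - 2) (int n - 2))
    = binom (y + int n - 1) (int n - 1) - binom (y - int j + int n - 1) (int n - 1)"
  using assms(2)
proof (induction j rule: dec_induct)
  case base
  then show ?case using binom_pascal[OF assms(1), of y] by simp
next
  case (step j)
  have "{0..Suc j - 1} = insert j {0..j - 1}" "j \<notin> {0..j - 1}" using step.hyps by auto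
  then have "(\<Sum>i=0..Suc j - 1. binom (y - int i + int n - 2) (int n - 2))
     = binom (y - int j + int n - 2) (int n - 2) + (\<Sum>i=0..j-1. binom (y - int i + int n - 2) (int n - 2))"
    by simp
  then show ?case
    using step.IH binom_pascal[OF assms(1), of "y - int j"] by (simp add: algebra_simps)
qed

text \<open>Here \<beta> and b - 2t - \<beta> are the numbers of positions of A where \<mu> is
  nonzero and zero, t is the size of B, chosen among the n - b + 2t positions outside A, and
  \<alpha> counts the positions of D where \<mu> is nonzero. The power of 2 counts the free choices
  of sign where \<mu> vanishes.\<close>

lemma cnt_formula:
  assumes n: "n > 0" and b: "b \<le> n" and \<mu>: "\<And>i. i \<notin> {1..n} \<Longrightarrow> \<mu> i = 0"
    and a: "a = (\<Sum>i=1..n. \<bar>\<mu> i\<bar>) + int b + 2 * x" and Z: "Z = card {i \<in> {1..n}. \<mu> i = 0}"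
  shows "cnt n a (int b) \<mu> = (\<Sum>t=0..b div 2. binom (int (n - b + 2 * t)) (int t) *
     (\<Sum>\<beta>=0..b - 2 * t. 2 ^ (b - 2 * t - \<beta>) * binom (int n - int Z) (int \<beta>) * binom (int Z) (int (b - 2 * t - \<beta>)) *
       (\<Sum>\<alpha>=0..\<beta>. binom (int \<beta>) (int \<alpha>) * binom (x + int t + int \<alpha> + int n - 1) (int n - 1))))"
proof -
  define P where "P = {1..n}"
  define Y where "Y = {i \<in> P. \<mu> i \<noteq> 0}"
  define W where "W = {i \<in> P. \<mu> i = 0}"
  define bn where "bn = (\<lambda>y. binom (y + int n - 1) (int n - 1))"
  define K where "K = (\<lambda>\<beta> \<gamma>. \<Sum>\<alpha>=0..\<beta>. int (\<beta> choose \<alpha>) * (2 ^ \<gamma> * (\<Sum>t=0..n. int ((n - (\<beta> + \<gamma>)) choose t) *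
     (if \<beta> + \<gamma> + 2 * t = b then bn (x + int t + int \<alpha>) else 0))))"
  define f where "f = (\<lambda>t \<beta> \<gamma>. int (card Y choose \<beta>) * int (card W choose \<gamma>) * (2 ^ \<gamma> * int ((n - (\<beta> + \<gamma>)) choose t) *
     (\<Sum>\<alpha>=0..\<beta>. int (\<beta> choose \<alpha>) * bn (x + int t + int \<alpha>))))"
  have finP: "finite P" "card P = n" by (auto simp: P_def)
  have YW: "finite Y" "finite W" "Y \<inter> W = {}" "Y \<union> W = P" by (auto simp: Y_def W_def P_def)
  have cYW: "card Y + card W = n" using card_Un_disjoint[OF YW(1-3)] YW(4) finP by simp
  have WZ: "card W = Z" by (simp add: W_def Z P_def)
  have inner: "(\<Sum>D\<in>Pow A. \<Sum>B\<in>Pow (P - A). if card A + 2 * card B = b then bn (x + int (card B) + int (card (D \<inter> {i. \<mu> i \<noteq> 0}))) else 0)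
     = K (card (A \<inter> Y)) (card (A \<inter> W))" if A: "A \<in> Pow P" for A
  proof -
    have fA: "finite A" using A finP finite_subset by auto
    have cA: "card A = card (A \<inter> Y) + card (A \<inter> W)"
      using card_Un_disjoint[of "A \<inter> Y" "A \<inter> W"] YW A by (simp add: Int_Un_distrib[symmetric] Int_absorb2 disjoint_iff)
    define F where "F = (\<lambda>\<alpha>. \<Sum>t=0..n. int ((n - card A) choose t) * (if card A + 2 * t = b then bn (x + int t + int \<alpha>) else 0))"
    have "(\<Sum>B\<in>Pow (P - A). if card A + 2 * card B = b then bn (x + int (card B) + int (card (D \<inter> {i. \<mu> i \<noteq> 0}))) else 0)
        = F (card (D \<inter> (A \<inter> Y)))" if D: "D \<in> Pow A" for D
    proof -
      have e1: "D \<inter> {i. \<mu> i \<noteq> 0} = D \<inter> (A \<inter> Y)" using D A by (auto simp: Y_def)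
      have e2: "card (P - A) = n - card A" using A fA finP by (simp add: card_Diff_subset)
      show ?thesis
        unfolding F_def e1 e2[symmetric]
        by (rule sum_Pow_card[of "P - A" n "\<lambda>t. if card A + 2 * t = b then bn (x + int t + int (card (D \<inter> (A \<inter> Y)))) else 0"])
          (use finP e2 in auto)
    qed
    then have "(\<Sum>D\<in>Pow A. \<Sum>B\<in>Pow (P - A). if card A + 2 * card B = b then bn (x + int (card B) + int (card (D \<inter> {i. \<mu> i \<noteq> 0}))) else 0)
       = (\<Sum>D\<in>Pow A. F (card (D \<inter> (A \<inter> Y))))" by (rule sum.cong[OF refl])
    also have "(\<Sum>D\<in>Pow A. F (card (D \<inter> (A \<inter> Y))))
       = (\<Sum>D\<in>Pow ((A \<inter> Y) \<union> (A \<inter> W)). F (card (D \<inter> (A \<inter> Y))))"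
      using A YW(4) by (simp add: Int_Un_distrib[symmetric] Int_absorb2)
    also have "\<dots> = (\<Sum>\<alpha>=0..card (A \<inter> Y). \<Sum>\<gamma>=0..card (A \<inter> W). int (card (A \<inter> Y) choose \<alpha>) * int (card (A \<inter> W) choose \<gamma>) * F \<alpha>)"
      using fA YW(3) by (intro sum_Pow_Un) auto
    also have "\<dots> = (\<Sum>\<alpha>=0..card (A \<inter> Y). int (card (A \<inter> Y) choose \<alpha>) * (2 ^ card (A \<inter> W) * F \<alpha>))"
    proof (rule sum.cong[OF refl])
      fix \<alpha>
      have "(\<Sum>\<gamma>=0..card (A \<inter> W). int (card (A \<inter> W) choose \<gamma>)) = 2 ^ card (A \<inter> W)"
        using choose_row_sum[of "card (A \<inter> W)"] by (simp add: atLeast0AtMost flip: of_nat_sum)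
      then show "(\<Sum>\<gamma>=0..card (A \<inter> W). int (card (A \<inter> Y) choose \<alpha>) * int (card (A \<inter> W) choose \<gamma>) * F \<alpha>)
         = int (card (A \<inter> Y) choose \<alpha>) * (2 ^ card (A \<inter> W) * F \<alpha>)"
        by (simp add: sum_distrib_left[symmetric] sum_distrib_right[symmetric] mult.assoc)
    qed
    finally show ?thesis unfolding K_def F_def cA .
  qed
  have "cnt n a (int b) \<mu> = (\<Sum>A\<in>Pow P. \<Sum>D\<in>Pow A. \<Sum>B\<in>Pow (P - A).
      if card A + 2 * card B = b then bn (x + int (card B) + int (card (D \<inter> {i. \<mu> i \<noteq> 0}))) else 0)"
    unfolding P_def bn_def by (rule cnt_triples[OF n \<mu> a])
  also have "\<dots> = (\<Sum>A\<in>Pow P. K (card (A \<inter> Y)) (card (A \<inter> W)))"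
    by (rule sum.cong[OF refl inner])
  also have "\<dots> = (\<Sum>\<beta>=0..n. \<Sum>\<gamma>=0..n. int (card Y choose \<beta>) * int (card W choose \<gamma>) * K \<beta> \<gamma>)"
    unfolding YW(4)[symmetric] using YW cYW by (intro sum_Pow_Un) auto
  also have "\<dots> = (\<Sum>\<beta>=0..n. \<Sum>\<gamma>=0..n. \<Sum>t=0..n. if \<beta> + \<gamma> + 2 * t = b then f t \<beta> \<gamma> else 0)"
  proof (intro sum.cong refl)
    fix \<beta> \<gamma>
    have "K \<beta> \<gamma> = (\<Sum>t=0..n. \<Sum>\<alpha>=0..\<beta>. int (\<beta> choose \<alpha>) * (2 ^ \<gamma> * (int ((n - (\<beta> + \<gamma>)) choose t) *
       (if \<beta> + \<gamma> + 2 * t = b then bn (x + int t + int \<alpha>) else 0))))"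
      unfolding K_def sum_distrib_left by (rule sum.swap)
    also have "\<dots> = (\<Sum>t=0..n. if \<beta> + \<gamma> + 2 * t = b then (2 ^ \<gamma> * int ((n - (\<beta> + \<gamma>)) choose t) *
        (\<Sum>\<alpha>=0..\<beta>. int (\<beta> choose \<alpha>) * bn (x + int t + int \<alpha>))) else 0)"
      by (intro sum.cong refl) (simp add: sum_distrib_left algebra_simps)
    finally show "int (card Y choose \<beta>) * int (card W choose \<gamma>) * K \<beta> \<gamma>
       = (\<Sum>t=0..n. if \<beta> + \<gamma> + 2 * t = b then f t \<beta> \<gamma> else 0)"
      by (simp add: f_def sum_distrib_left if_distrib cong: if_cong)
  qed
  also have "\<dots> = (\<Sum>\<beta>=0..n. \<Sum>t=0..n. \<Sum>\<gamma>=0..n. if \<beta> + \<gamma> + 2 * t = b then f t \<beta> \<gamma> else 0)"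
    by (intro sum.cong refl sum.swap)
  also have "\<dots> = (\<Sum>t=0..n. \<Sum>\<beta>=0..n. \<Sum>\<gamma>=0..n. if \<beta> + \<gamma> + 2 * t = b then f t \<beta> \<gamma> else 0)"
    by (rule sum.swap)
  also have "\<dots> = (\<Sum>t=0..n. if 2 * t \<le> b then (\<Sum>\<beta>=0..b - 2 * t. f t \<beta> (b - 2 * t - \<beta>)) else 0)"
  proof (rule sum.cong[OF refl])
    fix t
    \<comment> \<open>For given t and \<beta> the size condition leaves a single \<gamma>; it lies
      within 0..n because b \<le> n.\<close>
    have "(\<Sum>\<gamma>=0..n. if \<beta> + \<gamma> + 2 * t = b then f t \<beta> \<gamma> else 0)
        = (if 2 * t \<le> b \<and> \<beta> \<le> b - 2 * t then f t \<beta> (b - 2 * t - \<beta>) else 0)" for \<beta>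
    proof -
      have "(\<Sum>\<gamma>=0..n. if \<beta> + \<gamma> + 2 * t = b then f t \<beta> \<gamma> else 0)
        = (\<Sum>\<gamma>=0..n. if \<gamma> = b - 2 * t - \<beta> then (if 2 * t \<le> b \<and> \<beta> \<le> b - 2 * t then f t \<beta> (b - 2 * t - \<beta>) else 0) else 0)"
        by (intro sum.cong refl) auto
      then show ?thesis by (simp add: order_trans[OF diff_le_self b])
    qed
    then have "(\<Sum>\<beta>=0..n. \<Sum>\<gamma>=0..n. if \<beta> + \<gamma> + 2 * t = b then f t \<beta> \<gamma> else 0)
       = (\<Sum>\<beta>=0..n. if 2 * t \<le> b \<and> \<beta> \<le> b - 2 * t then f t \<beta> (b - 2 * t - \<beta>) else 0)" by simp
    also have "\<dots> = (if 2 * t \<le> b then (\<Sum>\<beta>=0..b - 2 * t. f t \<beta> (b - 2 * t - \<beta>)) else 0)"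
    proof (cases "2 * t \<le> b")
      case True
      have "{0..n} \<inter> {\<beta>. \<beta> \<le> b - 2 * t} = {0..b - 2 * t}" using b by auto
      then show ?thesis using True by (simp add: sum.If_cases)
    qed simp
    finally show "(\<Sum>\<beta>=0..n. \<Sum>\<gamma>=0..n. if \<beta> + \<gamma> + 2 * t = b then f t \<beta> \<gamma> else 0)
       = (if 2 * t \<le> b then (\<Sum>\<beta>=0..b - 2 * t. f t \<beta> (b - 2 * t - \<beta>)) else 0)" .
  qed
  also have "\<dots> = (\<Sum>t=0..b div 2. \<Sum>\<beta>=0..b - 2 * t. f t \<beta> (b - 2 * t - \<beta>))"
  proof -
    have "{0..n} \<inter> {t. 2 * t \<le> b} = {0..b div 2}" using b by auto
    then show ?thesis by (simp add: sum.If_cases)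
  qed
  also have "\<dots> = (\<Sum>t=0..b div 2. binom (int (n - b + 2 * t)) (int t) *
     (\<Sum>\<beta>=0..b - 2 * t. 2 ^ (b - 2 * t - \<beta>) * binom (int n - int Z) (int \<beta>) * binom (int Z) (int (b - 2 * t - \<beta>)) *
       (\<Sum>\<alpha>=0..\<beta>. binom (int \<beta>) (int \<alpha>) * bn (x + int t + int \<alpha>))))"
    unfolding sum_distrib_left[of "binom _ _" _ "{0.._}"]
  proof (intro sum.cong[OF refl])
    fix t \<beta> assume t: "t \<in> {0..b div 2}" and \<beta>: "\<beta> \<in> {0..b - 2 * t}"
    have e: "n - (\<beta> + (b - 2 * t - \<beta>)) = n - b + 2 * t" "int n - int Z = int (card Y)"
      using t \<beta> b cYW WZ by auto
    show "f t \<beta> (b - 2 * t - \<beta>) = binom (int (n - b + 2 * t)) (int t) *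
      (2 ^ (b - 2 * t - \<beta>) * binom (int n - int Z) (int \<beta>) * binom (int Z) (int (b - 2 * t - \<beta>)) *
       (\<Sum>\<alpha>=0..\<beta>. binom (int \<beta>) (int \<alpha>) * bn (x + int t + int \<alpha>)))"
      unfolding f_def e binom_int WZ by (simp only: mult.assoc mult.left_commute mult.commute)
  qed
  finally show ?thesis unfolding bn_def .
qed

text \<open>For Sym^(k+j) tensor Lambda^(p-j) the parameter x of \<open>cnt_formula\<close> is r - p
  + j, and for Sym^(k-j) tensor Lambda^(p-j) it is r - p; the difference of the two counts
  telescopes.\<close>

lemma character_formula:
  assumes n: "2 \<le> n" "1 \<le> p" "p \<le> n" and \<mu>: "\<And>i. i \<notin> {1..n} \<Longrightarrow> \<mu> i = 0"
    and r: "int k + int p - (\<Sum>i=1..n. \<bar>\<mu> i\<bar>) = 2 * r" and Z: "Z = card {i \<in> {1..n}. \<mu> i = 0}"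
  shows "(\<Sum>j=1..p. (-1) ^ (j - 1) * (cnt n (int k + int j) (int p - int j) \<mu> - cnt n (int k - int j) (int p - int j) \<mu>))
    = mult_formula n p r Z"
  unfolding mult_formula_def
proof (rule sum.cong[OF refl])
  fix j assume j: "j \<in> {1..p}"
  have pj: "int p - int j = int (p - j)" using j by auto
  have e: "n - p + j + 2 * t = n - (p - j) + 2 * t" for t using j n by auto
  have c1: "cnt n (int k + int j) (int (p - j)) \<mu> = (\<Sum>t=0..(p - j) div 2. binom (int (n - (p - j) + 2 * t)) (int t) *
     (\<Sum>\<beta>=0..p - j - 2 * t. 2 ^ (p - j - 2 * t - \<beta>) * binom (int n - int Z) (int \<beta>) * binom (int Z) (int (p - j - 2 * t - \<beta>)) *
       (\<Sum>\<alpha>=0..\<beta>. binom (int \<beta>) (int \<alpha>) * binom ((r - int p + int j) + int t + int \<alpha> + int n - 1) (int n - 1))))"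
    using n r j by (intro cnt_formula[OF _ _ \<mu> _ Z]) auto
  have c2: "cnt n (int k - int j) (int (p - j)) \<mu> = (\<Sum>t=0..(p - j) div 2. binom (int (n - (p - j) + 2 * t)) (int t) *
     (\<Sum>\<beta>=0..p - j - 2 * t. 2 ^ (p - j - 2 * t - \<beta>) * binom (int n - int Z) (int \<beta>) * binom (int Z) (int (p - j - 2 * t - \<beta>)) *
       (\<Sum>\<alpha>=0..\<beta>. binom (int \<beta>) (int \<alpha>) * binom ((r - int p) + int t + int \<alpha> + int n - 1) (int n - 1))))"
    using n r j by (intro cnt_formula[OF _ _ \<mu> _ Z]) auto
  have tel: "binom ((r - int p + int j) + int t + int \<alpha> + int n - 1) (int n - 1) - binom ((r - int p) + int t + int \<alpha> + int n - 1) (int n - 1)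
     = (\<Sum>i=0..j-1. binom (r - int i - int p + int \<alpha> + int t + int j + int n - 2) (int n - 2))" for t \<alpha>
    using binom_telescope[OF n(1), of j "r - int p + int j + int t + int \<alpha>"] j by (simp add: algebra_simps)
  show "(-1) ^ (j - 1) * (cnt n (int k + int j) (int p - int j) \<mu> - cnt n (int k - int j) (int p - int j) \<mu>) =
    (-1) ^ (j - 1) * (\<Sum>t=0..(p-j) div 2. binom (int (n-p+j+2*t)) (int t) *
        (\<Sum>\<beta>=0..p-j-2*t. 2^(p-j-2*t-\<beta>) * binom (int n - int Z) (int \<beta>) * binom (int Z) (int (p-j-2*t-\<beta>)) *
          (\<Sum>\<alpha>=0..\<beta>. binom (int \<beta>) (int \<alpha>) *
            (\<Sum>i=0..j-1. binom (r - int i - int p + int \<alpha> + int t + int j + int n - 2) (int n - 2)))))"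
    unfolding pj c1 c2 e tel[symmetric] by (simp only: sum_subtractf[symmetric] right_diff_distrib[symmetric])
qed

section \<open>Multiplicities\<close>

text \<open>At each position the total degree is the absolute value of the difference of the two
  occupation numbers plus twice their minimum, and the total over all positions is k + p.\<close>

lemma widx_parity:
  assumes "widx n (int k) (int p) \<mu> \<noteq> {}"
  shows "\<exists>r::nat. int k + int p - (\<Sum>i=1..n. \<bar>\<mu> i\<bar>) = 2 * int r"
proof -
  obtain e S where I: "(e, S) \<in> widx n (int k) (int p) \<mu>" using assms by auto
  then have g: "(e, S) \<in> gidx n (int k) (int p)" and w: "wtI n (e, S) = \<mu>" by (auto simp: widx_def)
  define q where "q = (\<lambda>i. min (e i + of_bool (i \<in> S)) (e (i + n) + of_bool (i + n \<in> S)))"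
  have t: "int (e i + e (i + n)) + (of_bool (i \<in> S) + of_bool (i + n \<in> S)) - \<bar>\<mu> i\<bar> = 2 * int (q i)" if "i \<in> {1..n}" for i
  proof -
    have "\<mu> i = int (e i + of_bool (i \<in> S)) - int (e (i + n) + of_bool (i + n \<in> S))"
      unfolding w[symmetric] using that by (simp add: wtI_def)
    then show ?thesis by (simp add: q_def min_def)
  qed
  have "int k = (\<Sum>i=1..n. int (e i + e (i + n)))"
    using g by (simp add: gidx_def sum_ix sum.distrib)
  moreover have "int p = (\<Sum>i=1..n. of_bool (i \<in> S) + of_bool (i + n \<in> S))"
  proof -
    have "int p = (\<Sum>a\<in>ix n. of_bool (a \<in> S))"
      using g by (simp add: gidx_def of_bool_def sum.If_cases Int_absorb1)
    then show ?thesis by (simp only: sum_ix)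
  qed
  ultimately have "int k + int p - (\<Sum>i=1..n. \<bar>\<mu> i\<bar>)
     = (\<Sum>i=1..n. int (e i + e (i + n)) + (of_bool (i \<in> S) + of_bool (i + n \<in> S)) - \<bar>\<mu> i\<bar>)"
    by (simp only: sum.distrib sum_subtractf)
  also have "\<dots> = (\<Sum>i=1..n. 2 * int (q i))" by (rule sum.cong[OF refl t])
  also have "\<dots> = 2 * int (\<Sum>i=1..n. q i)" by (simp add: sum_distrib_left)
  finally show ?thesis by blast
qed

lemma Mf_inter: "MG n k p \<inter> sp n k p \<mu> = Mf n k p \<mu>"
  by (auto simp: MG_def Mf_def intro: sp_gr)

text \<open>The range of the embedding contains the only top monomial available for p < n, so
  \<open>top_vector\<close> with this range as U shows that the embedding is onto M(k,p).\<close>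

lemma mult_irreducible:
  fixes sc :: "complex \<Rightarrow> 'v::ab_group_add \<Rightarrow> 'v"
  assumes n: "2 \<le> n" "1 \<le> p" "p < n"
    and V: "irrep_hw n sc \<rho> lam" and lam: "\<And>i. i \<in> {1..n} \<Longrightarrow> lam i = of_int (wtI n (Iplus k p) i)"
  shows "in_PG n mu \<Longrightarrow> wmult n sc \<rho> mu = FS.dim (Mf n (int k) (int p) (\<lambda>i. if i \<in> {1..n} then \<lfloor>mu i\<rfloor> else 0))"
    and "\<not> in_PG n mu \<Longrightarrow> wmult n sc \<rho> mu = 0"
proof -
  have pn: "p \<le> n" "\<not> p = n" using n by auto
  obtain \<phi> where \<phi>: "Vector_Spaces.linear sc fscale \<phi>" "inj \<phi>"
    "\<forall>A\<in>so n. \<forall>x. \<phi> (\<rho> A x) = rM n A (\<phi> x)"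
    "MM.smod n (range \<phi>)" "range \<phi> \<subseteq> MG n (int k) (int p)" "unitf (Iplus k p) \<in> range \<phi>"
    by (rule embed_irrep[OF n(1,2) pn(1) disjI1[OF refl] V lam]) (assumption | rule that)+
  have "MG n (int k) (int p) \<subseteq> range \<phi>"
    using top_vector[OF n(1,2) pn(1) \<phi>(4) smod_MG order_refl] \<phi>(6) pn(2) by blast
  then have "range \<phi> = MG n (int k) (int p)" using \<phi>(5) by blast
  then show "in_PG n mu \<Longrightarrow> wmult n sc \<rho> mu = FS.dim (Mf n (int k) (int p) (\<lambda>i. if i \<in> {1..n} then \<lfloor>mu i\<rfloor> else 0))"
    "\<not> in_PG n mu \<Longrightarrow> wmult n sc \<rho> mu = 0"
    using wmult_image[OF \<phi>(1,2,3,5)] by (simp_all only: Mf_inter)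
qed

lemma proj_id: "f \<in> sp n p q \<mu> \<Longrightarrow> proj n \<mu> f = f"
proof
  fix I assume f: "f \<in> sp n p q \<mu>"
  show "proj n \<mu> f I = f I"
  proof (cases "f I = 0")
    case False
    then have "I \<in> widx n p q \<mu>" by (rule fsupD[OF f])
    then show ?thesis by (simp add: widx_def proj_def)
  qed (simp add: proj_def)
qed

lemma proj_add: "proj n \<mu> (f + g) = proj n \<mu> f + proj n \<mu> g"
  by (rule ext) (simp add: proj_def)

text \<open>The order of the summands is the one of is_pi_kp: the weight with negative last entry comes first.\<close>

lemma mult_pair:
  fixes sc :: "complex \<Rightarrow> 'v::ab_group_add \<Rightarrow> 'v" and sc' :: "complex \<Rightarrow> 'w::ab_group_add \<Rightarrow> 'w"
  assumes n: "2 \<le> n"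
    and V: "irrep_hw n sc \<rho> lam" and lam: "\<And>i. i \<in> {1..n} \<Longrightarrow> lam i = of_int (wtI n (Iminus k n) i)"
    and V': "irrep_hw n sc' \<sigma> lam'" and lam': "\<And>i. i \<in> {1..n} \<Longrightarrow> lam' i = of_int (wtI n (Iplus k n) i)"
  shows "in_PG n mu \<Longrightarrow> wmult n sc \<rho> mu + wmult n sc' \<sigma> mu = FS.dim (Mf n (int k) (int n) (\<lambda>i. if i \<in> {1..n} then \<lfloor>mu i\<rfloor> else 0))"
    and "\<not> in_PG n mu \<Longrightarrow> wmult n sc \<rho> mu + wmult n sc' \<sigma> mu = 0"
proof -
  have n': "1 \<le> n" using n by simp
  let ?M = "MG n (int k) (int n)" and ?\<mu> = "\<lambda>i. if i \<in> {1..n} then \<lfloor>mu i\<rfloor> else 0"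
  have ne: "Iplus k n \<noteq> Iminus k n" using wtI_Iplus_neq_Iminus[OF n, of k] by metis
  obtain \<phi> where \<phi>: "Vector_Spaces.linear sc fscale \<phi>" "inj \<phi>"
    "\<forall>A\<in>so n. \<forall>x. \<phi> (\<rho> A x) = rM n A (\<phi> x)"
    "MM.smod n (range \<phi>)" "range \<phi> \<subseteq> ?M" "unitf (Iminus k n) \<in> range \<phi>"
    "\<And>I'. I' = Iplus k n \<or> (n = n \<and> I' = Iminus k n) \<Longrightarrow> unitf I' \<in> range \<phi> \<Longrightarrow> I' = Iminus k n"
    by (rule embed_irrep[OF n n' order_refl disjI2[OF conjI[OF refl refl]] V lam]) (assumption | rule that)+
  obtain \<psi> where \<psi>: "Vector_Spaces.linear sc' fscale \<psi>" "inj \<psi>"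
    "\<forall>A\<in>so n. \<forall>x. \<psi> (\<sigma> A x) = rM n A (\<psi> x)"
    "MM.smod n (range \<psi>)" "range \<psi> \<subseteq> ?M" "unitf (Iplus k n) \<in> range \<psi>"
    "\<And>I'. I' = Iplus k n \<or> (n = n \<and> I' = Iminus k n) \<Longrightarrow> unitf I' \<in> range \<psi> \<Longrightarrow> I' = Iplus k n"
    by (rule embed_irrep[OF n n' order_refl disjI1[OF refl] V' lam']) (assumption | rule that)+
  let ?R = "range \<phi>" and ?S = "range \<psi>"
  note sR = MM.smodD(1)[OF \<phi>(4)] and sS = MM.smodD(1)[OF \<psi>(4)]
  have zero: "MM.smod n {0}"
    unfolding MM.smod_def FS.subspace_def by (auto simp: MM.rho_0 simp del: fscale_apply)
  have RS: "MM.smod n (?R \<inter> ?S)"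
    unfolding MM.smod_def
    using FS.subspace_inter[OF sR sS] MM.smodD(2)[OF \<phi>(4)] MM.smodD(2)[OF \<psi>(4)] by blast
  \<comment> \<open>A nonzero intersection would contain one of the two top monomials, but each
    range contains only its own.\<close>
  have int0: "?R \<inter> ?S \<subseteq> {0}"
  proof (rule ccontr)
    assume nz: "\<not> ?R \<inter> ?S \<subseteq> {0}"
    have "?R \<inter> ?S \<subseteq> ?M" using \<phi>(5) by (rule le_infI1)
    from top_vector[OF n n' order_refl zero RS this nz] show False
    proof (elim disjE conjE IntE)
      assume "unitf (Iplus k n) \<in> ?R"
      from \<phi>(7)[OF disjI1[OF refl] this] ne show False by contradiction
    next
      assume "unitf (Iminus k n) \<in> ?S"
      from \<psi>(7)[OF disjI2[OF conjI[OF refl refl]] this] ne[symmetric] show False by contradiction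
    qed
  qed
  let ?U = "{x + y | x y. x \<in> ?R \<and> y \<in> ?S}"
  have U: "MM.smod n ?U"
    unfolding MM.smod_def
  proof (intro conjI ballI)
    show "FS.subspace ?U" by (rule FS.subspace_sums[OF sR sS])
    show "rM n A f \<in> ?U" if A: "A \<in> so n" and f: "f \<in> ?U" for A f
    proof -
      obtain x y where "f = x + y" "x \<in> ?R" "y \<in> ?S" using f by blast
      then show ?thesis using MM.rho_add[OF A, of x y] MM.smodD(2)[OF \<phi>(4) A] MM.smodD(2)[OF \<psi>(4) A] by blast
    qed
  qed
  have "unitf (Iminus k n) + 0 \<in> ?U" "0 + unitf (Iplus k n) \<in> ?U"
    using \<phi>(6) \<psi>(6) FS.subspace_0[OF sR] FS.subspace_0[OF sS] by blast+
  then have "unitf (Iminus k n) \<in> ?U" "unitf (Iplus k n) \<in> ?U" by (simp_all only: add_0 add_0_right)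
  \<comment> \<open>The sum of the ranges contains both top monomials, so nothing of M(k,n) is left
    outside it.\<close>
  then have MU: "?M \<subseteq> ?U"
    using top_vector[OF n n' order_refl U smod_MG order_refl] by blast
  have split: "Mf n (int k) (int n) ?\<mu> = {x + y | x y. x \<in> ?R \<inter> sp n (int k) (int n) ?\<mu> \<and> y \<in> ?S \<inter> sp n (int k) (int n) ?\<mu>}"
  proof
    show "Mf n (int k) (int n) ?\<mu> \<subseteq> {x + y | x y. x \<in> ?R \<inter> sp n (int k) (int n) ?\<mu> \<and> y \<in> ?S \<inter> sp n (int k) (int n) ?\<mu>}"
    proof
      fix f assume f: "f \<in> Mf n (int k) (int n) ?\<mu>"
      then have "f \<in> ?M" "f \<in> sp n (int k) (int n) ?\<mu>" unfolding Mf_inter[symmetric] by auto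
      then obtain x y where xy: "f = x + y" "x \<in> ?R" "y \<in> ?S" using MU by blast
      have g: "x \<in> gr n (int k) (int n)" "y \<in> gr n (int k) (int n)" using xy \<phi>(5) \<psi>(5) by (auto simp: MG_def)
      \<comment> \<open>The two summands need not be weight vectors; their components of weight
        \<open>?\<mu>\<close> are, and submodules contain these.\<close>
      have "f = proj n ?\<mu> x + proj n ?\<mu> y"
        using proj_id[OF \<open>f \<in> sp n (int k) (int n) ?\<mu>\<close>] unfolding xy(1) proj_add by (rule sym)
      moreover have "proj n ?\<mu> x \<in> ?R" by (rule smod_proj[OF \<phi>(4) xy(2) g(1)]) (rule if_not_P)
      moreover have "proj n ?\<mu> y \<in> ?S" by (rule smod_proj[OF \<psi>(4) xy(3) g(2)]) (rule if_not_P)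
      ultimately show "f \<in> {x + y | x y. x \<in> ?R \<inter> sp n (int k) (int n) ?\<mu> \<and> y \<in> ?S \<inter> sp n (int k) (int n) ?\<mu>}"
        using proj_sp[OF g(1)] proj_sp[OF g(2)] by blast
    qed
    show "{x + y | x y. x \<in> ?R \<inter> sp n (int k) (int n) ?\<mu> \<and> y \<in> ?S \<inter> sp n (int k) (int n) ?\<mu>} \<subseteq> Mf n (int k) (int n) ?\<mu>"
    proof
      fix f assume "f \<in> {x + y | x y. x \<in> ?R \<inter> sp n (int k) (int n) ?\<mu> \<and> y \<in> ?S \<inter> sp n (int k) (int n) ?\<mu>}"
      then obtain x y where xy: "f = x + y" "x \<in> ?R" "y \<in> ?S"
        "x \<in> sp n (int k) (int n) ?\<mu>" "y \<in> sp n (int k) (int n) ?\<mu>" by blast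
      have "x \<in> ?M" "y \<in> ?M" using xy(2,3) \<phi>(5) \<psi>(5) by blast+
      then have "f \<in> ?M" unfolding xy(1) by (rule FS.subspace_add[OF MM.smodD(1)[OF smod_MG]])
      then show "f \<in> Mf n (int k) (int n) ?\<mu>"
        unfolding Mf_inter[symmetric] using fsup_add[OF xy(4,5)] xy(1) by blast
    qed
  qed
  have d: "FS.dim (Mf n (int k) (int n) ?\<mu>) = FS.dim (?R \<inter> sp n (int k) (int n) ?\<mu>) + FS.dim (?S \<inter> sp n (int k) (int n) ?\<mu>)"
    using int0 by (intro FS_dim_direct_sum[OF _ _ _ _ _ finite_widx split] FS.subspace_inter sR sS subspace_fsup) auto
  show "wmult n sc \<rho> mu + wmult n sc' \<sigma> mu = FS.dim (Mf n (int k) (int n) ?\<mu>)" if "in_PG n mu"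
    unfolding d wmult_image(1)[OF \<phi>(1,2,3,5) that] wmult_image(1)[OF \<psi>(1,2,3,5) that] ..
  show "wmult n sc \<rho> mu + wmult n sc' \<sigma> mu = 0" if "\<not> in_PG n mu"
    unfolding wmult_image(2)[OF \<phi>(1,2,3,5) that] wmult_image(2)[OF \<psi>(1,2,3,5) that] by simp
qed

text \<open>The half-integers disappear: \<omega>_(n-1) + \<omega>_n = (1,...,1,0), 2\<omega>_(n-1)
  = (1,...,1,-1) and 2\<omega>_n = (1,...,1,1). Hence the highest weights are exactly those of the
  top monomials.\<close>

lemma mult_pi_kp_eq:
  fixes sc :: "complex \<Rightarrow> 'v::ab_group_add \<Rightarrow> 'v" and sc' :: "complex \<Rightarrow> 'w::ab_group_add \<Rightarrow> 'w"
  assumes n: "2 \<le> n" "1 \<le> p" "p \<le> n" and pi: "is_pi_kp n k p sc \<rho> sc' \<sigma>"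
  shows "in_PG n mu \<Longrightarrow> mult_pi_kp n p sc \<rho> sc' \<sigma> mu = FS.dim (Mf n (int k) (int p) (\<lambda>i. if i \<in> {1..n} then \<lfloor>mu i\<rfloor> else 0))"
    and "\<not> in_PG n mu \<Longrightarrow> mult_pi_kp n p sc \<rho> sc' \<sigma> mu = 0"
proof -
  have IpW: "wtI n (Iplus k p) i = (if i = 1 then int k else 0) + of_bool (i \<le> p)" if "i \<in> {1..n}" for i
    using that n by (auto simp: wtI_def Iplus_def)
  have ImW: "wtI n (Iminus k n) i = (if i = 1 then int k else 0) + (if i = n then -1 else 1)" if "i \<in> {1..n}" for i
    using that n(1) by (cases "i = n") (simp add: wtI_def Iminus_def mult_2, simp add: wtI_def Iminus_def, arith)
  have "(in_PG n mu \<longrightarrow> mult_pi_kp n p sc \<rho> sc' \<sigma> mu = FS.dim (Mf n (int k) (int p) (\<lambda>i. if i \<in> {1..n} then \<lfloor>mu i\<rfloor> else 0)))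
     \<and> (\<not> in_PG n mu \<longrightarrow> mult_pi_kp n p sc \<rho> sc' \<sigma> mu = 0)"
  proof (cases "p < n")
    case True
    obtain lam where V: "irrep_hw n sc \<rho> lam" and lam: "\<And>i. i \<in> {1..n} \<Longrightarrow> lam i = of_int (wtI n (Iplus k p) i)"
    proof (cases "p \<le> n - 2")
      case 2: True
      show ?thesis
      proof (rule that)
        show "irrep_hw n sc \<rho> (wadd (wscale (real k) (eps 1)) (omega n p))" using pi 2 by (simp add: is_pi_kp_def)
        show "wadd (wscale (real k) (eps 1)) (omega n p) i = of_int (wtI n (Iplus k p) i)" if "i \<in> {1..n}" for i
          unfolding IpW[OF that] using that 2 by (simp add: wadd_def wscale_def eps_def omega_def)
      qed
    next
      case 2: False
      then have p: "p = n - 1" using True by simp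
      show ?thesis
      proof (rule that)
        show "irrep_hw n sc \<rho> (wadd (wscale (real k) (eps 1)) (wadd (omega n (n - 1)) (omega n n)))"
          using pi 2 p by (simp add: is_pi_kp_def)
        show "wadd (wscale (real k) (eps 1)) (wadd (omega n (n - 1)) (omega n n)) i = of_int (wtI n (Iplus k p) i)" if "i \<in> {1..n}" for i
          unfolding IpW[OF that] using that n(1) p by (auto simp: wadd_def wscale_def eps_def omega_def)
      qed
    qed
    then show ?thesis using mult_irreducible[OF n(1,2) True V lam] True by (simp add: mult_pi_kp_def)
  next
    case False
    then have p: "p = n" using n by simp
    have V: "irrep_hw n sc \<rho> (wadd (wscale (real k) (eps 1)) (wscale 2 (omega n (n - 1))))"
      and V': "irrep_hw n sc' \<sigma> (wadd (wscale (real k) (eps 1)) (wscale 2 (omega n n)))"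
    proof -
      have "\<not> n \<le> n - 2" "n \<noteq> n - 1" using n(1) by auto
      then show "irrep_hw n sc \<rho> (wadd (wscale (real k) (eps 1)) (wscale 2 (omega n (n - 1))))"
        "irrep_hw n sc' \<sigma> (wadd (wscale (real k) (eps 1)) (wscale 2 (omega n n)))"
        using pi p by (simp_all add: is_pi_kp_def)
    qed
    have lam: "wadd (wscale (real k) (eps 1)) (wscale 2 (omega n (n - 1))) i = of_int (wtI n (Iminus k n) i)" if "i \<in> {1..n}" for i
      unfolding ImW[OF that] using that n(1) by (auto simp: wadd_def wscale_def eps_def omega_def)
    have lam': "wadd (wscale (real k) (eps 1)) (wscale 2 (omega n n)) i = of_int (wtI n (Iplus k n) i)" if "i \<in> {1..n}" for i
      unfolding IpW[unfolded p, OF that] using that n(1) by (auto simp: wadd_def wscale_def eps_def omega_def)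
    show ?thesis using mult_pair[OF n(1) V lam V' lam'] p by (simp add: mult_pi_kp_def)
  qed
  then show "in_PG n mu \<Longrightarrow> mult_pi_kp n p sc \<rho> sc' \<sigma> mu = FS.dim (Mf n (int k) (int p) (\<lambda>i. if i \<in> {1..n} then \<lfloor>mu i\<rfloor> else 0))"
    "\<not> in_PG n mu \<Longrightarrow> mult_pi_kp n p sc \<rho> sc' \<sigma> mu = 0" by blast+
qed

theorem theorem4p1:
  fixes n k p :: nat
    and sc :: "complex \<Rightarrow> 'v::ab_group_add \<Rightarrow> 'v" and \<rho> :: "cmat \<Rightarrow> 'v \<Rightarrow> 'v"
    and sc' :: "complex \<Rightarrow> 'w::ab_group_add \<Rightarrow> 'w" and \<sigma> :: "cmat \<Rightarrow> 'w \<Rightarrow> 'w"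
    and mu :: "nat \<Rightarrow> real"
  assumes "2 \<le> n" and "1 \<le> p" and "p \<le> n"
    and "is_pi_kp n k p sc \<rho> sc' \<sigma>"
  shows "(in_PG n mu \<longrightarrow>
            (if (\<exists>r::nat. (real k + real p - wnorm n mu) / 2 = real r)
             then int (mult_pi_kp n p sc \<rho> sc' \<sigma> mu)
                    = mult_formula n p \<lfloor>(real k + real p - wnorm n mu) / 2\<rfloor> (Zc n mu)
             else mult_pi_kp n p sc \<rho> sc' \<sigma> mu = 0))
       \<and> (in_Pg n mu \<and> \<not> in_PG n mu \<longrightarrow> mult_pi_kp n p sc \<rho> sc' \<sigma> mu = 0)"
proof -
  \<comment> \<open>Weights of monomials are 0 outside {1..n} by convention, while \<open>mu\<close>
    is arbitrary there.\<close>
  define \<mu> where "\<mu> = (\<lambda>i. if i \<in> {1..n} then \<lfloor>mu i\<rfloor> else 0)"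
  have \<mu>0: "\<mu> i = 0" if "i \<notin> {1..n}" for i unfolding \<mu>_def by (rule if_not_P[OF that])
  note mult = mult_pi_kp_eq[OF assms, of mu, folded \<mu>_def]
  have main: "if (\<exists>r::nat. (real k + real p - wnorm n mu) / 2 = real r)
     then int (mult_pi_kp n p sc \<rho> sc' \<sigma> mu)
        = mult_formula n p \<lfloor>(real k + real p - wnorm n mu) / 2\<rfloor> (Zc n mu)
     else mult_pi_kp n p sc \<rho> sc' \<sigma> mu = 0" if PG: "in_PG n mu"
  proof -
    have real: "mu i = of_int (\<mu> i)" if "i \<in> {1..n}" for i
      using PG that by (auto simp: in_PG_def \<mu>_def elim!: Ints_cases ballE)
    have norm: "wnorm n mu = of_int (\<Sum>i=1..n. \<bar>\<mu> i\<bar>)"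
      unfolding wnorm_def of_int_sum using real by (intro sum.cong refl) simp
    have Z: "Zc n mu = card {i \<in> {1..n}. \<mu> i = 0}"
      unfolding Zc_def using real by (intro arg_cong[of _ _ card]) auto
    show ?thesis
    proof (cases "\<exists>r::nat. (real k + real p - wnorm n mu) / 2 = real r")
      case True
      then obtain r :: nat where r: "(real k + real p - wnorm n mu) / 2 = real r" by blast
      then have "of_int (int k + int p - (\<Sum>i=1..n. \<bar>\<mu> i\<bar>)) = (of_int (2 * int r) :: real)"
        unfolding norm by simp
      then have r': "int k + int p - (\<Sum>i=1..n. \<bar>\<mu> i\<bar>) = 2 * int r" by (simp only: of_int_eq_iff)
      have "int (mult_pi_kp n p sc \<rho> sc' \<sigma> mu) = mult_formula n p (int r) (Zc n mu)"
        unfolding mult(1)[OF PG] using dim_Mf[of n p k \<mu>] character_formula[OF assms(1-3) \<mu>0 r' Z] assms(1-3)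
        by simp
      then show ?thesis using True r by simp
    next
      case False
      \<comment> \<open>The weight of any monomial of this bidegree differs in norm from k + p by a
        non-negative even number, so none has weight \<mu>.\<close>
      have "widx n (int k) (int p) \<mu> = {}"
      proof (rule ccontr)
        assume "widx n (int k) (int p) \<mu> \<noteq> {}"
        then obtain r :: nat where r: "int k + int p - (\<Sum>i=1..n. \<bar>\<mu> i\<bar>) = 2 * int r" using widx_parity by blast
        have "real k + real p - wnorm n mu = of_int (int k + int p - (\<Sum>i=1..n. \<bar>\<mu> i\<bar>))" unfolding norm by simp
        then have "(real k + real p - wnorm n mu) / 2 = real r" unfolding r by simp
        then show False using False by blast
      qed
      then have "FS.dim (Mf n (int k) (int p) \<mu>) = 0" by (intro dim_zero_space) (auto simp: Mf_def)
      then show ?thesis unfolding mult(1)[OF PG] using False by auto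
    qed
  qed
  then show ?thesis using mult(2) by blast
qed

end
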